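(* Let $X_\bullet$ and $Y_\bullet$ be simplicial spaces, and let $(X\times Y)_\bullet$ be their levelwise product, $(X\times Y)_p=X_p\times Y_p$. Then the map $$\|(X\times Y)_\bullet\|\longrightarrow\|X_\bullet\|\times\|Y_\bullet\|$$ induced by the two projection maps $(X\times Y)_\bullet\to X_\bullet$ and $(X\times Y)_\bullet\to Y_\bullet$ is a weak homotopy equivalence.
   Context: All spaces are compactly generated (no Hausdorff condition), and products are formed in that category. A simplicial space is a functor $\Delta^{op}\to\mathrm{Top}$, with face maps $d_i$ and degeneracy maps. For a simplicial space, $\|X_\bullet\|$ denotes the fat geometric realisation, which uses only the face maps: $\|X_\bullet\| = \left(\coprod_p X_p \times \Delta^p\right)/((x, d^i t) \sim (d_i x, t))$, where $d^i:\Delta^{p-1}\to\Delta^p$ is the $i$-th coface inclusion. *)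

theory Defs
  imports "HOL-Analysis.Analysis" "HOL-Homology.Simplices" "HOL-Library.Equipollence"
begin

section \<open>Compactly generated spaces\<close>

text \<open>
  No separation axiom is imposed: a set is k-open if its preimage under every continuous map from a
  compact Hausdorff space is open.  HOL cannot quantify over the type of the test space inside a
  definition, so the test spaces are taken on one type that is large enough;
  the lemma \<open>k_openin_test\<close> below shows that test spaces on any other type give no further
  condition.  The library's \<open>k_space\<close> and \<open>kification\<close> test with compact subspaces
  that need not be Hausdorff, which is a different notion when the space is not Hausdorff.
\<close>

definition k_openin :: "'a topology \<Rightarrow> 'a set \<Rightarrow> bool" where
  "k_openin X U \<longleftrightarrow> U \<subseteq> topspace X \<and>
     (\<forall>(K :: ('a \<times> nat) set set topology) t.
        compact_space K \<and> Hausdorff_space K \<and> continuous_map K X t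
          \<longrightarrow> openin K {k \<in> topspace K. t k \<in> U})"

definition compactly_generated :: "'a topology \<Rightarrow> bool" where
  "compactly_generated X \<longleftrightarrow> (\<forall>U. k_openin X U \<longrightarrow> openin X U)"

definition cg_kification :: "'a topology \<Rightarrow> 'a topology" where
  "cg_kification X = topology (k_openin X)"

definition cg_prod :: "'a topology \<Rightarrow> 'b topology \<Rightarrow> ('a \<times> 'b) topology" where
  "cg_prod X Y = cg_kification (prod_topology X Y)"

lemma istopology_k_openin: "istopology (k_openin X)"
  unfolding istopology_def
proof (intro conjI allI impI)
  fix S T assume S: "k_openin X S" and T: "k_openin X T"
  have eq: "{k \<in> topspace K. t k \<in> S \<inter> T} = {k \<in> topspace K. t k \<in> S} \<inter> {k \<in> topspace K. t k \<in> T}"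
    for K :: "('a \<times> nat) set set topology" and t
    by auto
  show "k_openin X (S \<inter> T)"
    using S T unfolding k_openin_def eq by (auto intro!: openin_Int)
next
  fix \<K> assume \<K>: "\<forall>S\<in>\<K>. k_openin X S"
  have eq: "{k \<in> topspace K. t k \<in> \<Union>\<K>} = \<Union>((\<lambda>S. {k \<in> topspace K. t k \<in> S}) ` \<K>)"
    for K :: "('a \<times> nat) set set topology" and t
    by auto
  show "k_openin X (\<Union>\<K>)"
    using \<K> unfolding k_openin_def eq by (auto intro!: openin_Union)
qed

lemma openin_cg_kification: "openin (cg_kification X) U \<longleftrightarrow> k_openin X U"
  by (simp add: cg_kification_def istopology_k_openin)

lemma openin_imp_k_openin: "openin X U \<Longrightarrow> k_openin X U"
  by (auto simp: k_openin_def dest: openin_subset intro: openin_continuous_map_preimage)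

lemma topspace_cg_kification [simp]: "topspace (cg_kification X) = topspace X"
  by (metis k_openin_def openin_imp_k_openin openin_cg_kification openin_subset openin_topspace subset_antisym)

text \<open>Cardinality bookkeeping on the type \<open>('a \<times> nat) set\<close>.\<close>

lemma lists_lepoll_test:
  assumes "P \<lesssim> (UNIV :: ('a \<times> nat) set set)"
  shows "lists P \<lesssim> (UNIV :: ('a \<times> nat) set set)"
proof -
  define e :: "('a \<times> nat) set list \<Rightarrow> ('a \<times> nat) set" where
    "e xs = {(a, k). k = prod_encode (0, length xs) \<or>
              (\<exists>i m. i < length xs \<and> k = prod_encode (Suc i, m) \<and> (a, m) \<in> xs ! i)}" for xs
  have len: "(a, prod_encode (0, n)) \<in> e xs \<longleftrightarrow> n = length xs" for a n xs
    by (auto simp: e_def)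
  have nth: "i < length xs \<Longrightarrow> (a, prod_encode (Suc i, m)) \<in> e xs \<longleftrightarrow> (a, m) \<in> xs ! i" for a i m xs
    by (auto simp: e_def)
  have "inj e"
  proof (rule injI)
    fix xs ys assume eq: "e xs = e ys"
    then have "length xs = length ys"
      by (metis len)
    then show "xs = ys"
      by (metis eq nth nth_equalityI subset_antisym subrelI)
  qed
  then have "lists (UNIV :: ('a \<times> nat) set set) \<lesssim> (UNIV :: ('a \<times> nat) set set)"
    unfolding lepoll_def by auto
  then show ?thesis
    using assms lepoll_trans lists_lepoll_mono by blast
qed

lemma UN_lepoll_test:
  assumes I: "I \<lesssim> (UNIV :: ('a \<times> nat) set set)"
    and F: "\<And>i. i \<in> I \<Longrightarrow> F i \<lesssim> (UNIV :: ('a \<times> nat) set set)"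
  shows "(\<Union>i\<in>I. F i) \<lesssim> (UNIV :: ('a \<times> nat) set set)"
proof -
  obtain s where s: "I \<subseteq> range (s :: ('a \<times> nat) set \<Rightarrow> _)"
    using I by (auto simp: lepoll_iff)
  have "\<forall>i\<in>I. \<exists>r. F i \<subseteq> range (r :: ('a \<times> nat) set \<Rightarrow> _)"
    using F by (auto simp: lepoll_iff)
  then obtain r where r: "\<And>i. i \<in> I \<Longrightarrow> F i \<subseteq> range (r i :: ('a \<times> nat) set \<Rightarrow> _)"
    by metis
  have "(\<Union>i\<in>I. F i) \<subseteq> (\<lambda>l. r (s (l ! 0)) (l ! 1)) ` lists (UNIV :: ('a \<times> nat) set set)"
  proof
    fix x assume "x \<in> (\<Union>i\<in>I. F i)"
    then obtain i where i: "i \<in> I" "x \<in> F i" by auto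
    then obtain c d where "i = s c" "x = r i d" using s r by blast
    then have "x = (\<lambda>l. r (s (l ! 0)) (l ! 1)) [c, d]" by simp
    then show "x \<in> (\<lambda>l. r (s (l ! 0)) (l ! 1)) ` lists (UNIV :: ('a \<times> nat) set set)"
      by blast
  qed
  then have "(\<Union>i\<in>I. F i) \<lesssim> lists (UNIV :: ('a \<times> nat) set set)"
    by (rule subset_image_lepoll)
  also have "\<dots> \<lesssim> (UNIV :: ('a \<times> nat) set set)"
    by (rule lists_lepoll_test) simp
  finally show ?thesis .
qed

lemma Times_lepoll_test:
  assumes "P \<lesssim> (UNIV :: ('a \<times> nat) set set)" "Q \<lesssim> (UNIV :: ('a \<times> nat) set set)"
  shows "P \<times> Q \<lesssim> (UNIV :: ('a \<times> nat) set set)"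
proof -
  have "(\<Union>p\<in>P. Pair p ` Q) \<lesssim> (UNIV :: ('a \<times> nat) set set)"
    using assms by (intro UN_lepoll_test) (auto intro: lepoll_trans[OF image_lepoll])
  also have "(\<Union>p\<in>P. Pair p ` Q) = P \<times> Q" by auto
  finally show ?thesis .
qed

lemma nat_lepoll_test: "(UNIV :: nat set) \<lesssim> (UNIV :: ('a \<times> nat) set set)"
proof -
  have "inj (\<lambda>n. {(undefined :: 'a, n)})" by (auto simp: inj_def)
  then show ?thesis unfolding lepoll_def by blast
qed

lemma countable_lepoll_test: "countable P \<Longrightarrow> P \<lesssim> (UNIV :: ('a \<times> nat) set set)"
  by (metis countableE inj_on_def lepoll_def lepoll_trans nat_lepoll_test top_greatest)

lemma Un_lepoll_test:
  assumes "P \<lesssim> (UNIV :: ('a \<times> nat) set set)" "Q \<lesssim> (UNIV :: ('a \<times> nat) set set)"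
  shows "P \<union> Q \<lesssim> (UNIV :: ('a \<times> nat) set set)"
proof -
  have "(\<Union>b\<in>(UNIV::bool set). if b then P else Q) \<lesssim> (UNIV :: ('a \<times> nat) set set)"
    using assms by (intro UN_lepoll_test) (auto intro: countable_lepoll_test)
  then show ?thesis by (simp add: UNIV_bool Un_commute)
qed

lemma set_lepoll_test: "(P :: 'a set set) \<lesssim> (UNIV :: ('a \<times> nat) set set)"
proof -
  have "inj_on (\<lambda>S. S \<times> {0 :: nat}) P"
    by (rule inj_on_inverseI[where g = "\<lambda>T. fst ` T"]) simp
  then show ?thesis unfolding lepoll_def by blast
qed

lemma real_lepoll_test: "(UNIV :: real set) \<lesssim> (UNIV :: ('a \<times> nat) set set)"
proof -
  obtain c :: "rat \<Rightarrow> nat" where c: "inj c"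
    using countableE by blast
  define j where "j x = {(undefined :: 'a, c q) | q. real_of_rat q < x}" for x :: real
  have mem: "(undefined, c q) \<in> j x \<longleftrightarrow> real_of_rat q < x" for q x
    using c by (auto simp: j_def inj_def)
  have "inj j"
  proof (rule injI)
    fix x y assume "j x = j y"
    then have "real_of_rat q < x \<longleftrightarrow> real_of_rat q < y" for q
      by (metis mem)
    then show "x = y"
      by (metis linorder_neqE of_rat_dense order_less_asym)
  qed
  then show ?thesis unfolding lepoll_def by blast
qed

lemma fun_lepoll_test: "(UNIV :: (('a \<times> nat) set \<Rightarrow> real) set) \<lesssim> (UNIV :: ('a \<times> nat) set set set)"
proof -
  have "(UNIV :: (('a \<times> nat) set \<times> real) set) \<lesssim> (UNIV :: ('a \<times> nat) set set)"
    using Times_lepoll_test[OF lepoll_refl real_lepoll_test] by simp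
  then obtain e :: "('a \<times> nat) set \<times> real \<Rightarrow> ('a \<times> nat) set" where e: "inj e"
    unfolding lepoll_def by auto
  have "inj (\<lambda>h. (\<lambda>c. e (c, h c)) ` UNIV)"
  proof (rule injI)
    fix h h' assume eq: "range (\<lambda>c. e (c, h c)) = range (\<lambda>c. e (c, h' c))"
    show "h = h'"
    proof
      fix c
      have "e (c, h c) \<in> range (\<lambda>c. e (c, h' c))" using eq by blast
      then show "h c = h' c" using e by (auto simp: inj_def)
    qed
  qed
  then show ?thesis unfolding lepoll_def by blast
qed

text \<open>
  Given a test space of arbitrary size, a quotient of it is formed by a family \<open>\<Phi>\<close> of real functions
  that is closed under enough choices for the test map to descend (up to topological
  indistinguishability) but small enough for the quotient to live on the type \<open>('a \<times> nat) set set\<close>.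
\<close>

lemma k_openin_test:
  fixes X :: "'a topology" and K :: "'k topology"
  assumes U: "k_openin X U" and comp: "compact_space K" and Haus: "Hausdorff_space K"
    and f: "continuous_map K X f"
  shows "openin K {k \<in> topspace K. f k \<in> U}"
proof (rule ccontr)
  assume "\<not> openin K {k \<in> topspace K. f k \<in> U}"
  then obtain k0 where k0: "k0 \<in> topspace K" "f k0 \<in> U"
    and k0_lim: "\<And>W. openin K W \<Longrightarrow> k0 \<in> W \<Longrightarrow> \<exists>s\<in>W. f s \<notin> U"
    using openin_subopen[of K "{k \<in> topspace K. f k \<in> U}"] by (smt (verit) mem_Collect_eq openin_subset subset_eq)
  define pre where "pre V = {y \<in> topspace K. f y \<in> V}" for V
  have pre: "openin K (pre V)" if "openin X V" for V
    unfolding pre_def using openin_continuous_map_preimage[OF f that] .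
  have creg: "completely_regular_space K"
    using comp Haus compact_Hausdorff_or_regular_imp_normal_space normal_imp_completely_regular_space by blast
  have "\<exists>\<psi>. openin K W \<and> x \<in> W \<longrightarrow> continuous_map K euclideanreal \<psi> \<and> \<psi> x \<noteq> 0 \<and> (\<forall>y \<in> topspace K - W. \<psi> y = 0)" for x W
  proof (cases "openin K W \<and> x \<in> W")
    case True
    then obtain g where g: "continuous_map K euclideanreal g" "g x = 0" "g ` (topspace K - W) \<subseteq> {1}"
      using creg unfolding completely_regular_space_alt' by meson
    then show ?thesis
      by (intro exI[of _ "\<lambda>y. 1 - g y"]) (auto intro!: continuous_intros)
  qed auto
  note * = this
  have "\<exists>u. \<forall>x W. openin K W \<and> x \<in> W \<longrightarrow>
      continuous_map K euclideanreal (u x W) \<and> u x W x \<noteq> 0 \<and> (\<forall>y \<in> topspace K - W. u x W y = 0)"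
    by (rule choice, rule allI, rule choice, rule allI, rule *)
  then obtain u where u': "\<forall>x W. openin K W \<and> x \<in> W \<longrightarrow>
      continuous_map K euclideanreal (u x W) \<and> u x W x \<noteq> 0 \<and> (\<forall>y \<in> topspace K - W. u x W y = 0)"
    by (rule exE)
  have u: "continuous_map K euclideanreal (u x W) \<and> u x W x \<noteq> 0 \<and> (\<forall>y \<in> topspace K - W. u x W y = 0)"
    if "openin K W" "x \<in> W" for x W
    using u'[rule_format, OF conjI, OF that] by simp
  define strict :: "(('k \<Rightarrow> real) \<times> real \<times> real) list \<Rightarrow> 'k set" where
    "strict ds = {x \<in> topspace K. \<forall>(\<phi>, q, r) \<in> set ds. \<bar>\<phi> x - q\<bar> < r}" for ds
  define weak :: "(('k \<Rightarrow> real) \<times> real \<times> real) list \<Rightarrow> 'k set" where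
    "weak ds = {x \<in> topspace K. \<forall>(\<phi>, q, r) \<in> set ds. \<bar>\<phi> x - q\<bar> \<le> r}" for ds
  have strict_weak: "strict ds \<subseteq> weak ds" for ds
    unfolding strict_def weak_def by force
  have strict_open: "openin K (strict ds)" if "\<And>\<phi> q r. (\<phi>, q, r) \<in> set ds \<Longrightarrow> continuous_map K euclideanreal \<phi>" for ds
    using that
  proof (induction ds)
    case Nil
    then show ?case by (simp add: strict_def)
  next
    case (Cons d ds)
    obtain \<phi> q r where d: "d = (\<phi>, q, r)" by (cases d)
    have \<phi>: "continuous_map K euclideanreal \<phi>" using Cons.prems d by auto
    have "openin K {x \<in> topspace K. (\<lambda>x. \<bar>\<phi> x - q\<bar>) x \<in> {..<r}}"
      by (rule openin_continuous_map_preimage[where Y = euclideanreal]) (auto intro!: continuous_intros \<phi>)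
    moreover have "strict (d # ds) = {x \<in> topspace K. (\<lambda>x. \<bar>\<phi> x - q\<bar>) x \<in> {..<r}} \<inter> strict ds"
      by (auto simp: strict_def d)
    ultimately show ?case using Cons by (auto intro!: openin_Int)
  qed
  have weak_closed: "closedin K (weak ds)" if "\<And>\<phi> q r. (\<phi>, q, r) \<in> set ds \<Longrightarrow> continuous_map K euclideanreal \<phi>" for ds
    using that
  proof (induction ds)
    case Nil
    then show ?case by (simp add: weak_def)
  next
    case (Cons d ds)
    obtain \<phi> q r where d: "d = (\<phi>, q, r)" by (cases d)
    have \<phi>: "continuous_map K euclideanreal \<phi>" using Cons.prems d by auto
    have "closedin K {x \<in> topspace K. (\<lambda>x. \<bar>\<phi> x - q\<bar>) x \<in> {..r}}"
      by (rule closedin_continuous_map_preimage[where Y = euclideanreal]) (auto intro!: continuous_intros \<phi>)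
    moreover have "weak (d # ds) = {x \<in> topspace K. (\<lambda>x. \<bar>\<phi> x - q\<bar>) x \<in> {..r}} \<inter> weak ds"
      by (auto simp: weak_def d)
    ultimately show ?case using Cons by (auto intro!: closedin_Int)
  qed

  define pt where "pt ds = (if \<exists>s. s \<in> strict ds \<and> f s \<notin> U then SOME s. s \<in> strict ds \<and> f s \<notin> U else k0)" for ds
  have pt: "pt ds = k0 \<or> pt ds \<in> strict ds \<and> f (pt ds) \<notin> U" for ds
    using someI_ex[of "\<lambda>s. s \<in> strict ds \<and> f s \<notin> U"] by (simp add: pt_def)
  have pt_K: "pt ds \<in> topspace K" for ds
    using pt[of ds] k0 by (auto simp: strict_def)
  have pt_near: "pt ds \<in> strict ds \<and> f (pt ds) \<notin> U" if "\<exists>s. s \<in> strict ds \<and> f s \<notin> U" for ds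
    using someI_ex[OF that] that by (simp add: pt_def)

  define good where "good ds Us \<Psi> \<longleftrightarrow> finite \<Psi> \<and> (\<forall>\<psi>\<in>\<Psi>. continuous_map K euclideanreal \<psi>) \<and>
      (\<forall>x \<in> weak ds. \<exists>\<psi>\<in>\<Psi>. \<exists>V \<in> set Us. \<psi> x \<noteq> 0 \<and> (\<forall>y \<in> topspace K - pre V. \<psi> y = 0))"
    for ds and Us :: "'a set list" and \<Psi> :: "('k \<Rightarrow> real) set"
  define Psi where "Psi ds Us = (if Ex (good ds Us) then SOME \<Psi>. good ds Us \<Psi> else {})" for ds Us
  have Psi: "good ds Us (Psi ds Us)"
    if ds: "\<And>\<phi> q r. (\<phi>, q, r) \<in> set ds \<Longrightarrow> continuous_map K euclideanreal \<phi>"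
      and Us: "\<And>V. V \<in> set Us \<Longrightarrow> openin X V" and cov: "weak ds \<subseteq> (\<Union>V \<in> set Us. pre V)" for ds Us
  proof -
    have "compactin K (weak ds)"
      by (rule closedin_compact_space[OF comp weak_closed]) (rule ds)
    moreover define Idx where "Idx = {(x, V). V \<in> set Us \<and> x \<in> pre V}"
    moreover define N where "N = (\<lambda>(x, V). {y \<in> topspace K. u x (pre V) y \<in> - {0}})"
    have Idx: "V \<in> set Us" "openin K (pre V)" "x \<in> pre V" if "(x, V) \<in> Idx" for x V
      using that Us pre by (auto simp: Idx_def)
    have "openin K O'" if O': "O' \<in> N ` Idx" for O'
    proof -
      obtain x V where xV: "O' = N (x, V)" "(x, V) \<in> Idx"
        using O' by auto
      show ?thesis
        unfolding xV(1) N_def prod.case using u[OF Idx(2,3)[OF xV(2)]]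
        by (intro openin_continuous_map_preimage[where Y = euclideanreal]) auto
    qed
    moreover have "weak ds \<subseteq> \<Union>(N ` Idx)"
    proof
      fix x assume "x \<in> weak ds"
      then obtain V where V: "(x, V) \<in> Idx" using cov by (auto simp: Idx_def)
      then have "x \<in> N (x, V)"
        using u[OF Idx(2,3)[OF V]] Idx(3)[OF V] by (auto simp: N_def pre_def)
      then show "x \<in> \<Union>(N ` Idx)" using V by blast
    qed
    ultimately obtain \<F> where \<F>: "finite \<F>" "\<F> \<subseteq> N ` Idx" "weak ds \<subseteq> \<Union>\<F>"
      unfolding compactin_def by meson
    then obtain J where J: "finite J" "J \<subseteq> Idx" "\<F> = N ` J"
      by (meson finite_subset_image)
    have "good ds Us ((\<lambda>(x, V). u x (pre V)) ` J)"
      unfolding good_def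
    proof (intro conjI ballI)
      show "finite ((\<lambda>(x, V). u x (pre V)) ` J)" using J by simp
    next
      fix \<psi> assume "\<psi> \<in> (\<lambda>(x, V). u x (pre V)) ` J"
      then obtain x V where "\<psi> = u x (pre V)" "(x, V) \<in> Idx" using J by auto
      then show "continuous_map K euclideanreal \<psi>" using u[OF Idx(2,3)] by simp
    next
      fix y assume "y \<in> weak ds"
      then obtain x V where xV: "(x, V) \<in> J" "y \<in> N (x, V)" using \<F>(3) J(3) by auto
      then have I: "(x, V) \<in> Idx" using J by auto
      have "u x (pre V) \<in> (\<lambda>(x, V). u x (pre V)) ` J" using xV by force
      moreover have "u x (pre V) y \<noteq> 0" using xV by (simp add: N_def)
      moreover have "\<forall>z \<in> topspace K - pre V. u x (pre V) z = 0" using u[OF Idx(2,3)[OF I]] by simp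
      ultimately show "\<exists>\<psi>\<in>(\<lambda>(x, V). u x (pre V)) ` J. \<exists>V \<in> set Us. \<psi> y \<noteq> 0 \<and> (\<forall>z \<in> topspace K - pre V. \<psi> z = 0)"
        using Idx(1)[OF I] by blast
    qed
    then have "Ex (good ds Us)" ..
    then show ?thesis
      unfolding Psi_def using someI_ex[of "good ds Us"] by simp
  qed
  have Psi_or: "good ds Us (Psi ds Us) \<or> Psi ds Us = {}" for ds Us
    using someI_ex[of "good ds Us"] by (simp add: Psi_def)
  have Psi_cont: "continuous_map K euclideanreal \<psi>" if "\<psi> \<in> Psi ds Us" for ds Us \<psi>
    using that Psi_or[of ds Us] by (auto simp: good_def)
  have Psi_fin: "finite (Psi ds Us)" for ds Us
    using Psi_or[of ds Us] by (auto simp: good_def)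

  define Bd where "Bd x = (\<lambda>V. u x (pre V)) ` {V. openin X V \<and> f x \<in> V}" for x
  define Gd where "Gd ds = Bd (pt ds) \<union> (if pt ds = k0 then {} else {u (pt ds) (topspace K - {k0})}) \<union>
      (\<Union>Us \<in> lists {V. openin X V}. Psi ds Us)" for ds
  define G where "G P = P \<union> (\<Union>ds \<in> lists (P \<times> UNIV \<times> UNIV). Gd ds)" for P
  define \<Phi>n where "\<Phi>n n = (G ^^ n) (Bd k0)" for n
  define \<Phi> where "\<Phi> = (\<Union>n. \<Phi>n n)"
  have openk0: "openin K (topspace K - {k0})"
    using Haus k0 by (simp add: Hausdorff_imp_t1_space closedin_t1_singleton openin_diff)
  have Bd_cont: "continuous_map K euclideanreal \<phi>" if "\<phi> \<in> Bd x" "x \<in> topspace K" for \<phi> x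
    using that u pre by (auto simp: Bd_def pre_def)
  have Gd_cont: "continuous_map K euclideanreal \<phi>" if "\<phi> \<in> Gd ds" for \<phi> ds
    using that Bd_cont pt_K[of ds] Psi_cont u[OF openk0, of "pt ds"] by (auto simp: Gd_def split: if_splits)
  have "\<forall>\<phi>\<in>\<Phi>n n. continuous_map K euclideanreal \<phi>" for n
    by (induction n) (use Bd_cont k0 Gd_cont in \<open>auto simp: \<Phi>n_def G_def\<close>)
  then have \<Phi>_cont: "\<phi> \<in> \<Phi> \<Longrightarrow> continuous_map K euclideanreal \<phi>" for \<phi>
    by (auto simp: \<Phi>_def)
  have Bd_small: "Bd x \<lesssim> (UNIV :: ('a \<times> nat) set set)" for x
    unfolding Bd_def by (rule lepoll_trans[OF image_lepoll set_lepoll_test])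
  have Gd_small: "Gd ds \<lesssim> (UNIV :: ('a \<times> nat) set set)" for ds
    unfolding Gd_def
    by (intro Un_lepoll_test UN_lepoll_test Bd_small lists_lepoll_test set_lepoll_test countable_lepoll_test)
      (use Psi_fin in \<open>auto intro: countable_finite\<close>)
  have "\<Phi>n n \<lesssim> (UNIV :: ('a \<times> nat) set set)" for n
  proof (induction n)
    case 0
    then show ?case by (simp add: \<Phi>n_def Bd_small)
  next
    case (Suc n)
    have "G (\<Phi>n n) \<lesssim> (UNIV :: ('a \<times> nat) set set)"
      unfolding G_def UNIV_Times_UNIV[symmetric]
      by (intro Un_lepoll_test UN_lepoll_test lists_lepoll_test Times_lepoll_test Gd_small Suc real_lepoll_test)
    then show ?case by (simp add: \<Phi>n_def)
  qed
  then have \<Phi>_small: "\<Phi> \<lesssim> (UNIV :: ('a \<times> nat) set set)"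
    unfolding \<Phi>_def by (intro UN_lepoll_test nat_lepoll_test)
  have mono: "m \<le> n \<Longrightarrow> \<Phi>n m \<subseteq> \<Phi>n n" for m n
    using lift_Suc_mono_le[of \<Phi>n m n] by (simp add: \<Phi>n_def G_def)
  have Gd_\<Phi>: "Gd ds \<subseteq> \<Phi>" if ds: "ds \<in> lists (\<Phi> \<times> UNIV \<times> UNIV)" for ds
  proof -
    have "\<exists>n. ds \<in> lists (\<Phi>n n \<times> UNIV \<times> UNIV)"
      using ds
    proof (induction ds)
      case (Cons d ds)
      obtain m where m: "ds \<in> lists (\<Phi>n m \<times> UNIV \<times> UNIV)" using Cons by auto
      obtain n where n: "d \<in> \<Phi>n n \<times> UNIV \<times> UNIV" using Cons by (auto simp: \<Phi>_def)
      have sub: "\<Phi>n m \<subseteq> \<Phi>n (max m n)" "\<Phi>n n \<subseteq> \<Phi>n (max m n)"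
        using mono by simp_all
      have "ds \<in> lists (\<Phi>n (max m n) \<times> UNIV \<times> UNIV)"
        using m lists_mono[OF Sigma_mono[OF sub(1) order_refl]] by (rule rev_subsetD)
      moreover have "d \<in> \<Phi>n (max m n) \<times> UNIV \<times> UNIV"
        using n sub(2) by auto
      ultimately have "d # ds \<in> lists (\<Phi>n (max m n) \<times> UNIV \<times> UNIV)"
        by (rule lists.Cons[rotated])
      then show ?case ..
    qed auto
    then obtain n where "ds \<in> lists (\<Phi>n n \<times> UNIV \<times> UNIV)" ..
    then have "Gd ds \<subseteq> \<Phi>n (Suc n)" by (auto simp: \<Phi>n_def G_def)
    then show ?thesis by (auto simp: \<Phi>_def)
  qed

  define C where "C x = {y \<in> topspace K. \<forall>\<phi>\<in>\<Phi>. \<phi> y = \<phi> x}" for x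
  have ds_cont: "continuous_map K euclideanreal \<phi>" if "ds \<in> lists (\<Phi> \<times> UNIV \<times> UNIV)" "(\<phi>, q, r) \<in> set ds" for ds \<phi> q r
    using that \<Phi>_cont by (auto simp: in_lists_conv_set)
  have nbhd: "\<exists>ds \<in> lists (\<Phi> \<times> UNIV \<times> UNIV). x \<in> strict ds \<and> weak ds \<subseteq> W"
    if W: "openin K W" and x: "x \<in> topspace K" "C x \<subseteq> W" for x W
  proof -
    have "compactin K (topspace K - W)"
      using comp W by (intro closedin_compact_space) auto
    moreover define B :: "('k \<Rightarrow> real) \<times> real \<Rightarrow> 'k set" where "B = (\<lambda>(\<phi>, r). {y \<in> topspace K. \<bar>\<phi> y - \<phi> x\<bar> \<in> {r<..}})"
    have "openin K V" if VB: "V \<in> B ` (\<Phi> \<times> {0 <..})" for V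
    proof -
      obtain \<phi> r where V: "V = {y \<in> topspace K. (\<lambda>y. \<bar>\<phi> y - \<phi> x\<bar>) y \<in> {r<..}}" "\<phi> \<in> \<Phi>"
        using VB by (auto simp: B_def)
      note \<phi> = \<Phi>_cont[OF V(2)]
      show ?thesis unfolding V(1)
        by (rule openin_continuous_map_preimage[where Y = euclideanreal]) (auto intro!: continuous_intros \<phi>)
    qed
    moreover have "topspace K - W \<subseteq> \<Union>(B ` (\<Phi> \<times> {0 <..}))"
    proof
      fix y assume y: "y \<in> topspace K - W"
      then obtain \<phi> where \<phi>: "\<phi> \<in> \<Phi>" "\<phi> y \<noteq> \<phi> x" using x by (auto simp: C_def)
      then have "y \<in> B (\<phi>, \<bar>\<phi> y - \<phi> x\<bar> / 2)" "(\<phi>, \<bar>\<phi> y - \<phi> x\<bar> / 2) \<in> \<Phi> \<times> {0 <..}"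
        using y by (auto simp: B_def)
      then show "y \<in> \<Union>(B ` (\<Phi> \<times> {0 <..}))" by blast
    qed
    ultimately obtain \<F> where \<F>: "finite \<F>" "\<F> \<subseteq> B ` (\<Phi> \<times> {0 <..})" "topspace K - W \<subseteq> \<Union>\<F>"
      unfolding compactin_def by meson
    then obtain I where I: "finite I" "I \<subseteq> \<Phi> \<times> {0 <..}" "\<F> = B ` I"
      by (meson finite_subset_image)
    obtain rs where rs: "set rs = I" using finite_list[OF I(1)] by auto
    define ds where "ds = map (\<lambda>(\<phi>, r). (\<phi>, \<phi> x, r)) rs"
    have "ds \<in> lists (\<Phi> \<times> UNIV \<times> UNIV)" using I rs by (auto simp: ds_def)
    moreover have "x \<in> strict ds" using x I rs by (auto simp: ds_def strict_def)
    moreover have "weak ds \<subseteq> W"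
    proof
      fix y assume y: "y \<in> weak ds"
      show "y \<in> W"
      proof (rule ccontr)
        assume "y \<notin> W"
        then have "y \<in> \<Union>(B ` I)" using y \<F>(3) I(3) by (auto simp: weak_def)
        then obtain \<phi> r where "(\<phi>, r) \<in> I" "\<bar>\<phi> y - \<phi> x\<bar> > r" by (auto simp: B_def)
        moreover from this(1) have "(\<phi>, \<phi> x, r) \<in> set ds" using rs by (force simp: ds_def)
        ultimately show False using y by (auto simp: weak_def)
      qed
    qed
    ultimately show ?thesis by blast
  qed
  have C_closed: "closedin K (C x)" for x
  proof -
    have eq: "C x = (if \<Phi> = {} then topspace K else \<Inter>\<phi>\<in>\<Phi>. {y \<in> topspace K. \<phi> y \<in> {\<phi> x}})"
      by (auto simp: C_def)
    have "closedin K {y \<in> topspace K. \<phi> y \<in> {\<phi> x}}" if "\<phi> \<in> \<Phi>" for \<phi>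
      by (rule closedin_continuous_map_preimage[OF \<Phi>_cont[OF that]]) simp
    then show ?thesis unfolding eq by auto
  qed
  have C_eq: "C y = C x" if "y \<in> C x" for x y
    using that by (auto simp: C_def)
  have C_self: "x \<in> C x" if "x \<in> topspace K" for x
    using that by (simp add: C_def)

  define special where "special c \<longleftrightarrow> (\<forall>V. openin X V \<and> f c \<in> V \<longrightarrow> C c \<subseteq> pre V)" for c
  have special_Bd: "special c" if c: "c \<in> topspace K" "Bd c \<subseteq> \<Phi>" for c
    unfolding special_def
  proof (intro allI impI subsetI)
    fix V y assume V: "openin X V \<and> f c \<in> V" and y: "y \<in> C c"
    have "u c (pre V) \<in> \<Phi>" using c V by (auto simp: Bd_def)
    then have "u c (pre V) y = u c (pre V) c" using y by (auto simp: C_def)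
    moreover have "c \<in> pre V" using c V by (simp add: pre_def)
    ultimately have "u c (pre V) y \<noteq> 0" "\<forall>y \<in> topspace K - pre V. u c (pre V) y = 0"
      using u[OF pre, of V c] V by auto
    then show "y \<in> pre V" using y unfolding C_def by blast
  qed
  have special_k0: "special k0"
    using k0 by (intro special_Bd) (auto simp: \<Phi>_def \<Phi>n_def intro!: exI[of _ 0])
  have special_pt: "special (pt ds)" if "ds \<in> lists (\<Phi> \<times> UNIV \<times> UNIV)" for ds
    using Gd_\<Phi>[OF that] pt_K by (intro special_Bd) (auto simp: Gd_def)
  have special_ex: "\<exists>c \<in> C x. special c" if x: "x \<in> topspace K" for x
  proof (rule ccontr)
    assume "\<not> (\<exists>c \<in> C x. special c)"
    then have "\<forall>c\<in>C x. \<exists>V. openin X V \<and> f c \<in> V \<and> \<not> C x \<subseteq> pre V"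
      unfolding special_def using C_eq by metis
    then obtain V where V: "\<And>c. c \<in> C x \<Longrightarrow> openin X (V c) \<and> f c \<in> V c \<and> \<not> C x \<subseteq> pre (V c)"
      by metis
    have "compactin K (C x)" by (rule closedin_compact_space[OF comp C_closed])
    moreover have "openin K W" if "W \<in> (\<lambda>c. pre (V c)) ` C x" for W
      using that V pre by auto
    moreover have "C x \<subseteq> \<Union>((\<lambda>c. pre (V c)) ` C x)"
      using V by (auto simp: pre_def C_def)
    ultimately obtain \<F> where \<F>: "finite \<F>" "\<F> \<subseteq> (\<lambda>c. pre (V c)) ` C x" "C x \<subseteq> \<Union>\<F>"
      unfolding compactin_def by meson
    then obtain I where I: "finite I" "I \<subseteq> C x" "\<F> = (\<lambda>c. pre (V c)) ` I"
      by (meson finite_subset_image)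
    obtain Us where Us: "set Us = V ` I" using finite_list[of "V ` I"] I(1) by auto
    have opn: "\<And>W. W \<in> set Us \<Longrightarrow> openin X W" and notsub: "\<And>W. W \<in> set Us \<Longrightarrow> \<not> C x \<subseteq> pre W"
      using Us I V by auto
    have U1: "openin K (\<Union>W \<in> set Us. pre W)" and U2: "C x \<subseteq> (\<Union>W \<in> set Us. pre W)"
      using opn pre \<F> I Us by auto
    obtain ds where ds: "ds \<in> lists (\<Phi> \<times> UNIV \<times> UNIV)" "x \<in> strict ds" "weak ds \<subseteq> (\<Union>W \<in> set Us. pre W)"
      using nbhd[OF U1 x U2] by blast
    have "good ds Us (Psi ds Us)"
      by (rule Psi[OF ds_cont[OF ds(1)] opn ds(3)])
    then obtain \<psi> W where \<psi>: "\<psi> \<in> Psi ds Us" "W \<in> set Us" "\<psi> x \<noteq> 0" "\<forall>y \<in> topspace K - pre W. \<psi> y = 0"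
      using ds(2) strict_weak[of ds] unfolding good_def by blast
    have "Us \<in> lists {V. openin X V}" using opn by auto
    then have "\<psi> \<in> Gd ds" using \<psi>(1) unfolding Gd_def by blast
    then have "\<psi> \<in> \<Phi>" using Gd_\<Phi>[OF ds(1)] by blast
    then have eq: "y \<in> topspace K \<and> \<psi> y = \<psi> x" if "y \<in> C x" for y
      using that by (simp add: C_def)
    have "C x \<subseteq> pre W"
    proof
      fix y assume "y \<in> C x"
      then show "y \<in> pre W" using eq[of y] \<psi>(3,4) by (metis DiffI)
    qed
    then show False using notsub[OF \<psi>(2)] by simp
  qed

  define S0 where "S0 = pt ` lists (\<Phi> \<times> UNIV \<times> UNIV)"
  define pick where "pick D = (if k0 \<in> D then k0 else if D \<inter> S0 \<noteq> {} then SOME s. s \<in> D \<inter> S0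
      else SOME c. c \<in> D \<and> special c)" for D
  have pick_S0: "pick D \<in> D \<inter> S0" if "k0 \<notin> D" "D \<inter> S0 \<noteq> {}" for D
    using that some_in_eq[of "D \<inter> S0"] by (simp add: pick_def)
  have pick: "pick (C x) \<in> C x \<and> special (pick (C x))" if x: "x \<in> topspace K" for x
  proof (cases "k0 \<in> C x \<or> C x \<inter> S0 \<noteq> {}")
    case True
    show ?thesis
    proof (cases "k0 \<in> C x")
      case k0C: True
      then show ?thesis using special_k0 by (simp add: pick_def)
    next
      case False
      then have D: "pick (C x) \<in> C x \<inter> S0" using pick_S0[of "C x"] True by argo
      then obtain ds where "ds \<in> lists (\<Phi> \<times> UNIV \<times> UNIV)" "pick (C x) = pt ds"
        unfolding S0_def by blast
      then show ?thesis using D special_pt[of ds] by auto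
    qed
  next
    case False
    then have "pick (C x) = (SOME c. c \<in> C x \<and> special c)" by (simp add: pick_def)
    moreover have "\<exists>c. c \<in> C x \<and> special c" using special_ex[OF x] by (simp only: Bex_def)
    note someI_ex[OF this]
    ultimately show ?thesis by (simp only:)
  qed

  obtain e where e: "inj_on e \<Phi>" "e ` \<Phi> \<subseteq> (UNIV :: ('a \<times> nat) set set)"
    using \<Phi>_small unfolding lepoll_def by blast
  obtain i :: "(('a \<times> nat) set \<Rightarrow> real) \<Rightarrow> ('a \<times> nat) set set" where i: "inj i"
    using fun_lepoll_test unfolding lepoll_def by blast
  define h where "h x = (\<lambda>c. if c \<in> e ` \<Phi> then inv_into \<Phi> e c x else 0)" for x
  have h_eq: "h y = h x \<longleftrightarrow> (\<forall>\<phi>\<in>\<Phi>. \<phi> y = \<phi> x)" for x y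
  proof
    assume eq: "h y = h x"
    show "\<forall>\<phi>\<in>\<Phi>. \<phi> y = \<phi> x"
    proof
      fix \<phi> assume "\<phi> \<in> \<Phi>"
      then show "\<phi> y = \<phi> x" using fun_cong[OF eq, of "e \<phi>"] e by (simp add: h_def)
    qed
  next
    assume "\<forall>\<phi>\<in>\<Phi>. \<phi> y = \<phi> x"
    then show "h y = h x" by (auto simp: h_def fun_eq_iff inv_into_into)
  qed
  have h_cont: "continuous_map K (powertop_real UNIV) h"
    unfolding continuous_map_componentwise_UNIV
  proof
    fix c
    show "continuous_map K euclideanreal (\<lambda>x. h x c)"
      using \<Phi>_cont[OF inv_into_into, of c e] by (cases "c \<in> e ` \<Phi>") (auto simp: h_def)
  qed
  define \<pi> where "\<pi> = i \<circ> h"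
  have \<pi>_eq: "{y \<in> topspace K. \<pi> y = \<pi> x} = C x" for x
    using i h_eq by (auto simp: \<pi>_def C_def inj_eq)
  define L where "L = pullback_topology (\<pi> ` topspace K) (inv_into UNIV i) (powertop_real UNIV)"
  have L_top: "topspace L = \<pi> ` topspace K"
    by (simp add: L_def topspace_pullback_topology)
  have "inv_into UNIV i \<circ> \<pi> = h" using i by (auto simp: \<pi>_def fun_eq_iff)
  then have \<pi>_cont: "continuous_map K L \<pi>"
    unfolding L_def by (intro continuous_map_pullback') (auto simp: h_cont)
  have L_comp: "compact_space L"
    using image_compactin[OF _ \<pi>_cont, of "topspace K"] comp L_top by (simp add: compact_space_def)
  have "continuous_map L (powertop_real UNIV) (id \<circ> inv_into UNIV i)"
    unfolding L_def by (intro continuous_map_pullback) simp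
  moreover have "inj_on (inv_into UNIV i) (topspace L)"
    using i by (auto simp: L_top \<pi>_def inj_on_def)
  ultimately have L_Haus: "Hausdorff_space L"
    using Hausdorff_space_injective_preimage[of "powertop_real UNIV" L "inv_into UNIV i"]
    by (simp add: Hausdorff_space_product_topology)
  define t where "t l = f (pick {y \<in> topspace K. \<pi> y = l})" for l
  have t: "t (\<pi> x) = f (pick (C x))" for x
    by (simp add: t_def \<pi>_eq)
  have t_pre: "t (\<pi> x) \<in> V \<longleftrightarrow> C x \<subseteq> pre V" if "x \<in> topspace K" "openin X V" for x V
  proof
    assume "t (\<pi> x) \<in> V"
    then have "C (pick (C x)) \<subseteq> pre V" using pick[OF that(1)] that by (auto simp: t special_def)
    then show "C x \<subseteq> pre V" using pick[OF that(1)] C_eq by blast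
  next
    assume "C x \<subseteq> pre V"
    then show "t (\<pi> x) \<in> V" using pick[OF that(1)] by (auto simp: t pre_def)
  qed
  have t_cont: "continuous_map L X t"
    unfolding continuous_map_def
  proof (intro conjI allI impI)
    show "t \<in> topspace L \<rightarrow> topspace X"
      using pick f by (auto simp: L_top t C_def continuous_map_def)
  next
    fix V assume V: "openin X V"
    have "closedin K (topspace K - pre V)" using pre[OF V] by blast
    then have cl: "closedin L (\<pi> ` (topspace K - pre V))"
      using continuous_imp_closed_map[OF \<pi>_cont comp L_Haus] by (simp add: closed_map_def)
    have "{l \<in> topspace L. t l \<in> V} = topspace L - \<pi> ` (topspace K - pre V)"
    proof -
      have "t (\<pi> x) \<in> V \<longleftrightarrow> \<pi> x \<notin> \<pi> ` (topspace K - pre V)" if "x \<in> topspace K" for x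
        unfolding t_pre[OF that V] \<pi>_eq[symmetric] image_iff subset_iff by (auto dest: sym)
      then show ?thesis by (auto simp: L_top)
    qed
    then show "openin L {l \<in> topspace L. t l \<in> V}" using cl by auto
  qed
  have "openin L {l \<in> topspace L. t l \<in> U}"
    using U L_comp L_Haus t_cont unfolding k_openin_def by blast
  then have W: "openin K {x \<in> topspace K. \<pi> x \<in> {l \<in> topspace L. t l \<in> U}}" (is "openin K ?W")
    by (rule openin_continuous_map_preimage[OF \<pi>_cont])
  have "C k0 \<subseteq> ?W"
  proof
    fix y assume y: "y \<in> C k0"
    then have "t (\<pi> y) = f k0" using C_eq[OF y] C_self[OF k0(1)] by (simp add: t pick_def)
    then show "y \<in> ?W" using y k0 by (auto simp: C_def L_top)
  qed
  then obtain ds where ds: "ds \<in> lists (\<Phi> \<times> UNIV \<times> UNIV)" "k0 \<in> strict ds" "weak ds \<subseteq> ?W"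
    using nbhd[OF W k0(1)] by blast
  have "\<exists>s. s \<in> strict ds \<and> f s \<notin> U"
  proof -
    have "openin K (strict ds)"
      by (rule strict_open, rule ds_cont[OF ds(1)])
    then show ?thesis using k0_lim ds(2) by blast
  qed
  then have p: "pt ds \<in> strict ds" "f (pt ds) \<notin> U" using pt_near[of ds] by simp_all
  then have "pt ds \<noteq> k0" using k0 by auto
  then have uk: "u (pt ds) (topspace K - {k0}) \<in> \<Phi>" using Gd_\<Phi>[OF ds(1)] by (auto simp: Gd_def)
  have "u (pt ds) (topspace K - {k0}) (pt ds) \<noteq> 0" "u (pt ds) (topspace K - {k0}) k0 = 0"
    using u[OF openk0, of "pt ds"] pt_K[of ds] \<open>pt ds \<noteq> k0\<close> k0 by simp_all
  then have "k0 \<notin> C (pt ds)"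
    using uk unfolding C_def by force
  moreover have "pt ds \<in> C (pt ds) \<inter> S0" using C_self[OF pt_K] ds(1) by (auto simp: S0_def)
  ultimately have D: "pick (C (pt ds)) \<in> C (pt ds) \<inter> S0" using pick_S0[of "C (pt ds)"] by blast
  then obtain ds' where "pick (C (pt ds)) = pt ds'"
    unfolding S0_def by blast
  moreover from this D \<open>k0 \<notin> C (pt ds)\<close> have "pt ds' \<noteq> k0" by auto
  ultimately have "f (pick (C (pt ds))) \<notin> U" using pt[of ds'] by simp
  then have "pt ds \<notin> ?W" by (simp add: t)
  then show False using p strict_weak ds(3) by blast
qed


lemma compactly_generated_cg_kification: "compactly_generated (cg_kification X)"
  unfolding compactly_generated_def
proof (intro allI impI)
  fix U assume U: "k_openin (cg_kification X) U"
  have "continuous_map K (cg_kification X) t"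
    if "compact_space K" "Hausdorff_space K" "continuous_map K X t"
    for K :: "('a \<times> nat) set set topology" and t
    using that by (auto simp: continuous_map_def openin_cg_kification k_openin_def)
  then have "k_openin X U"
    using U by (simp add: k_openin_def)
  then show "openin (cg_kification X) U"
    by (simp add: openin_cg_kification)
qed

lemma continuous_map_from_cg_kification: "continuous_map X Y f \<Longrightarrow> continuous_map (cg_kification X) Y f"
  by (simp add: continuous_map_def openin_cg_kification openin_imp_k_openin)

lemma continuous_map_into_cg_kification:
  assumes X: "compactly_generated X"
  shows "continuous_map X (cg_kification Y) f \<longleftrightarrow> continuous_map X Y f"
proof
  assume "continuous_map X (cg_kification Y) f"
  then show "continuous_map X Y f"
    by (simp add: continuous_map_def openin_cg_kification openin_imp_k_openin)
next
  assume f: "continuous_map X Y f"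
  show "continuous_map X (cg_kification Y) f"
    unfolding continuous_map_def
  proof (intro conjI allI impI)
    show "f \<in> topspace X \<rightarrow> topspace (cg_kification Y)"
      using f by (simp add: continuous_map_def)
  next
    fix V assume "openin (cg_kification Y) V"
    then have V: "k_openin Y V" by (simp add: openin_cg_kification)
    have "k_openin X {x \<in> topspace X. f x \<in> V}"
      unfolding k_openin_def
    proof (intro conjI allI impI)
      fix K :: "('a \<times> nat) set set topology" and t
      assume K: "compact_space K \<and> Hausdorff_space K \<and> continuous_map K X t"
      then have "openin K {k \<in> topspace K. (f \<circ> t) k \<in> V}"
        using f by (intro k_openin_test[OF V] continuous_map_compose[of K X]) auto
      moreover have "{k \<in> topspace K. (f \<circ> t) k \<in> V} =
          {k \<in> topspace K. t k \<in> {x \<in> topspace X. f x \<in> V}}"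
        using K by (auto simp: continuous_map_def)
      ultimately show "openin K {k \<in> topspace K. t k \<in> {x \<in> topspace X. f x \<in> V}}"
        by simp
    qed auto
    then show "openin X {x \<in> topspace X. f x \<in> V}"
      using X by (simp add: compactly_generated_def)
  qed
qed

lemma continuous_map_into_cg_prod:
  "compactly_generated Z \<Longrightarrow> continuous_map Z (cg_prod X Y) f \<longleftrightarrow>
     continuous_map Z X (fst \<circ> f) \<and> continuous_map Z Y (snd \<circ> f)"
  by (simp add: cg_prod_def continuous_map_into_cg_kification continuous_map_pairwise)

lemma compactly_generated_cg_prod: "compactly_generated (cg_prod X Y)"
  by (simp add: cg_prod_def compactly_generated_cg_kification)

lemma compactly_generated_quotient_map:
  assumes q: "quotient_map X Y q" and X: "compactly_generated X"
  shows "compactly_generated Y"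
  unfolding compactly_generated_def
proof (intro allI impI)
  fix V assume V: "k_openin Y V"
  have "continuous_map X (cg_kification Y) q"
    using X q by (simp add: continuous_map_into_cg_kification quotient_imp_continuous_map)
  moreover have "openin (cg_kification Y) V"
    using V by (simp add: openin_cg_kification)
  ultimately have "openin X {x \<in> topspace X. q x \<in> V}"
    by (rule openin_continuous_map_preimage)
  then show "openin Y V"
    using q V by (auto simp: quotient_map_def k_openin_def)
qed

lemma compactly_generated_sum:
  assumes "\<And>i. i \<in> I \<Longrightarrow> compactly_generated (X i)"
  shows "compactly_generated (sum_topology X I)"
  unfolding compactly_generated_def
proof (intro allI impI)
  fix V assume V: "k_openin (sum_topology X I) V"
  have "openin (X i) {x. (i, x) \<in> V}" if i: "i \<in> I" for i
  proof -
    have "continuous_map (X i) (sum_topology X I) (Pair i)"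
      using i by (simp add: continuous_map_component_injection)
    then have "continuous_map (X i) (cg_kification (sum_topology X I)) (Pair i)"
      using assms[OF i] by (simp add: continuous_map_into_cg_kification)
    moreover have "openin (cg_kification (sum_topology X I)) V"
      using V by (simp add: openin_cg_kification)
    ultimately have "openin (X i) {x \<in> topspace (X i). (i, x) \<in> V}"
      by (rule openin_continuous_map_preimage)
    moreover have "{x \<in> topspace (X i). (i, x) \<in> V} = {x. (i, x) \<in> V}"
      using V by (auto simp: k_openin_def)
    ultimately show ?thesis by simp
  qed
  then show "openin (sum_topology X I) V"
    using V by (auto simp: openin_sum_topology k_openin_def)
qed

section \<open>Simplicial spaces\<close>

text \<open>
  \<open>\<Delta>_hom m n\<close> is the set of morphisms \<open>[m] \<rightarrow> [n]\<close> of the simplex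
  category, and \<open>act X m n \<theta>\<close> is the map \<open>X\<^sub>n \<rightarrow> X\<^sub>m\<close> induced by
  \<open>\<theta> : [m] \<rightarrow> [n]\<close>.  That all levels have points in one type is no restriction, since
  the type may be taken to be a disjoint union.
\<close>

definition \<Delta>_hom :: "nat \<Rightarrow> nat \<Rightarrow> (nat \<Rightarrow> nat) set" where
  "\<Delta>_hom m n = {\<theta> \<in> {..m} \<rightarrow>\<^sub>E {..n}. mono_on {..m} \<theta>}"

definition coface :: "nat \<Rightarrow> nat \<Rightarrow> nat \<Rightarrow> nat" where
  "coface p i = (\<lambda>j\<in>{..p}. if j < i then j else Suc j)"

record 'a sspace =
  level :: "nat \<Rightarrow> 'a topology"
  act :: "nat \<Rightarrow> nat \<Rightarrow> (nat \<Rightarrow> nat) \<Rightarrow> 'a \<Rightarrow> 'a"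

definition simplicial_space :: "'a sspace \<Rightarrow> bool" where
  "simplicial_space X \<longleftrightarrow>
     (\<forall>n. compactly_generated (level X n)) \<and>
     (\<forall>m n. \<forall>\<theta> \<in> \<Delta>_hom m n. continuous_map (level X n) (level X m) (act X m n \<theta>)) \<and>
     (\<forall>n. \<forall>x \<in> topspace (level X n). act X n n (\<lambda>j\<in>{..n}. j) x = x) \<and>
     (\<forall>l m n. \<forall>\<phi> \<in> \<Delta>_hom l m. \<forall>\<theta> \<in> \<Delta>_hom m n. \<forall>x \<in> topspace (level X n).
        act X l n (compose {..l} \<theta> \<phi>) x = act X l m \<phi> (act X m n \<theta> x))"

definition face :: "'a sspace \<Rightarrow> nat \<Rightarrow> nat \<Rightarrow> 'a \<Rightarrow> 'a" where
  "face X p i = act X p (Suc p) (coface p i)"  \<comment> \<open>\<open>d\<^sub>i\<close> on level \<open>p + 1\<close>\<close>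

definition sprod :: "'a sspace \<Rightarrow> 'b sspace \<Rightarrow> ('a \<times> 'b) sspace" where
  "sprod X Y = \<lparr>level = (\<lambda>n. cg_prod (level X n) (level Y n)),
                act = (\<lambda>m n \<theta>. map_prod (act X m n \<theta>) (act Y m n \<theta>))\<rparr>"

lemma simplicial_space_sprod:
  assumes X: "simplicial_space X" and Y: "simplicial_space Y"
  shows "simplicial_space (sprod X Y)"
proof -
  have "continuous_map (cg_prod (level X n) (level Y n)) (cg_prod (level X m) (level Y m))
          (map_prod (act X m n \<theta>) (act Y m n \<theta>))" if "\<theta> \<in> \<Delta>_hom m n" for m n \<theta>
  proof -
    have "continuous_map (prod_topology (level X n) (level Y n)) (prod_topology (level X m) (level Y m))
          (map_prod (act X m n \<theta>) (act Y m n \<theta>))"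
      using X Y that unfolding simplicial_space_def map_prod_def
      by (auto simp: continuous_map_prod_top)
    then show ?thesis
      unfolding cg_prod_def continuous_map_into_cg_kification[OF compactly_generated_cg_kification]
      by (rule continuous_map_from_cg_kification)
  qed
  then show ?thesis
    using X Y unfolding simplicial_space_def
    by (auto simp: sprod_def compactly_generated_cg_prod) (auto simp: cg_prod_def)
qed

section \<open>Fat geometric realisation\<close>

definition quotient_topology :: "'a topology \<Rightarrow> ('a \<times> 'a) set \<Rightarrow> 'a set topology" where
  "quotient_topology T E =
     topology (\<lambda>\<U>. \<U> \<subseteq> topspace T // E \<and> openin T {z \<in> topspace T. E `` {z} \<in> \<U>})"

lemma openin_quotient_topology:
  "openin (quotient_topology T E) \<U> \<longleftrightarrow>
     \<U> \<subseteq> topspace T // E \<and> openin T {z \<in> topspace T. E `` {z} \<in> \<U>}"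
proof -
  have "istopology (\<lambda>\<U>. \<U> \<subseteq> topspace T // E \<and> openin T {z \<in> topspace T. E `` {z} \<in> \<U>})"
    unfolding istopology_def
  proof (intro conjI allI impI)
    fix S R
    assume "S \<subseteq> topspace T // E \<and> openin T {z \<in> topspace T. E `` {z} \<in> S}"
      and "R \<subseteq> topspace T // E \<and> openin T {z \<in> topspace T. E `` {z} \<in> R}"
    moreover have "{z \<in> topspace T. E `` {z} \<in> S \<inter> R} =
        {z \<in> topspace T. E `` {z} \<in> S} \<inter> {z \<in> topspace T. E `` {z} \<in> R}"
      by auto
    ultimately show "S \<inter> R \<subseteq> topspace T // E" "openin T {z \<in> topspace T. E `` {z} \<in> S \<inter> R}"
      by (auto intro: openin_Int)
  next
    fix \<K>
    assume \<K>: "\<forall>S\<in>\<K>. S \<subseteq> topspace T // E \<and> openin T {z \<in> topspace T. E `` {z} \<in> S}"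
    then show "\<Union>\<K> \<subseteq> topspace T // E"
      by auto
    have "{z \<in> topspace T. E `` {z} \<in> \<Union>\<K>} = \<Union>((\<lambda>S. {z \<in> topspace T. E `` {z} \<in> S}) ` \<K>)"
      by auto
    then show "openin T {z \<in> topspace T. E `` {z} \<in> \<Union>\<K>}"
      using \<K> by auto
  qed
  then show ?thesis
    by (simp add: quotient_topology_def)
qed

lemma topspace_quotient_topology [simp]: "topspace (quotient_topology T E) = topspace T // E"
proof -
  have "{z \<in> topspace T. E `` {z} \<in> topspace T // E} = topspace T"
    by (auto intro: quotientI)
  then have "openin (quotient_topology T E) (topspace T // E)"
    by (simp add: openin_quotient_topology)
  then show ?thesis
    by (metis openin_quotient_topology openin_subset openin_topspace subset_antisym)
qed

lemma quotient_map_quotient_topology: "quotient_map T (quotient_topology T E) (\<lambda>z. E `` {z})"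
  unfolding quotient_map_def
  by (auto simp: openin_quotient_topology quotient_def)

definition simplex_space :: "nat \<Rightarrow> (nat \<Rightarrow> real) topology" where
  "simplex_space p = subtopology (powertop_real UNIV) (standard_simplex p)"

definition fat_total :: "'a sspace \<Rightarrow> (nat \<times> 'a \<times> (nat \<Rightarrow> real)) topology" where
  "fat_total X = sum_topology (\<lambda>p. cg_prod (level X p) (simplex_space p)) UNIV"

text \<open>The coface inclusion of standard simplices is the library's \<open>simplical_face\<close>.\<close>

definition fat_glue :: "'a sspace \<Rightarrow> ((nat \<times> 'a \<times> (nat \<Rightarrow> real)) \<times> (nat \<times> 'a \<times> (nat \<Rightarrow> real))) set" where
  "fat_glue X = {((Suc p, x, simplical_face i t), (p, face X p i x, t)) | p i x t.
      i \<le> Suc p \<and> x \<in> topspace (level X (Suc p)) \<and> t \<in> standard_simplex p}"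

definition fat_equiv :: "'a sspace \<Rightarrow> ((nat \<times> 'a \<times> (nat \<Rightarrow> real)) \<times> (nat \<times> 'a \<times> (nat \<Rightarrow> real))) set" where
  "fat_equiv X = (fat_glue X \<union> (fat_glue X)\<inverse>)\<^sup>*"

definition fat_realisation :: "'a sspace \<Rightarrow> (nat \<times> 'a \<times> (nat \<Rightarrow> real)) set topology" where
  "fat_realisation X = quotient_topology (fat_total X) (fat_equiv X)"

lemma compactly_generated_fat_realisation: "compactly_generated (fat_realisation X)"
  unfolding fat_realisation_def fat_total_def
  by (rule compactly_generated_quotient_map[OF quotient_map_quotient_topology])
    (intro compactly_generated_sum compactly_generated_cg_prod)

text \<open>
  The map \<open>\<parallel>X\<parallel> \<rightarrow> \<parallel>Y\<parallel>\<close> induced by a map of simplicial spaces with components \<open>\<phi> p\<close>,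
  \<open>[p, x, t] \<mapsto> [p, \<phi> p x, t]\<close>.  Points are equivalence classes; the union is over
  representatives, all of which give the same class.
\<close>

definition fat_map ::
  "'b sspace \<Rightarrow> (nat \<Rightarrow> 'a \<Rightarrow> 'b) \<Rightarrow> (nat \<times> 'a \<times> (nat \<Rightarrow> real)) set \<Rightarrow> (nat \<times> 'b \<times> (nat \<Rightarrow> real)) set" where
  "fat_map Y \<phi> C = (\<Union>(p, x, t) \<in> C. fat_equiv Y `` {(p, \<phi> p x, t)})"

section \<open>Weak homotopy equivalences\<close>

definition cube :: "nat \<Rightarrow> (nat \<Rightarrow> real) topology" where
  "cube n = product_topology (\<lambda>_. top_of_set {0..1}) {..<n}"

definition cube_boundary :: "nat \<Rightarrow> (nat \<Rightarrow> real) set" where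
  "cube_boundary n = {s \<in> topspace (cube n). \<exists>i<n. s i = 0 \<or> s i = 1}"

definition spheroids :: "nat \<Rightarrow> 'a topology \<Rightarrow> 'a \<Rightarrow> ((nat \<Rightarrow> real) \<Rightarrow> 'a) set" where
  "spheroids n X x = {g. continuous_map (cube n) X g \<and> g ` cube_boundary n \<subseteq> {x}}"

definition spheroid_class :: "nat \<Rightarrow> 'a topology \<Rightarrow> 'a \<Rightarrow> ((nat \<Rightarrow> real) \<Rightarrow> 'a) \<Rightarrow> ((nat \<Rightarrow> real) \<Rightarrow> 'a) set" where
  "spheroid_class n X x g = {h. homotopic_with (\<lambda>k. k ` cube_boundary n \<subseteq> {x}) (cube n) X g h}"

definition homotopy_group :: "nat \<Rightarrow> 'a topology \<Rightarrow> 'a \<Rightarrow> ((nat \<Rightarrow> real) \<Rightarrow> 'a) set set" where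
  "homotopy_group n X x = spheroid_class n X x ` spheroids n X x"

definition homotopy_group_map ::
  "nat \<Rightarrow> 'b topology \<Rightarrow> ('a \<Rightarrow> 'b) \<Rightarrow> 'a \<Rightarrow> ((nat \<Rightarrow> real) \<Rightarrow> 'a) set \<Rightarrow> ((nat \<Rightarrow> real) \<Rightarrow> 'b) set" where
  "homotopy_group_map n Y f x C = (\<Union>g \<in> C. spheroid_class n Y (f x) (f \<circ> g))"

definition path_components_map :: "'b topology \<Rightarrow> ('a \<Rightarrow> 'b) \<Rightarrow> 'a set \<Rightarrow> 'b set" where
  "path_components_map Y f C = (\<Union>x \<in> C. path_component_of_set Y (f x))"

text \<open>
  The group structure on \<open>\<pi>\<^sub>n\<close> is not needed: the map induced by a continuous map is a
  homomorphism, so it is an isomorphism exactly when it is bijective.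
\<close>

definition weak_homotopy_equivalence :: "'a topology \<Rightarrow> 'b topology \<Rightarrow> ('a \<Rightarrow> 'b) \<Rightarrow> bool" where
  "weak_homotopy_equivalence X Y f \<longleftrightarrow>
     continuous_map X Y f \<and>
     bij_betw (path_components_map Y f) (path_components_of X) (path_components_of Y) \<and>
     (\<forall>n\<ge>1. \<forall>x \<in> topspace X.
        bij_betw (homotopy_group_map n Y f x) (homotopy_group n X x) (homotopy_group n Y (f x)))"

end

theory Submission
  imports Defs
begin

text \<open>
  The map is a homotopy equivalence with an explicit inverse. A pair of points \<open>[x, s]\<close>, \<open>[y, t]\<close>
  cuts the unit interval into pieces of lengths \<open>s\<close> and pieces of lengths \<open>t\<close>; the common
  refinement of the two subdivisions has pieces labelled by a chain of pairs \<open>(i, j)\<close>, and pulling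
  \<open>x\<close> and \<open>y\<close> back along the two components of this chain gives a point of the realisation of the
  product. This inverse \<open>G\<close> satisfies \<open>G \<circ> F = id\<close>, because the common refinement of \<open>s\<close> with
  itself is \<open>s\<close>. The composite \<open>F \<circ> G\<close> refines \<open>x\<close> by \<open>t\<close> and \<open>y\<close> by \<open>s\<close>. Refining \<open>x\<close> by
  \<open>(\<tau>, (1 - \<tau>) t)\<close> instead and letting \<open>\<tau>\<close> run from \<open>0\<close> to \<open>1\<close> deforms it to the identity.
\<close>

subsection \<open>Compactly generated products\<close>

text \<open>For fixed levels p and q the overlap lengths are the barycentric coordinates of
  \<open>(s, t)\<close> in the triangulation of the product of the two simplices by chains of pairs.
  The components of a chain may repeat indices, so pulling back along them uses the degeneracies of
  X and Y, although the realisation identifies points along faces only. This makes the inverse well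
  defined and lets finitely many closed pieces be pasted. The topological obstacle is that the
  target is a product of quotients whose topology may be finer than the product topology. Continuity
  out of it is tested on compact Hausdorff spaces, where closed pieces remain compactly generated
  and products with quotient maps are quotient maps. The deformation cones only the refining
  subdivision: coning x or y itself would need an extra degeneracy, whereas a bare subdivision
  carries no labels.\<close>

lemma topspace_cg_prod [simp]: "topspace (cg_prod A B) = topspace A \<times> topspace B"
  by (simp add: cg_prod_def)

lemma compactly_generated_compact_Hausdorff:
  assumes "compact_space K" "Hausdorff_space K"
  shows "compactly_generated K"
  unfolding compactly_generated_def
proof (intro allI impI)
  fix U assume U: "k_openin K U"
  have "openin K {k \<in> topspace K. id k \<in> U}"
    using U assms by (rule k_openin_test) simp
  moreover have "{k \<in> topspace K. id k \<in> U} = U"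
    using U by (auto simp: k_openin_def)
  ultimately show "openin K U" by simp
qed

lemma continuous_map_cg_prod_components:
  "continuous_map Z (cg_prod A B) h \<Longrightarrow> continuous_map Z A (\<lambda>z. fst (h z)) \<and> continuous_map Z B (\<lambda>z. snd (h z))"
proof -
  assume h: "continuous_map Z (cg_prod A B) h"
  have "continuous_map (cg_prod A B) (prod_topology A B) id"
    unfolding cg_prod_def by (rule continuous_map_from_cg_kification) simp
  from continuous_map_compose[OF h this] have "continuous_map Z (prod_topology A B) h"
    by simp
  then show ?thesis by (auto simp: continuous_map_pairwise o_def)
qed

lemma continuous_map_cg_prod_fst: "continuous_map (cg_prod A B) A fst"
  and continuous_map_cg_prod_snd: "continuous_map (cg_prod A B) B snd"
  using continuous_map_cg_prod_components[of "cg_prod A B" A B id] by simp_all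

lemma continuous_map_cg_prod_swap: "continuous_map (cg_prod A B) (cg_prod B A) prod.swap"
  using continuous_map_cg_prod_fst[of A B] continuous_map_cg_prod_snd[of A B]
  by (simp add: continuous_map_into_cg_prod compactly_generated_cg_prod comp_def)

text \<open>Open sets of the k-ified product are by definition detected on compact Hausdorff spaces,
  so a map out of it need only be checked along pairs of maps from such a space. The continuity
  statements below about products of sums, quotients and realisations rest on this test.\<close>

lemma continuous_map_cg_prod_test:
  fixes f :: "'a \<times> 'b \<Rightarrow> 'c"
  assumes "\<And>(K :: (('a \<times> 'b) \<times> nat) set set topology) a b.
      \<lbrakk>compact_space K; Hausdorff_space K; continuous_map K A a; continuous_map K B b\<rbrakk>
      \<Longrightarrow> continuous_map K V (\<lambda>k. f (a k, b k))"
    and f: "f \<in> topspace A \<times> topspace B \<rightarrow> topspace V"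
  shows "continuous_map (cg_prod A B) V f"
  unfolding continuous_map_def
proof (intro conjI allI impI)
  show "f \<in> topspace (cg_prod A B) \<rightarrow> topspace V"
    using f by simp
next
  fix U assume U: "openin V U"
  have "k_openin (prod_topology A B) {z \<in> topspace (cg_prod A B). f z \<in> U}"
    unfolding k_openin_def
  proof (intro conjI allI impI)
    fix K :: "(('a \<times> 'b) \<times> nat) set set topology" and t
    assume K: "compact_space K \<and> Hausdorff_space K \<and> continuous_map K (prod_topology A B) t"
    then have "continuous_map K V (\<lambda>k. f (fst (t k), snd (t k)))"
      by (intro assms) (auto simp: continuous_map_pairwise o_def)
    then have "openin K {k \<in> topspace K. f (t k) \<in> U}"
      using U by (simp add: openin_continuous_map_preimage)
    moreover have "{k \<in> topspace K. f (t k) \<in> U} =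
        {k \<in> topspace K. t k \<in> {z \<in> topspace (cg_prod A B). f z \<in> U}}"
      using K by (auto simp: continuous_map_def)
    ultimately show "openin K {k \<in> topspace K. t k \<in> {z \<in> topspace (cg_prod A B). f z \<in> U}}"
      by simp
  qed auto
  then show "openin (cg_prod A B) {z \<in> topspace (cg_prod A B). f z \<in> U}"
    by (simp add: cg_prod_def openin_cg_kification)
qed

lemma continuous_map_compose_cg_prod:
  assumes "continuous_map (cg_prod A B) V f" "compactly_generated Z"
    "continuous_map Z A a" "continuous_map Z B b"
  shows "continuous_map Z V (\<lambda>z. f (a z, b z))"
proof -
  have "continuous_map Z (cg_prod A B) (\<lambda>z. (a z, b z))"
    using assms by (simp add: continuous_map_into_cg_prod o_def)
  from continuous_map_compose[OF this assms(1)] show ?thesis by (simp add: o_def)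
qed

text \<open>An open set of the k-ified product need not be a union of boxes, so the summands are
  separated on a test space \<open>K\<close> instead: their preimages partition \<open>K\<close>
  into clopen sets, which are again compact Hausdorff.\<close>

lemma continuous_map_cg_prod_sum_left:
  fixes f :: "('i \<times> 'a) \<times> 'b \<Rightarrow> 'c"
  assumes f: "\<And>i. i \<in> I \<Longrightarrow> continuous_map (cg_prod (A i) B) V (\<lambda>(x, y). f ((i, x), y))"
  shows "continuous_map (cg_prod (sum_topology A I) B) V f"
proof (rule continuous_map_cg_prod_test)
  show "f \<in> topspace (sum_topology A I) \<times> topspace B \<rightarrow> topspace V"
    using f by (force simp: continuous_map_def)
next
  fix K :: "((('i \<times> 'a) \<times> 'b) \<times> nat) set set topology" and a b
  assume K: "compact_space K" "Hausdorff_space K"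
    and a: "continuous_map K (sum_topology A I) a" and b: "continuous_map K B b"
  define P where "P i = {k \<in> topspace K. a k \<in> {i} \<times> topspace (A i)}" for i
  have sub: "openin (sum_topology A I) ({i} \<times> U)" if "i \<in> I" "openin (A i) U" for i U
  proof -
    have "Pair i ` U = {i} \<times> U" by auto
    then show ?thesis
      using open_map_component_injection[OF that(1), of A] that(2) by (metis open_map_def)
  qed
  have a_in: "a k \<in> Sigma I (topspace \<circ> A)" if "k \<in> topspace K" for k
    using a that by (auto simp: continuous_map_def)
  show "continuous_map K V (\<lambda>k. f (a k, b k))"
  proof (rule pasting_lemma[where I = I and T = P and f = "\<lambda>_ k. f (a k, b k)"])
    fix i assume i: "i \<in> I"
    show "openin K (P i)" unfolding P_def
      by (rule openin_continuous_map_preimage[OF a sub[OF i]]) simp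
    \<comment> \<open>As the complement of the preimage of all other summands, \<open>P i\<close> is
      also closed, and thereby compact.\<close>
    have "P i = topspace K - {k \<in> topspace K. a k \<in> (\<Union>j \<in> I - {i}. {j} \<times> topspace (A j))}"
      using a_in i by (fastforce simp: P_def)
    moreover have "openin (sum_topology A I) (\<Union>j \<in> I - {i}. {j} \<times> topspace (A j))"
      by (intro openin_Union) (auto intro!: sub)
    then have "openin K {k \<in> topspace K. a k \<in> (\<Union>j \<in> I - {i}. {j} \<times> topspace (A j))}"
      by (rule openin_continuous_map_preimage[OF a])
    ultimately have "closedin K (P i)" by auto
    then have "compact_space (subtopology K (P i))" 
      using K(1) closedin_compact_space compact_space_subtopology by blast
    then have cg: "compactly_generated (subtopology K (P i))"
      using K(2) Hausdorff_space_subtopology compactly_generated_compact_Hausdorff by blast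
    have "continuous_map (subtopology K (P i)) (A i) (\<lambda>k. snd (a k))"
      unfolding continuous_map_def
    proof (intro conjI allI impI)
      show "(\<lambda>k. snd (a k)) \<in> topspace (subtopology K (P i)) \<rightarrow> topspace (A i)"
        by (auto simp: P_def)
    next
      fix U assume U: "openin (A i) U"
      have "openin K {k \<in> topspace K. a k \<in> {i} \<times> U}"
        by (rule openin_continuous_map_preimage[OF a sub[OF i U]])
      moreover have "{k \<in> topspace (subtopology K (P i)). snd (a k) \<in> U} = {k \<in> topspace K. a k \<in> {i} \<times> U} \<inter> P i"
        using openin_subset[OF U] by (auto simp: P_def)
      ultimately show "openin (subtopology K (P i)) {k \<in> topspace (subtopology K (P i)). snd (a k) \<in> U}"
        by (auto simp: openin_subtopology)
    qed
    then have "continuous_map (subtopology K (P i)) V (\<lambda>k. (\<lambda>(x, y). f ((i, x), y)) (snd (a k), b k))"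
      by (rule continuous_map_compose_cg_prod[OF f[OF i] cg]) (rule continuous_map_from_subtopology[OF b])
    then show "continuous_map (subtopology K (P i)) V (\<lambda>k. f (a k, b k))"
      by (rule continuous_map_eq) (auto simp: P_def)
  next
    fix k assume "k \<in> topspace K"
    then show "\<exists>j. j \<in> I \<and> k \<in> P j \<and> f (a k, b k) = f (a k, b k)"
      using a_in[of k] by (auto simp: P_def)
  qed auto
qed

lemma continuous_map_cg_prod_sum_right:
  assumes f: "\<And>i. i \<in> I \<Longrightarrow> continuous_map (cg_prod B (A i)) V (\<lambda>(y, x). f (y, (i, x)))"
  shows "continuous_map (cg_prod B (sum_topology A I)) V f"
proof -
  have "continuous_map (cg_prod (sum_topology A I) B) V (f \<circ> prod.swap)"
  proof (rule continuous_map_cg_prod_sum_left)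
    fix i assume "i \<in> I"
    from continuous_map_compose[OF continuous_map_cg_prod_swap f[OF this]]
    show "continuous_map (cg_prod (A i) B) V (\<lambda>(x, y). (f \<circ> prod.swap) ((i, x), y))"
      by (rule continuous_map_eq) auto
  qed
  from continuous_map_compose[OF continuous_map_cg_prod_swap this] show ?thesis
    by (simp add: o_assoc[symmetric])
qed

text \<open>The tube lemma replaces the exponential law of compactly generated spaces.\<close>

lemma compactly_generated_prod_compact_Hausdorff:
  fixes T :: "'a topology" and K :: "'k topology"
  assumes T: "compactly_generated T" and K: "compact_space K" "Hausdorff_space K"
  shows "compactly_generated (prod_topology T K)"
  unfolding compactly_generated_def
proof (intro allI impI)
  fix W assume W: "k_openin (prod_topology T K) W"
  show "openin (prod_topology T K) W"
    unfolding openin_prod_topology_alt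
  proof (intro allI impI)
    fix t0 k0 assume tk: "(t0, k0) \<in> W"
    then have t0: "t0 \<in> topspace T" and k0: "k0 \<in> topspace K"
      using W by (auto simp: k_openin_def)
    have "openin K {k \<in> topspace K. (t0, k) \<in> W}"
      by (rule k_openin_test[OF W K]) (simp add: continuous_map_pairwise o_def t0)
    moreover have "neighbourhood_base_of (compactin K) K"
      using K by (meson compact_imp_locally_compact_space locally_compact_space_neighbourhood_base)
    ultimately obtain O' N where N: "openin K O'" "compactin K N" "k0 \<in> O'" "O' \<subseteq> N" "N \<subseteq> {k \<in> topspace K. (t0, k) \<in> W}"
      using k0 tk unfolding neighbourhood_base_of by (smt (verit, best) mem_Collect_eq)
    \<comment> \<open>Compactness of \<open>N\<close> makes this set k-open: pulled back to a test
      space \<open>L\<close>, \<open>W\<close> becomes open in the compact Hausdorff product of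
      \<open>L\<close> and \<open>K\<close>, and the tube lemma applies to the slice over
      \<open>N\<close>.\<close>
    define T' where "T' = {t \<in> topspace T. \<forall>k\<in>N. (t, k) \<in> W}"
    have "k_openin T T'"
      unfolding k_openin_def
    proof (intro conjI allI impI)
      fix L :: "('a \<times> nat) set set topology" and u
      assume "compact_space L \<and> Hausdorff_space L \<and> continuous_map L T u"
      then have L: "compact_space L" "Hausdorff_space L" and u: "continuous_map L T u" by auto
      have "openin (prod_topology L K) {z \<in> topspace (prod_topology L K). (u (fst z), snd z) \<in> W}" (is "openin _ ?W'")
        using K L u
        by (intro k_openin_test[OF W])
          (auto simp: compact_space_prod_topology Hausdorff_space_prod_topology continuous_map_pairwise o_def continuous_map_snd
            intro!: continuous_map_compose[OF continuous_map_fst, unfolded o_def])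
      then have W': "openin (prod_topology L K) ?W'" .
      show "openin L {l \<in> topspace L. u l \<in> T'}"
      proof (subst openin_subopen, intro ballI)
        fix l assume l: "l \<in> {l \<in> topspace L. u l \<in> T'}"
        have "{l} \<times> N \<subseteq> ?W'"
          using l N(5) by (auto simp: T'_def)
        then obtain U V where UV: "openin L U" "openin K V" "l \<in> U" "N \<subseteq> V" "U \<times> V \<subseteq> ?W'"
          using tube_lemma_right[OF W' N(2), of l] l by (auto simp del: topspace_prod_topology)
        moreover have "U \<subseteq> {l \<in> topspace L. u l \<in> T'}"
        proof
          fix l' assume l': "l' \<in> U"
          then have "l' \<in> topspace L" using UV(1) openin_subset by blast
          moreover have "(u l', k) \<in> W" if "k \<in> N" for k
          proof -
            have "(l', k) \<in> ?W'" using that l' UV by blast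
            then show ?thesis by simp
          qed
          ultimately show "l' \<in> {l \<in> topspace L. u l \<in> T'}"
            using u by (auto simp: T'_def continuous_map_def)
        qed
        ultimately show "\<exists>U. openin L U \<and> l \<in> U \<and> U \<subseteq> {l \<in> topspace L. u l \<in> T'}" by blast
      qed
    qed (auto simp: T'_def)
    then have "openin T T'" using T by (simp add: compactly_generated_def)
    moreover have "t0 \<in> T'" using N t0 by (auto simp: T'_def)
    moreover have "T' \<times> O' \<subseteq> W" using N by (auto simp: T'_def)
    ultimately show "\<exists>U V. openin T U \<and> openin K V \<and> t0 \<in> U \<and> k0 \<in> V \<and> U \<times> V \<subseteq> W"
      using N by blast
  qed
qed

lemma compactly_generated_prod_compact_Hausdorff_left:
  assumes "compactly_generated T" "compact_space K" "Hausdorff_space K"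
  shows "compactly_generated (prod_topology K T)"
proof (rule compactly_generated_quotient_map)
  show "compactly_generated (prod_topology T K)"
    using assms by (rule compactly_generated_prod_compact_Hausdorff)
  show "quotient_map (prod_topology T K) (prod_topology K T) (\<lambda>(x, y). (y, x))"
    using homeomorphic_map_swap[of T K] by (simp add: homeomorphic_map_def)
qed

lemma continuous_map_cg_prod_quotient_left:
  fixes q :: "'t \<Rightarrow> 'q" and B :: "'b topology"
  assumes q: "quotient_map T Q q" and T: "compactly_generated T"
    and f: "continuous_map (cg_prod T B) V (\<lambda>(t, b). f (q t, b))"
  shows "continuous_map (cg_prod Q B) V f"
proof (rule continuous_map_cg_prod_test)
  show "f \<in> topspace Q \<times> topspace B \<rightarrow> topspace V"
  proof safe
    fix z b assume "z \<in> topspace Q" and b: "b \<in> topspace B"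
    then obtain t where "t \<in> topspace T" "z = q t"
      using q by (auto simp: quotient_map_def)
    then show "f (z, b) \<in> topspace V"
      using continuous_map_funspace[OF f] b by force
  qed
next
  fix K :: "(('q \<times> 'b) \<times> nat) set set topology" and a b
  assume K: "compact_space K" "Hausdorff_space K"
    and a: "continuous_map K Q a" and b: "continuous_map K B b"
  have "continuous_map (prod_topology T K) V (\<lambda>z. (\<lambda>(t, b). f (q t, b)) (fst z, b (snd z)))"
    by (intro continuous_map_compose_cg_prod[OF f] compactly_generated_prod_compact_Hausdorff T K continuous_map_fst
        continuous_map_compose[OF continuous_map_snd b, unfolded o_def])
  then have "continuous_map (prod_topology T K) V ((\<lambda>(z, k). f (z, b k)) \<circ> (\<lambda>(t, k). (q t, k)))"
    by (simp add: o_def case_prod_unfold)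
  moreover have "quotient_map (prod_topology T K) (prod_topology Q K) (\<lambda>(t, k). (q t, k))"
    using K q by (simp add: quotient_map_prod_left compact_imp_locally_compact_space)
  ultimately have *: "continuous_map (prod_topology Q K) V (\<lambda>(z, k). f (z, b k))"
    using continuous_compose_quotient_map by blast
  have "continuous_map K (prod_topology Q K) (\<lambda>k. (a k, k))"
    by (simp add: continuous_map_pairwise o_def a)
  from continuous_map_compose[OF this *] show "continuous_map K V (\<lambda>k. f (a k, b k))"
    by (simp add: o_def)
qed

lemma continuous_map_cg_prod_quotient_right:
  assumes q: "quotient_map T Q q" and T: "compactly_generated T"
    and f: "continuous_map (cg_prod B T) V (\<lambda>(b, t). f (b, q t))"
  shows "continuous_map (cg_prod B Q) V f"
proof -
  have "continuous_map (cg_prod Q B) V (f \<circ> prod.swap)"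
  proof (rule continuous_map_cg_prod_quotient_left[OF q T])
    from continuous_map_compose[OF continuous_map_cg_prod_swap f]
    show "continuous_map (cg_prod T B) V (\<lambda>(t, b). (f \<circ> prod.swap) (q t, b))"
      by (rule continuous_map_eq) auto
  qed
  from continuous_map_compose[OF continuous_map_cg_prod_swap this] show ?thesis
    by (simp add: o_assoc[symmetric])
qed

subsection \<open>Homotopy retractions\<close>

lemma homotopic_spheroids_compose:
  assumes "homotopic_with (\<lambda>k. k ` S \<subseteq> {x}) A X g h" "continuous_map X Y f"
  shows "homotopic_with (\<lambda>k. k ` S \<subseteq> {f x}) A Y (f \<circ> g) (f \<circ> h)"
  by (rule homotopic_with_compose_continuous_map_left[OF assms]) auto

lemma spheroid_class_eq_iff:
  assumes "g \<in> spheroids n X x"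
  shows "spheroid_class n X x g = spheroid_class n X x h \<longleftrightarrow>
    homotopic_with (\<lambda>k. k ` cube_boundary n \<subseteq> {x}) (cube n) X g h"
proof
  assume eq: "spheroid_class n X x g = spheroid_class n X x h"
  have "g \<in> spheroid_class n X x g"
    using assms by (simp add: spheroid_class_def spheroids_def)
  then show "homotopic_with (\<lambda>k. k ` cube_boundary n \<subseteq> {x}) (cube n) X g h"
    unfolding eq by (simp add: spheroid_class_def homotopic_with_symD)
next
  assume "homotopic_with (\<lambda>k. k ` cube_boundary n \<subseteq> {x}) (cube n) X g h"
  then show "spheroid_class n X x g = spheroid_class n X x h"
    unfolding spheroid_class_def by (auto intro: homotopic_with_trans homotopic_with_symD)
qed

lemma homotopy_group_map_spheroid_class:
  assumes f: "continuous_map X Y f" and g: "g \<in> spheroids n X x"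
  shows "homotopy_group_map n Y f x (spheroid_class n X x g) = spheroid_class n Y (f x) (f \<circ> g)"
proof -
  have fg: "f \<circ> g \<in> spheroids n Y (f x)"
    using g f by (auto simp: spheroids_def intro: continuous_map_compose)
  have "spheroid_class n Y (f x) (f \<circ> h) = spheroid_class n Y (f x) (f \<circ> g)"
    if "h \<in> spheroid_class n X x g" for h
  proof -
    have "homotopic_with (\<lambda>k. k ` cube_boundary n \<subseteq> {x}) (cube n) X g h"
      using that by (simp add: spheroid_class_def)
    from homotopic_spheroids_compose[OF this f] show ?thesis
      using spheroid_class_eq_iff[OF fg, of "f \<circ> h"] by simp
  qed
  moreover have "g \<in> spheroid_class n X x g"
    using g by (simp add: spheroid_class_def spheroids_def)
  ultimately show ?thesis
    unfolding homotopy_group_map_def by blast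
qed

lemma path_component_of_continuous_map:
  assumes "path_component_of X x y" "continuous_map X Y f"
  shows "path_component_of Y (f x) (f y)"
proof -
  obtain g where "pathin X g" "g 0 = x" "g 1 = y"
    using assms by (auto simp: path_component_of_def)
  moreover from this have "pathin Y (f \<circ> g)"
    using assms pathin_compose by blast
  ultimately show ?thesis
    unfolding path_component_of_def by (intro exI[of _ "f \<circ> g"]) auto
qed

lemma path_components_map_component:
  assumes "continuous_map X Y f" "x \<in> topspace X"
  shows "path_components_map Y f (path_component_of_set X x) = path_component_of_set Y (f x)"
proof -
  have "path_component_of_set Y (f y) = path_component_of_set Y (f x)" if "path_component_of X x y" for y
    using path_component_of_continuous_map[OF that assms(1)]
    by (simp add: path_component_of_equiv)
  moreover have "path_component_of X x x"
    using assms by (simp add: path_component_of_refl)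
  ultimately show ?thesis
    unfolding path_components_map_def by blast
qed

section \<open>A collar around an inner cube\<close>

definition clamp01 :: "real \<Rightarrow> real" where
  "clamp01 r = max 0 (min 1 r)"

text \<open>Stretches the inner cube with coordinates in [1/4, 3/4] over the whole cube and sends
  the collar around it into the boundary.\<close>

definition cube_stretch :: "nat \<Rightarrow> (nat \<Rightarrow> real) \<Rightarrow> nat \<Rightarrow> real" where
  "cube_stretch n c = (\<lambda>i\<in>{..<n}. clamp01 (2 * c i - 1/2))"

text \<open>On the cube this vanishes exactly on the inner cube. A boundary coordinate overshoots
  the unit interval by 1/2, so the factor 2 brings the value up to 1 there.\<close>

definition cube_collar :: "nat \<Rightarrow> (nat \<Rightarrow> real) \<Rightarrow> real" where
  "cube_collar n c = min 1 (\<Sum>i<n. 2 * \<bar>2 * c i - 1/2 - clamp01 (2 * c i - 1/2)\<bar>)"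

lemma topspace_cube: "topspace (cube n) = {..<n} \<rightarrow>\<^sub>E {0..1}"
  by (simp add: cube_def)

lemma continuous_map_cube_coordinate:
  "i < n \<Longrightarrow> continuous_map (cube n) euclideanreal (\<lambda>c. c i)"
  using continuous_map_product_projection[of i "{..<n}" "\<lambda>_. top_of_set {0..1::real}"]
  by (simp add: cube_def continuous_map_in_subtopology)

lemma continuous_map_into_cube:
  assumes "\<And>i. i < n \<Longrightarrow> continuous_map X euclideanreal (\<lambda>x. f x i)"
    and "f \<in> topspace X \<rightarrow> ({..<n} \<rightarrow>\<^sub>E {0..1})"
  shows "continuous_map X (cube n) f"
  unfolding cube_def
  by (rule continuous_map_coordinatewise_then_product) (use assms in \<open>auto simp: continuous_map_in_subtopology PiE_def Pi_def extensional_def\<close>)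

lemma continuous_map_clamp01:
  "continuous_map X euclideanreal f \<Longrightarrow> continuous_map X euclideanreal (\<lambda>x. clamp01 (f x))"
  unfolding clamp01_def by (intro continuous_map_real_max continuous_map_real_min) auto

lemma cube_stretch_in: "cube_stretch n c \<in> {..<n} \<rightarrow>\<^sub>E {0..1}"
  by (auto simp: cube_stretch_def clamp01_def)

lemma cube_collar_in: "cube_collar n c \<in> {0..1}"
  by (auto simp: cube_collar_def intro!: sum_nonneg)

lemma continuous_map_cube_stretch: "continuous_map (cube n) (cube n) (cube_stretch n)"
  using cube_stretch_in
  by (intro continuous_map_into_cube)
    (auto simp: cube_stretch_def intro!: continuous_map_clamp01 continuous_intros continuous_map_cube_coordinate)

lemma continuous_map_cube_collar: "continuous_map (cube n) euclideanreal (cube_collar n)"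
  unfolding cube_collar_def
  by (intro continuous_map_real_min continuous_map_clamp01 continuous_intros continuous_map_cube_coordinate) auto

lemma cube_stretch_boundary:
  assumes "c \<in> cube_boundary n"
  shows "cube_stretch n c \<in> cube_boundary n"
proof -
  obtain i where "i < n" "c i = 0 \<or> c i = 1"
    using assms unfolding cube_boundary_def by blast
  moreover from this have "cube_stretch n c i = 0 \<or> cube_stretch n c i = 1"
    by (auto simp: cube_stretch_def clamp01_def)
  ultimately show ?thesis
    using cube_stretch_in[of n c] unfolding cube_boundary_def topspace_cube by blast
qed

lemma cube_collar_boundary:
  assumes "c \<in> cube_boundary n"
  shows "cube_collar n c = 1"
proof -
  obtain i where i: "i < n" "c i = 0 \<or> c i = 1"
    using assms by (auto simp: cube_boundary_def)
  then have "1 \<le> 2 * \<bar>2 * c i - 1/2 - clamp01 (2 * c i - 1/2)\<bar>"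
    by (auto simp: clamp01_def)
  also have "\<dots> \<le> (\<Sum>i<n. 2 * \<bar>2 * c i - 1/2 - clamp01 (2 * c i - 1/2)\<bar>)"
    using i by (intro member_le_sum) auto
  finally show ?thesis by (simp add: cube_collar_def)
qed

lemma cube_stretch_collar:
  assumes "cube_collar n c \<noteq> 0"
  shows "cube_stretch n c \<in> cube_boundary n"
proof -
  have "(\<Sum>i<n. 2 * \<bar>2 * c i - 1/2 - clamp01 (2 * c i - 1/2)\<bar>) \<noteq> 0"
    using assms by (auto simp: cube_collar_def)
  then obtain i where i: "i < n" "2 * \<bar>2 * c i - 1/2 - clamp01 (2 * c i - 1/2)\<bar> \<noteq> 0"
    by (rule sum.not_neutral_contains_not_neutral) simp
  then have "cube_stretch n c i = 0 \<or> cube_stretch n c i = 1"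
    by (simp add: cube_stretch_def clamp01_def max_def min_def split: if_splits)
  then show ?thesis
    using i(1) cube_stretch_in[of n c] unfolding cube_boundary_def topspace_cube by blast
qed

text \<open>A coordinate equal to 0 or 1 is fixed by \<open>cube_stretch n\<close>, so the straight
  line to the identity maps the boundary into itself, and composing with \<open>g\<close> keeps the
  base point.\<close>

lemma cube_stretch_homotopic:
  assumes g: "continuous_map (cube n) Z g" and gz: "g ` cube_boundary n \<subseteq> {z}"
  shows "homotopic_with (\<lambda>k. k ` cube_boundary n \<subseteq> {z}) (cube n) Z (g \<circ> cube_stretch n) g"
proof -
  let ?I = "top_of_set {0..1::real}"
  define e where "e = (\<lambda>(\<sigma>::real, c). \<lambda>i\<in>{..<n}. (1 - \<sigma>) * cube_stretch n c i + \<sigma> * c i)"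
  have coord: "continuous_map (prod_topology ?I (cube n)) euclideanreal (\<lambda>z. snd z i)" if "i < n" for i
    using continuous_map_compose[OF continuous_map_snd continuous_map_cube_coordinate[OF that]] by (simp add: o_def)
  have str: "continuous_map (prod_topology ?I (cube n)) euclideanreal (\<lambda>z. cube_stretch n (snd z) i)" if "i < n" for i
    using that coord by (auto simp: cube_stretch_def intro!: continuous_map_clamp01 continuous_intros)
  have fst: "continuous_map (prod_topology ?I (cube n)) euclideanreal fst"
    using continuous_map_fst[of ?I "cube n"] continuous_map_into_fulltopology by blast
  have e_in: "e (\<sigma>, c) \<in> {..<n} \<rightarrow>\<^sub>E {0..1}" if "\<sigma> \<in> {0..1}" "c \<in> topspace (cube n)" for \<sigma> c
    using that cube_stretch_in[of n c] convex_bound_le[of "cube_stretch n c _" 1 "c _" "1-\<sigma>" \<sigma>]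
    by (auto simp: e_def topspace_cube PiE_iff)
  have e: "continuous_map (prod_topology ?I (cube n)) (cube n) e"
  proof (rule continuous_map_into_cube)
    show "continuous_map (prod_topology ?I (cube n)) euclideanreal (\<lambda>x. e x i)" if "i < n" for i
      using that coord[OF that] str[OF that] fst
      by (simp add: e_def case_prod_unfold) (intro continuous_intros)
    show "e \<in> topspace (prod_topology ?I (cube n)) \<rightarrow> ({..<n} \<rightarrow>\<^sub>E {0..1})"
    proof
      fix z assume "z \<in> topspace (prod_topology ?I (cube n))"
      then show "e z \<in> {..<n} \<rightarrow>\<^sub>E {0..1}"
        using e_in[of "fst z" "snd z"] by (cases z) simp
    qed
  qed
  have ext: "c \<in> topspace (cube n) \<Longrightarrow> restrict c {..<n} = c" "restrict (cube_stretch n c) {..<n} = cube_stretch n c" for c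
    using cube_stretch_in[of n c] by (auto simp: topspace_cube PiE_def extensional_restrict)
  have bd: "e (\<sigma>, c) \<in> cube_boundary n" if "\<sigma> \<in> {0..1}" and cb: "c \<in> cube_boundary n" for \<sigma> c
  proof -
    obtain i where i: "i < n" "c i = 0 \<or> c i = 1" and c: "c \<in> topspace (cube n)"
      using cb unfolding cube_boundary_def by blast
    then have "e (\<sigma>, c) i = 0 \<or> e (\<sigma>, c) i = 1"
      by (auto simp: e_def cube_stretch_def clamp01_def)
    then show ?thesis
      using e_in[OF that(1) c] i(1) by (auto simp: cube_boundary_def topspace_cube)
  qed
  show ?thesis
  proof (subst homotopic_with)
    show "\<exists>h. continuous_map (prod_topology ?I (cube n)) Z h \<and>
        (\<forall>c\<in>topspace (cube n). h (0, c) = (g \<circ> cube_stretch n) c) \<and>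
        (\<forall>c\<in>topspace (cube n). h (1, c) = g c) \<and>
        (\<forall>\<sigma>\<in>{0..1}. (\<lambda>c. h (\<sigma>, c)) ` cube_boundary n \<subseteq> {z})"
    proof (intro exI[of _ "g \<circ> e"] conjI ballI)
      show "continuous_map (prod_topology ?I (cube n)) Z (g \<circ> e)"
        by (rule continuous_map_compose[OF e g])
    qed (use bd gz ext in \<open>auto simp: e_def\<close>)
  qed (auto simp: cube_boundary_def image_subset_iff)
qed

text \<open>
  The homotopy need not fix the base point, but since it preserves the range of \<open>F\<close>, a spheroid
  surrounded by a collar that follows the trace of the base point is fixed by \<open>F \<circ> G\<close>.
\<close>

lemma weak_homotopy_equivalence_retraction:
  assumes F: "continuous_map W Z F" and G: "continuous_map Z W G"
    and GF: "\<And>w. w \<in> topspace W \<Longrightarrow> G (F w) = w"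
    and H: "continuous_map (prod_topology (top_of_set {0..1::real}) Z) Z H"
    and H0: "\<And>z. z \<in> topspace Z \<Longrightarrow> H (0, z) = F (G z)"
    and H1: "\<And>z. z \<in> topspace Z \<Longrightarrow> H (1, z) = z"
    and HF: "\<And>s w. \<lbrakk>s \<in> {0..1}; w \<in> topspace W\<rbrakk> \<Longrightarrow> H (s, F w) \<in> F ` topspace W"
  shows "weak_homotopy_equivalence W Z F"
  unfolding weak_homotopy_equivalence_def
proof (intro conjI allI impI ballI)
  have Fin: "F w \<in> topspace Z" if "w \<in> topspace W" for w
    using F that by (auto simp: continuous_map_def)
  have Gin: "G w \<in> topspace W" if "w \<in> topspace Z" for w
    using G that by (auto simp: continuous_map_def)
  show "bij_betw (path_components_map Z F) (path_components_of W) (path_components_of Z)"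
    unfolding bij_betw_def
  proof
    show "inj_on (path_components_map Z F) (path_components_of W)"
    proof (rule inj_onI)
      fix C D assume CD: "C \<in> path_components_of W" "D \<in> path_components_of W"
        and eq: "path_components_map Z F C = path_components_map Z F D"
      obtain x y where xy: "x \<in> topspace W" "y \<in> topspace W"
        and C: "C = path_component_of_set W x" and D: "D = path_component_of_set W y"
        using CD by (auto simp: path_components_of_def)
      then have "path_component_of_set Z (F x) = path_component_of_set Z (F y)"
        using eq path_components_map_component[OF F] by simp
      then have "path_component_of Z (F x) (F y)"
        using Fin xy path_component_of_refl[of Z "F y"] by blast
      from path_component_of_continuous_map[OF this G] have "path_component_of W x y"
        using xy GF by simp
      then show "C = D"
        unfolding C D by (simp add: path_component_of_equiv)
    qed
    have "path_component_of_set Z z \<in> path_components_map Z F ` path_components_of W" if z: "z \<in> topspace Z" for z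
    proof -
      have "continuous_map (top_of_set {0..1::real}) (prod_topology (top_of_set {0..1}) Z) (\<lambda>s. (s, z))"
        using z by (simp add: continuous_map_pairwise o_def)
      from continuous_map_compose[OF this H] have "pathin Z (\<lambda>s. H (s, z))"
        by (simp add: pathin_def o_def)
      then have "path_component_of Z (F (G z)) z"
        using H0[OF z] H1[OF z] unfolding path_component_of_def by (intro exI[of _ "\<lambda>s. H (s, z)"]) auto
      then have "path_component_of_set Z z = path_components_map Z F (path_component_of_set W (G z))"
        unfolding path_components_map_component[OF F Gin[OF z]]
        by (simp add: path_component_of_equiv)
      then show ?thesis
        using Gin[OF z] by (auto simp: path_components_of_def)
    qed
    then show "path_components_map Z F ` path_components_of W = path_components_of Z"
      using path_components_map_component[OF F] Fin by (auto simp: path_components_of_def)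
  qed
next
  fix n :: nat and x assume x: "x \<in> topspace W"
  have Fin: "F w \<in> topspace Z" if "w \<in> topspace W" for w
    using F that by (auto simp: continuous_map_def)
  let ?I = "top_of_set {0..1::real}"
  let ?hom = "\<lambda>X x. homotopic_with (\<lambda>k. k ` cube_boundary n \<subseteq> {x}) (cube n) X"
  have sphF: "F \<circ> g \<in> spheroids n Z (F x)" if "g \<in> spheroids n W x" for g
    using that F by (auto simp: spheroids_def intro: continuous_map_compose)
  \<comment> \<open>The two maps agree on the cube only, as functions they may differ outside it, so
    they are compared up to homotopy.\<close>
  have GFg: "?hom W x (G \<circ> (F \<circ> g)) g" if "g \<in> spheroids n W x" for g
  proof (rule homotopic_with_equal)
    have "g c \<in> topspace W" if "c \<in> topspace (cube n)" for c
      using that \<open>g \<in> spheroids n W x\<close> by (auto simp: spheroids_def continuous_map_def)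
    then show "\<And>c. c \<in> topspace (cube n) \<Longrightarrow> (G \<circ> (F \<circ> g)) c = g c"
      using GF by simp
    show "(G \<circ> (F \<circ> g)) ` cube_boundary n \<subseteq> {x}"
      using that GF[OF x] by (auto simp: spheroids_def)
  qed (use that F G in \<open>auto simp: spheroids_def intro!: continuous_map_compose\<close>)
  show "bij_betw (homotopy_group_map n Z F x) (homotopy_group n W x) (homotopy_group n Z (F x))"
    unfolding bij_betw_def
  proof
    show "inj_on (homotopy_group_map n Z F x) (homotopy_group n W x)"
    proof (rule inj_onI)
      fix C D assume CD: "C \<in> homotopy_group n W x" "D \<in> homotopy_group n W x"
        and eq: "homotopy_group_map n Z F x C = homotopy_group_map n Z F x D"
      obtain g h where gh: "g \<in> spheroids n W x" "h \<in> spheroids n W x"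
        and C: "C = spheroid_class n W x g" and D: "D = spheroid_class n W x h"
        using CD by (auto simp: homotopy_group_def)
      have "?hom Z (F x) (F \<circ> g) (F \<circ> h)"
        using eq homotopy_group_map_spheroid_class[OF F] spheroid_class_eq_iff[OF sphF] gh
        by (simp add: C D)
      from homotopic_spheroids_compose[OF this G] have "?hom W x (G \<circ> (F \<circ> g)) (G \<circ> (F \<circ> h))"
        using GF[OF x] by simp
      then have "?hom W x g h"
        using GFg gh by (meson homotopic_with_symD homotopic_with_trans)
      then show "C = D"
        unfolding C D by (simp add: spheroid_class_eq_iff gh)
    qed
    have "spheroid_class n Z (F x) g \<in> homotopy_group_map n Z F x ` homotopy_group n W x"
      if g: "g \<in> spheroids n Z (F x)" for g
    proof -
      have gc: "continuous_map (cube n) Z g" and gb: "\<And>c. c \<in> cube_boundary n \<Longrightarrow> g c = F x"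
        using g by (auto simp: spheroids_def)
      have gin: "g c \<in> topspace Z" if "c \<in> topspace (cube n)" for c
        using gc that by (auto simp: continuous_map_def)
      let ?e = "cube_stretch n" and ?d = "cube_collar n"
      have e_in: "?e c \<in> topspace (cube n)" for c
        using cube_stretch_in by (simp add: topspace_cube)
      \<comment> \<open>At \<open>\<sigma> = 0\<close> the inner cube carries a stretched copy of
        \<open>F \<circ> G \<circ> g\<close>, while on the collar, where \<open>g \<circ> ?e\<close>
        is constantly \<open>F x\<close>, the time of the homotopy rises to 1. Raising
        \<open>\<sigma>\<close> lifts the time to 1 everywhere, where \<open>H\<close> is the
        identity, and leaves only \<open>g \<circ> ?e\<close>. The boundary stays at time 1
        throughout.\<close>
      define \<Phi> where "\<Phi> = (\<lambda>(\<sigma>, c). H (max (?d c) \<sigma>, g (?e c)))"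
      define h where "h c = G (\<Phi> (0, c))" for c
      have d: "continuous_map (cube n) ?I ?d"
        using cube_collar_in continuous_map_cube_collar by (auto simp: continuous_map_in_subtopology)
      have \<Phi>: "continuous_map (prod_topology ?I (cube n)) Z \<Phi>"
      proof -
        have "continuous_map (prod_topology ?I (cube n)) euclideanreal fst"
          using continuous_map_fst[of ?I "cube n"] continuous_map_into_fulltopology by blast
        moreover have "continuous_map (prod_topology ?I (cube n)) euclideanreal (\<lambda>z. ?d (snd z))"
          using continuous_map_compose[OF continuous_map_snd continuous_map_cube_collar] by (simp add: o_def)
        ultimately have "continuous_map (prod_topology ?I (cube n)) euclideanreal (\<lambda>z. max (?d (snd z)) (fst z))"
          by (intro continuous_map_real_max)
        then have "continuous_map (prod_topology ?I (cube n)) ?I (\<lambda>z. max (?d (snd z)) (fst z))"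
          by (rule continuous_map_into_subtopology) (use cube_collar_in[of n] in \<open>auto simp: max_def\<close>)
        moreover have "continuous_map (prod_topology ?I (cube n)) Z (\<lambda>z. g (?e (snd z)))"
          using continuous_map_compose[OF continuous_map_snd continuous_map_compose[OF continuous_map_cube_stretch gc]]
          by (simp add: o_def)
        ultimately have "continuous_map (prod_topology ?I (cube n)) (prod_topology ?I Z)
            (\<lambda>z. (max (?d (snd z)) (fst z), g (?e (snd z))))"
          by (simp add: continuous_map_pairwise o_def)
        from continuous_map_compose[OF this H] show ?thesis
          by (simp add: \<Phi>_def o_def case_prod_unfold)
      qed
      have \<Phi>_bd: "\<Phi> (\<sigma>, c) = F x" if "c \<in> cube_boundary n" "\<sigma> \<in> {0..1}" for \<sigma> c
      proof -
        have "max (?d c) \<sigma> = 1"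
          using that cube_collar_boundary[OF that(1)] by simp
        then show ?thesis
          using gb[OF cube_stretch_boundary[OF that(1)]] H1[OF Fin[OF x]] by (simp add: \<Phi>_def)
      qed
      have "continuous_map (cube n) (prod_topology ?I (cube n)) (\<lambda>c. (0, c))"
        by (simp add: continuous_map_pairwise o_def)
      from continuous_map_compose[OF continuous_map_compose[OF this \<Phi>] G]
      have h: "h \<in> spheroids n W x"
        using GF[OF x] \<Phi>_bd by (auto simp: spheroids_def h_def[abs_def] o_def)
      \<comment> \<open>All values of \<open>\<Phi>\<close> at \<open>\<sigma> = 0\<close> lie in
        the range of \<open>F\<close>: on the inner cube by \<open>H0\<close>, on the collar because
        \<open>HF\<close> keeps the trace of \<open>F x\<close> there. On this range
        \<open>F \<circ> G\<close> is the identity.\<close>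
      have Fh: "F (h c) = \<Phi> (0, c)" if c: "c \<in> topspace (cube n)" for c
      proof (cases "?d c = 0")
        case True
        then have "\<Phi> (0, c) = F (G (g (?e c)))"
          using H0[OF gin[OF e_in]] by (simp add: \<Phi>_def)
        moreover have "G (g (?e c)) \<in> topspace W"
          using G gin[OF e_in] by (auto simp: continuous_map_def)
        ultimately show ?thesis by (simp add: h_def GF)
      next
        case False
        then have "g (?e c) = F x" by (intro gb cube_stretch_collar)
        then obtain w where "w \<in> topspace W" "\<Phi> (0, c) = F w"
          using HF[OF cube_collar_in x, of n c] cube_collar_in[of n c] by (auto simp: \<Phi>_def)
        then show ?thesis by (simp add: h_def GF)
      qed
      have "?hom Z (F x) (F \<circ> h) (g \<circ> ?e)"
      proof (subst homotopic_with)
        show "\<exists>k. continuous_map (prod_topology ?I (cube n)) Z k \<and>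
            (\<forall>c\<in>topspace (cube n). k (0, c) = (F \<circ> h) c) \<and>
            (\<forall>c\<in>topspace (cube n). k (1, c) = (g \<circ> ?e) c) \<and>
            (\<forall>\<sigma>\<in>{0..1}. (\<lambda>c. k (\<sigma>, c)) ` cube_boundary n \<subseteq> {F x})"
        proof (intro exI[of _ \<Phi>] conjI \<Phi> ballI)
          show "\<Phi> (1, c) = (g \<circ> ?e) c" for c
            using cube_collar_in[of n c] H1[OF gin[OF e_in]] by (simp add: \<Phi>_def max_def)
        qed (use Fh \<Phi>_bd in auto)
      qed (auto simp: cube_boundary_def image_subset_iff)
      moreover have "?hom Z (F x) (g \<circ> ?e) g"
        using gc gb by (intro cube_stretch_homotopic) auto
      ultimately have "?hom Z (F x) (F \<circ> h) g"
        by (rule homotopic_with_trans)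
      then have "spheroid_class n Z (F x) g = homotopy_group_map n Z F x (spheroid_class n W x h)"
        unfolding homotopy_group_map_spheroid_class[OF F h] using spheroid_class_eq_iff[OF sphF[OF h]] by metis
      then show ?thesis
        using h by (auto simp: homotopy_group_def)
    qed
    then show "homotopy_group_map n Z F x ` homotopy_group n W x = homotopy_group n Z (F x)"
      using homotopy_group_map_spheroid_class[OF F] sphF by (auto simp: homotopy_group_def)
  qed
qed (rule F)

subsection \<open>The monotone coupling of two points of simplices\<close>

definition partial_sum :: "(nat \<Rightarrow> real) \<Rightarrow> nat \<Rightarrow> real" where
  "partial_sum s k = (\<Sum>l<k. s l)"

text \<open>
  The length of the overlap of the \<open>i\<close>-th piece of the subdivision \<open>s\<close> and the \<open>j\<close>-th piece of
  \<open>t\<close>, written as a mixed second difference so that its sums telescope.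
\<close>

definition coupling :: "(nat \<Rightarrow> real) \<Rightarrow> (nat \<Rightarrow> real) \<Rightarrow> nat \<Rightarrow> nat \<Rightarrow> real" where
  "coupling s t i j =
     (min (partial_sum s (Suc i)) (partial_sum t (Suc j)) - min (partial_sum s i) (partial_sum t (Suc j))) -
     (min (partial_sum s (Suc i)) (partial_sum t j) - min (partial_sum s i) (partial_sum t j))"

lemma coupling_commute: "coupling s t i j = coupling t s j i"
  by (simp add: coupling_def min.commute)

lemma partial_sum_Suc: "partial_sum s (Suc k) = partial_sum s k + s k"
  by (simp add: partial_sum_def)

lemma partial_sum_mono:
  assumes "s \<in> standard_simplex p" "k \<le> l"
  shows "partial_sum s k \<le> partial_sum s l"
  unfolding partial_sum_def using assms
  by (intro sum_mono2) (auto simp: standard_simplex_def)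

lemma partial_sum_top: "s \<in> standard_simplex p \<Longrightarrow> partial_sum s (Suc p) = 1"
  by (simp add: partial_sum_def standard_simplex_def lessThan_Suc_atMost)

lemma partial_sum_nonneg: "s \<in> standard_simplex p \<Longrightarrow> 0 \<le> partial_sum s k"
  using partial_sum_mono[of s p 0 k] by (simp add: partial_sum_def)

text \<open>A face inserts a piece of length zero, so one breakpoint is repeated and the later ones
  shift by one.\<close>

lemma partial_sum_face:
  "partial_sum (simplical_face i s) k = partial_sum s (if k \<le> i then k else k - 1)"
proof (induction k)
  case (Suc k)
  show ?case
  proof (cases "k \<le> i")
    case True
    then show ?thesis
      using Suc by (auto simp: partial_sum_Suc simplical_face_def not_le Suc_le_eq order_less_le)
  next
    case False
    then have "k = Suc (k - 1)" and "simplical_face i s k = s (k - 1)"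
      by (auto simp: simplical_face_def)
    then show ?thesis
      using Suc False partial_sum_Suc[of s "k - 1"] by (simp add: partial_sum_Suc[of "simplical_face i s"])
  qed
qed (simp add: partial_sum_def)

lemma coupling_nonneg:
  assumes "s \<in> standard_simplex p" "t \<in> standard_simplex q"
  shows "0 \<le> coupling s t i j"
  using partial_sum_mono[OF assms(1), of i "Suc i"] partial_sum_mono[OF assms(2), of j "Suc j"]
  by (simp add: coupling_def min_def)

text \<open>The coface skips exactly the inserted piece of length zero, and the other pieces keep
  their endpoints.\<close>

lemma coupling_face:
  assumes "a \<le> p"
  shows "coupling (simplical_face i s) t (coface p i a) j = coupling s t a j"
  using assms by (auto simp: coupling_def coface_def partial_sum_face Suc_le_eq)

lemma sum_coupling:
  assumes "s \<in> standard_simplex p" "t \<in> standard_simplex q"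
  shows "(\<Sum>(i, j) \<in> {..p} \<times> {..q}. coupling s t i j) = 1"
proof -
  define f where "f i j = min (partial_sum s i) (partial_sum t j)" for i j
  \<comment> \<open>The lower end of the telescope vanishes: \<open>partial_sum t 0\<close> is 0 and
    the partial sums of \<open>s\<close> are nonnegative.\<close>
  have "(\<Sum>j<Suc q. coupling s t i j) = f (Suc i) (Suc q) - f i (Suc q)" for i
    using sum_lessThan_telescope[of "\<lambda>j. f (Suc i) j - f i j" "Suc q"]
      partial_sum_nonneg[OF assms(1), of i] partial_sum_nonneg[OF assms(1), of "Suc i"]
    by (simp add: coupling_def f_def partial_sum_def min_def)
  moreover have "(\<Sum>i<Suc p. f (Suc i) (Suc q) - f i (Suc q)) = 1"
    using sum_lessThan_telescope[of "\<lambda>i. f i (Suc q)" "Suc p"] partial_sum_top[OF assms(1)] partial_sum_top[OF assms(2)]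
    by (simp add: f_def partial_sum_def[of s 0])
  ultimately show ?thesis
    by (simp add: sum.cartesian_product[symmetric] lessThan_Suc_atMost)
qed

text \<open>Positive overlap means that the two intervals meet in their interiors. With
  \<open>i < i'\<close> and \<open>j' < j\<close>, comparing endpoints would give a strict cycle of
  inequalities.\<close>

lemma coupling_chain:
  assumes s: "s \<in> standard_simplex p" and t: "t \<in> standard_simplex q"
    and pos: "0 < coupling s t i j" "0 < coupling s t i' j'" and "i < i'"
  shows "j \<le> j'"
proof (rule ccontr)
  assume "\<not> j \<le> j'"
  have overlap: "partial_sum s i < partial_sum t (Suc j) \<and> partial_sum t j < partial_sum s (Suc i)"
    if "0 < coupling s t i j" for i j
    using that partial_sum_mono[OF s, of i "Suc i"] partial_sum_mono[OF t, of j "Suc j"]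
    by (auto simp: coupling_def min_def split: if_splits)
  have "partial_sum s i' < partial_sum t (Suc j')" using overlap pos by blast
  also have "\<dots> \<le> partial_sum t j" using \<open>\<not> j \<le> j'\<close> by (intro partial_sum_mono[OF t]) simp
  also have "\<dots> < partial_sum s (Suc i)" using overlap pos by blast
  also have "\<dots> \<le> partial_sum s i'" using \<open>i < i'\<close> by (intro partial_sum_mono[OF s]) simp
  finally show False by simp
qed

text \<open>
  A lattice path \<open>(n, \<alpha>, \<beta>)\<close> supports the coupling if no mass lies off the path; this is expressed
  by the total mass on the path, so that it is a closed condition on \<open>(s, t)\<close>.
\<close>

definition lattice_paths :: "nat \<Rightarrow> nat \<Rightarrow> (nat \<times> (nat \<Rightarrow> nat) \<times> (nat \<Rightarrow> nat)) set" where
  "lattice_paths p q =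
     {(n, \<alpha>, \<beta>). \<alpha> \<in> \<Delta>_hom n p \<and> \<beta> \<in> \<Delta>_hom n q \<and> inj_on (\<lambda>k. (\<alpha> k, \<beta> k)) {..n}}"

definition supports :: "nat \<Rightarrow> nat \<Rightarrow> (nat \<Rightarrow> real) \<Rightarrow> (nat \<Rightarrow> real) \<Rightarrow> nat \<Rightarrow> (nat \<Rightarrow> nat) \<Rightarrow> (nat \<Rightarrow> nat) \<Rightarrow> bool" where
  "supports p q s t n \<alpha> \<beta> \<longleftrightarrow>
     (n, \<alpha>, \<beta>) \<in> lattice_paths p q \<and> (\<Sum>k\<le>n. coupling s t (\<alpha> k) (\<beta> k)) = 1"

definition path_weights :: "(nat \<Rightarrow> real) \<Rightarrow> (nat \<Rightarrow> real) \<Rightarrow> nat \<Rightarrow> (nat \<Rightarrow> nat) \<Rightarrow> (nat \<Rightarrow> nat) \<Rightarrow> nat \<Rightarrow> real" where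
  "path_weights s t n \<alpha> \<beta> = (\<lambda>k. if k \<le> n then coupling s t (\<alpha> k) (\<beta> k) else 0)"

lemma \<Delta>_hom_bound: "\<alpha> \<in> \<Delta>_hom n p \<Longrightarrow> k \<le> n \<Longrightarrow> \<alpha> k \<le> p"
  by (auto simp: \<Delta>_hom_def)

lemma \<Delta>_hom_mono: "\<alpha> \<in> \<Delta>_hom n p \<Longrightarrow> k \<le> l \<Longrightarrow> l \<le> n \<Longrightarrow> \<alpha> k \<le> \<alpha> l"
  by (auto simp: \<Delta>_hom_def mono_on_def)

lemma \<Delta>_homI:
  assumes "\<And>k. k \<le> n \<Longrightarrow> \<alpha> k \<le> p" "\<And>k l. k \<le> l \<Longrightarrow> l \<le> n \<Longrightarrow> \<alpha> k \<le> \<alpha> l"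
  shows "restrict \<alpha> {..n} \<in> \<Delta>_hom n p"
  using assms by (auto simp: \<Delta>_hom_def intro!: mono_onI)

lemma \<Delta>_hom_compose:
  assumes "\<theta> \<in> \<Delta>_hom n p" "\<alpha> \<in> \<Delta>_hom m n"
  shows "compose {..m} \<theta> \<alpha> \<in> \<Delta>_hom m p"
  unfolding compose_def using assms by (intro \<Delta>_homI) (auto intro: \<Delta>_hom_bound \<Delta>_hom_mono)

lemma coface_in_\<Delta>_hom: "coface p i \<in> \<Delta>_hom p (Suc p)"
  unfolding coface_def by (rule \<Delta>_homI) auto

lemma finite_\<Delta>_hom: "finite (\<Delta>_hom n p)"
  by (rule finite_subset[of _ "{..n} \<rightarrow>\<^sub>E {..p}"]) (auto simp: \<Delta>_hom_def intro: finite_PiE)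

text \<open>Injectivity into the finite grid bounds the length of a path. Finiteness is what pasting
  along closed sets requires.\<close>

lemma finite_lattice_paths: "finite (lattice_paths p q)"
proof (rule finite_subset)
  show "lattice_paths p q \<subseteq> (SIGMA n:{..card ({..p} \<times> {..q})}. \<Delta>_hom n p \<times> \<Delta>_hom n q)"
  proof -
    have "n \<le> card ({..p} \<times> {..q})" if *: "\<alpha> \<in> \<Delta>_hom n p" "\<beta> \<in> \<Delta>_hom n q" "inj_on (\<lambda>k. (\<alpha> k, \<beta> k)) {..n}" for n \<alpha> \<beta>
    proof -
      have "card {..n} \<le> card ({..p} \<times> {..q})"
        using * by (intro card_inj_on_le[OF *(3)]) (auto intro: \<Delta>_hom_bound)
      then show ?thesis by simp
    qed
    then show ?thesis unfolding lattice_paths_def by blast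
  qed
qed (auto intro: finite_\<Delta>_hom)

lemma path_weights_in_simplex:
  assumes "s \<in> standard_simplex p" "t \<in> standard_simplex q" "supports p q s t n \<alpha> \<beta>"
  shows "path_weights s t n \<alpha> \<beta> \<in> standard_simplex n"
proof -
  have "coupling s t (\<alpha> k) (\<beta> k) \<le> (\<Sum>k\<le>n. coupling s t (\<alpha> k) (\<beta> k))" if "k \<le> n" for k
    using that coupling_nonneg[OF assms(1,2)] by (intro member_le_sum) auto
  then show ?thesis
    using assms(3) coupling_nonneg[OF assms(1,2)]
    by (auto simp: standard_simplex_def path_weights_def supports_def)
qed

text \<open>The path already carries the whole mass 1, so a cell of positive mass off the path would
  push the total over all cells above 1.\<close>

lemma supports_covers:
  assumes s: "s \<in> standard_simplex p" and t: "t \<in> standard_simplex q"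
    and sup: "supports p q s t n \<alpha> \<beta>" and ij: "i \<le> p" "j \<le> q" and pos: "0 < coupling s t i j"
  shows "\<exists>k\<le>n. \<alpha> k = i \<and> \<beta> k = j"
proof (rule ccontr)
  assume none: "\<not> (\<exists>k\<le>n. \<alpha> k = i \<and> \<beta> k = j)"
  let ?R = "(\<lambda>k. (\<alpha> k, \<beta> k)) ` {..n}"
  have "inj_on (\<lambda>k. (\<alpha> k, \<beta> k)) {..n}" and hom: "\<alpha> \<in> \<Delta>_hom n p" "\<beta> \<in> \<Delta>_hom n q"
    and one: "(\<Sum>k\<le>n. coupling s t (\<alpha> k) (\<beta> k)) = 1"
    using sup by (auto simp: supports_def lattice_paths_def)
  then have "(\<Sum>(i, j) \<in> ?R. coupling s t i j) = 1"
    by (simp add: sum.reindex)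
  then have "1 + coupling s t i j = (\<Sum>(i, j) \<in> insert (i, j) ?R. coupling s t i j)"
    using none by (subst sum.insert) auto
  also have "\<dots> \<le> (\<Sum>(i, j) \<in> {..p} \<times> {..q}. coupling s t i j)"
    using ij hom coupling_nonneg[OF s t] by (intro sum_mono2) (auto intro: \<Delta>_hom_bound)
  finally show False
    using pos sum_coupling[OF s t] by simp
qed

text \<open>By \<open>coupling_chain\<close> the cells of positive mass form a chain in the product
  order. Hence \<open>i + j\<close> is injective on them, and sorting by it lists them as a
  path.\<close>

lemma supports_positive_exists:
  assumes s: "s \<in> standard_simplex p" and t: "t \<in> standard_simplex q"
  obtains n \<alpha> \<beta> where "supports p q s t n \<alpha> \<beta>" "\<And>k. k \<le> n \<Longrightarrow> 0 < coupling s t (\<alpha> k) (\<beta> k)"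
proof -
  define D where "D = {(i, j) \<in> {..p} \<times> {..q}. 0 < coupling s t i j}"
  have fin: "finite D" unfolding D_def by (rule finite_subset[of _ "{..p} \<times> {..q}"]) auto
  have D_sum: "(\<Sum>(i, j) \<in> D. coupling s t i j) = 1"
  proof -
    have "(\<Sum>(i, j) \<in> D. coupling s t i j) = (\<Sum>(i, j) \<in> {..p} \<times> {..q}. coupling s t i j)"
      using coupling_nonneg[OF s t] by (intro sum.mono_neutral_left) (auto simp: D_def order_le_less)
    then show ?thesis using sum_coupling[OF s t] by simp
  qed
  have chain: "i \<le> i' \<and> j \<le> j'" if "(i, j) \<in> D" "(i', j') \<in> D" "i + j \<le> i' + j'" for i j i' j'
    using that coupling_chain[OF s t, of i j i' j'] coupling_chain[OF s t, of i' j' i j]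
    unfolding D_def by (cases i i' rule: linorder_cases) auto
  define f where "f = (\<lambda>(i, j). i + j :: nat)"
  have inj: "inj_on f D"
    using chain by (force simp: inj_on_def f_def intro: antisym)
  define l where "l = sorted_list_of_set (f ` D)"
  define g where "g k = inv_into D f (l ! k)" for k
  have "D \<noteq> {}" using D_sum by auto
  have len: "length l = card D"
    by (simp add: l_def card_image inj)
  then have pos: "0 < length l"
    using fin \<open>D \<noteq> {}\<close> by (simp add: card_gt_0_iff)
  \<comment> \<open>A path indexed by \<open>{..n}\<close> has \<open>n + 1\<close> cells; the
    subtraction is exact because total mass 1 forces \<open>D\<close> to be nonempty.\<close>
  define n where "n = length l - 1"
  have n: "k \<le> n \<longleftrightarrow> k < length l" for k
    using pos unfolding n_def by linarith
  have set_l: "set l = f ` D" using fin by (simp add: l_def)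
  have g: "g k \<in> D" "f (g k) = l ! k" if "k \<le> n" for k
    using that set_l nth_mem[of k l] by (auto simp: g_def n inv_into_into f_inv_into_f)
  have l_less: "l ! k < l ! k'" if "k < k'" "k' \<le> n" for k k'
    using that sorted_wrt_nth_less[of "(<)" l k k'] by (simp add: l_def n)
  have g_bij: "bij_betw g {..n} D"
    unfolding bij_betw_def
  proof
    show inj_g: "inj_on g {..n}"
      using l_less g(2) by (metis atMost_iff inj_onI linorder_neqE_nat order_less_irrefl)
    then have "card (g ` {..n}) = card D"
      using len pos by (simp add: card_image n_def)
    then show "g ` {..n} = D"
      using g fin by (intro card_subset_eq) auto
  qed
  let ?\<alpha> = "restrict (fst \<circ> g) {..n}" and ?\<beta> = "restrict (snd \<circ> g) {..n}"
  have mono: "fst (g k) \<le> fst (g k') \<and> snd (g k) \<le> snd (g k')" if "k \<le> k'" "k' \<le> n" for k k'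
  proof (cases "k = k'")
    case False
    then have "f (g k) \<le> f (g k')" using l_less[of k k'] that g(2)[of k] g(2)[of k'] by simp
    then show ?thesis
      using chain[of "fst (g k)" "snd (g k)" "fst (g k')" "snd (g k')"] g(1)[of k] g(1)[of k'] that
      by (simp add: f_def case_prod_unfold)
  qed simp
  have in_D: "fst (g k) \<le> p \<and> snd (g k) \<le> q \<and> 0 < coupling s t (fst (g k)) (snd (g k))" if "k \<le> n" for k
    using g(1)[OF that] by (auto simp: D_def)
  have "(\<Sum>k\<le>n. coupling s t (?\<alpha> k) (?\<beta> k)) = (\<Sum>k\<le>n. (\<lambda>(i, j). coupling s t i j) (g k))"
    by (intro sum.cong) (auto simp: case_prod_unfold)
  also have "\<dots> = 1"
    using sum.reindex_bij_betw[OF g_bij, of "\<lambda>(i, j). coupling s t i j"] D_sum by simp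
  finally have one: "(\<Sum>k\<le>n. coupling s t (?\<alpha> k) (?\<beta> k)) = 1" .
  have "?\<alpha> \<in> \<Delta>_hom n p" "?\<beta> \<in> \<Delta>_hom n q"
    using mono in_D by (auto intro!: \<Delta>_homI)
  moreover have "inj_on (\<lambda>k. (?\<alpha> k, ?\<beta> k)) {..n}"
    using g_bij by (auto simp: bij_betw_def inj_on_def prod_eq_iff)
  ultimately have "supports p q s t n ?\<alpha> ?\<beta>"
    using one by (simp add: supports_def lattice_paths_def)
  then show ?thesis
    by (rule that) (use in_D in auto)
qed

text \<open>In barycentric coordinates, the affine map of simplices that sends vertex
  \<open>k\<close> to vertex \<open>\<theta> k\<close>. It is applied to injective
  \<open>\<theta>\<close>, where it inserts zeros.\<close>

definition simplex_push :: "nat \<Rightarrow> (nat \<Rightarrow> nat) \<Rightarrow> (nat \<Rightarrow> real) \<Rightarrow> nat \<Rightarrow> real" where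
  "simplex_push n \<theta> w = (\<lambda>j. \<Sum>k | k \<le> n \<and> \<theta> k = j. w k)"

lemma simplex_push_inj:
  "inj_on \<theta> {..n} \<Longrightarrow> k \<le> n \<Longrightarrow> simplex_push n \<theta> w (\<theta> k) = w k"
proof -
  assume "inj_on \<theta> {..n}" "k \<le> n"
  then have "{l. l \<le> n \<and> \<theta> l = \<theta> k} = {k}" by (auto simp: inj_on_def)
  then show ?thesis by (simp add: simplex_push_def)
qed

lemma simplex_push_outside: "j \<notin> \<theta> ` {..n} \<Longrightarrow> simplex_push n \<theta> w j = 0"
  by (auto simp: simplex_push_def intro!: sum.neutral)

lemma simplex_push_in_simplex:
  assumes \<theta>: "\<theta> \<in> \<Delta>_hom n p" and inj: "inj_on \<theta> {..n}" and w: "w \<in> standard_simplex n"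
  shows "simplex_push n \<theta> w \<in> standard_simplex p"
proof -
  have "0 \<le> simplex_push n \<theta> w j \<and> simplex_push n \<theta> w j \<le> 1 \<and> (p < j \<longrightarrow> simplex_push n \<theta> w j = 0)" for j
  proof (cases "j \<in> \<theta> ` {..n}")
    case True
    then obtain k where "k \<le> n" "j = \<theta> k" by auto
    then show ?thesis
      using w simplex_push_inj[OF inj] \<Delta>_hom_bound[OF \<theta>, of k] by (auto simp: standard_simplex_def)
  qed (simp add: simplex_push_outside)
  moreover have "sum (simplex_push n \<theta> w) {..p} = 1"
  proof -
    have "sum (simplex_push n \<theta> w) {..p} = sum (simplex_push n \<theta> w) (\<theta> ` {..n})"
      using \<Delta>_hom_bound[OF \<theta>] by (intro sum.mono_neutral_right) (auto simp: simplex_push_outside)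
    also have "\<dots> = sum w {..n}"
      by (simp add: sum.reindex inj simplex_push_inj)
    finally show ?thesis using w by (simp add: standard_simplex_def)
  qed
  ultimately show ?thesis by (auto simp: standard_simplex_def)
qed

subsection \<open>Points and maps of fat realisations\<close>

lemma simplicial_space_act_in:
  "\<lbrakk>simplicial_space X; \<theta> \<in> \<Delta>_hom m n; x \<in> topspace (level X n)\<rbrakk> \<Longrightarrow> act X m n \<theta> x \<in> topspace (level X m)"
  unfolding simplicial_space_def continuous_map_def by blast

lemma simplicial_space_act_compose:
  "\<lbrakk>simplicial_space X; \<phi> \<in> \<Delta>_hom l m; \<theta> \<in> \<Delta>_hom m n; x \<in> topspace (level X n)\<rbrakk>
   \<Longrightarrow> act X l m \<phi> (act X m n \<theta> x) = act X l n (compose {..l} \<theta> \<phi>) x"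
  unfolding simplicial_space_def by simp

lemma simplicial_space_act_id:
  "\<lbrakk>simplicial_space X; x \<in> topspace (level X n)\<rbrakk> \<Longrightarrow> act X n n (restrict (\<lambda>j. j) {..n}) x = x"
  unfolding simplicial_space_def by blast

lemma simplicial_space_face_in:
  "\<lbrakk>simplicial_space X; x \<in> topspace (level X (Suc p))\<rbrakk> \<Longrightarrow> face X p i x \<in> topspace (level X p)"
  unfolding face_def by (rule simplicial_space_act_in[OF _ coface_in_\<Delta>_hom])

lemma topspace_simplex_space [simp]: "topspace (simplex_space p) = standard_simplex p"
  by (simp add: simplex_space_def)

section \<open>Classes of points and maps defined on representatives\<close>

definition fat_point :: "'a sspace \<Rightarrow> nat \<Rightarrow> 'a \<Rightarrow> (nat \<Rightarrow> real) \<Rightarrow> (nat \<times> 'a \<times> (nat \<Rightarrow> real)) set" where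
  "fat_point X p x t = fat_equiv X `` {(p, x, t)}"

lemma fat_equiv_sym: "(z, z') \<in> fat_equiv X \<Longrightarrow> (z', z) \<in> fat_equiv X"
proof -
  have "sym (fat_equiv X)"
    unfolding fat_equiv_def by (intro sym_rtrancl) (auto simp: sym_def)
  then show "(z, z') \<in> fat_equiv X \<Longrightarrow> (z', z) \<in> fat_equiv X" by (rule symD)
qed

lemma fat_equiv_trans: "\<lbrakk>(z, z') \<in> fat_equiv X; (z', z'') \<in> fat_equiv X\<rbrakk> \<Longrightarrow> (z, z'') \<in> fat_equiv X"
  unfolding fat_equiv_def by (rule rtrancl_trans)

lemma fat_point_self: "(p, x, t) \<in> fat_point X p x t"
  by (simp add: fat_point_def fat_equiv_def)

lemma fat_point_face:
  assumes "i \<le> Suc p" "x \<in> topspace (level X (Suc p))" "t \<in> standard_simplex p"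
  shows "fat_point X (Suc p) x (simplical_face i t) = fat_point X p (face X p i x) t"
proof -
  have "((Suc p, x, simplical_face i t), (p, face X p i x, t)) \<in> fat_equiv X"
    unfolding fat_equiv_def using assms by (intro r_into_rtrancl) (auto simp: fat_glue_def)
  then show ?thesis
    unfolding fat_point_def using fat_equiv_sym fat_equiv_trans by blast
qed

lemma topspace_fat_total:
  "topspace (fat_total X) = (SIGMA p:UNIV. topspace (level X p) \<times> standard_simplex p)"
  by (simp add: fat_total_def cg_prod_def o_def)

lemma fat_point_in:
  "\<lbrakk>x \<in> topspace (level X p); t \<in> standard_simplex p\<rbrakk> \<Longrightarrow> fat_point X p x t \<in> topspace (fat_realisation X)"
  by (auto simp: fat_realisation_def fat_point_def topspace_fat_total intro: quotientI)

lemma fat_realisation_cases: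
  assumes "A \<in> topspace (fat_realisation X)"
  obtains p x t where "x \<in> topspace (level X p)" "t \<in> standard_simplex p" "A = fat_point X p x t"
  using assms unfolding fat_realisation_def fat_point_def
  by (auto simp: topspace_fat_total quotient_def)

lemma fat_equiv_invariant:
  assumes "\<And>p i x t. \<lbrakk>i \<le> Suc p; x \<in> topspace (level X (Suc p)); t \<in> standard_simplex p\<rbrakk>
      \<Longrightarrow> f (Suc p, x, simplical_face i t) = f (p, face X p i x, t)"
    and "(z, z') \<in> fat_equiv X"
  shows "f z = f z'"
  using assms(2) unfolding fat_equiv_def
proof (induction rule: rtrancl_induct)
  case (step y z)
  then show ?case using assms(1) by (auto simp: fat_glue_def)
qed simp

text \<open>An arbitrary representative is evaluated; a union over representatives, as in
  \<open>fat_map\<close>, would force the values to be sets.\<close>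

definition fat_lift :: "(nat \<times> 'a \<times> (nat \<Rightarrow> real) \<Rightarrow> 'b) \<Rightarrow> (nat \<times> 'a \<times> (nat \<Rightarrow> real)) set \<Rightarrow> 'b" where
  "fat_lift f C = f (SOME z. z \<in> C)"

lemma fat_lift_point:
  assumes "\<And>p i x t. \<lbrakk>i \<le> Suc p; x \<in> topspace (level X (Suc p)); t \<in> standard_simplex p\<rbrakk>
      \<Longrightarrow> f (Suc p, x, simplical_face i t) = f (p, face X p i x, t)"
  shows "fat_lift f (fat_point X p x t) = f (p, x, t)"
proof -
  have "(SOME z. z \<in> fat_point X p x t) \<in> fat_point X p x t"
    by (rule someI, rule fat_point_self)
  then have "((p, x, t), SOME z. z \<in> fat_point X p x t) \<in> fat_equiv X"
    by (simp add: fat_point_def)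
  then show ?thesis
    unfolding fat_lift_def using fat_equiv_invariant[of X f, OF assms] by metis
qed

lemma fat_map_point:
  assumes "\<And>p i x. i \<le> Suc p \<Longrightarrow> x \<in> topspace (level X (Suc p)) \<Longrightarrow>
      \<phi> (Suc p) x \<in> topspace (level Y (Suc p)) \<and> face Y p i (\<phi> (Suc p) x) = \<phi> p (face X p i x)"
  shows "fat_map Y \<phi> (fat_point X p x t) = fat_point Y p (\<phi> p x) t"
proof -
  define f where "f = (\<lambda>(p, x, t). fat_point Y p (\<phi> p x) t)"
  have "f z = f (p, x, t)" if "z \<in> fat_point X p x t" for z
  proof (rule fat_equiv_invariant[symmetric])
    show "((p, x, t), z) \<in> fat_equiv X" using that by (simp add: fat_point_def)
  qed (use assms in \<open>simp add: f_def fat_point_face\<close>)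
  moreover have "fat_map Y \<phi> (fat_point X p x t) = (\<Union>z \<in> fat_point X p x t. f z)"
    by (auto simp: fat_map_def f_def fat_point_def)
  ultimately show ?thesis
    using fat_point_self[of p x t X] by (auto simp: f_def)
qed

section \<open>Continuity of maps out of realisations\<close>

lemma quotient_map_fat_realisation:
  "quotient_map (fat_total X) (fat_realisation X) (\<lambda>(p, x, t). fat_point X p x t)"
  using quotient_map_quotient_topology[of "fat_total X" "fat_equiv X"]
  by (simp add: fat_realisation_def fat_point_def case_prod_unfold)

lemma compactly_generated_fat_total: "compactly_generated (fat_total X)"
  unfolding fat_total_def by (intro compactly_generated_sum compactly_generated_cg_prod)

lemma continuous_map_fat_point:
  "continuous_map (cg_prod (level X p) (simplex_space p)) (fat_realisation X) (\<lambda>(x, t). fat_point X p x t)"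
proof -
  have "continuous_map (cg_prod (level X p) (simplex_space p)) (fat_total X) (Pair p)"
    unfolding fat_total_def by (rule continuous_map_component_injection) simp
  from continuous_map_compose[OF this quotient_imp_continuous_map[OF quotient_map_fat_realisation]]
  show ?thesis by (simp add: o_def)
qed

lemma continuous_map_from_sum_topology:
  assumes "\<And>i. i \<in> I \<Longrightarrow> continuous_map (A i) V (\<lambda>x. f (i, x))"
  shows "continuous_map (sum_topology A I) V f"
  unfolding continuous_map_def
proof (intro conjI allI impI)
  show "f \<in> topspace (sum_topology A I) \<rightarrow> topspace V"
    using assms by (fastforce simp: continuous_map_def)
next
  fix U assume U: "openin V U"
  have "openin (A i) {x. (i, x) \<in> {z \<in> topspace (sum_topology A I). f z \<in> U}}" if "i \<in> I" for i
    using openin_continuous_map_preimage[OF assms[OF that] U] that by simp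
  then show "openin (sum_topology A I) {z \<in> topspace (sum_topology A I). f z \<in> U}"
    by (auto simp: openin_sum_topology)
qed

lemma continuous_map_from_fat_realisation:
  assumes "\<And>p. continuous_map (cg_prod (level X p) (simplex_space p)) V (\<lambda>(x, t). f (fat_point X p x t))"
  shows "continuous_map (fat_realisation X) V f"
proof (rule continuous_compose_quotient_map[OF quotient_map_fat_realisation])
  show "continuous_map (fat_total X) V (f \<circ> (\<lambda>(p, x, t). fat_point X p x t))"
    unfolding fat_total_def
    by (rule continuous_map_from_sum_topology) (use assms in \<open>simp add: o_def case_prod_unfold\<close>)
qed

lemma continuous_map_from_fat_realisation_prod_right:
  assumes "\<And>p. continuous_map (cg_prod B (cg_prod (level X p) (simplex_space p))) V
      (\<lambda>(b, x, t). f (b, fat_point X p x t))"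
  shows "continuous_map (cg_prod B (fat_realisation X)) V f"
proof (rule continuous_map_cg_prod_quotient_right[OF quotient_map_fat_realisation compactly_generated_fat_total])
  show "continuous_map (cg_prod B (fat_total X)) V (\<lambda>(b, z). f (b, case z of (p, x, t) \<Rightarrow> fat_point X p x t))"
    unfolding fat_total_def
    by (rule continuous_map_cg_prod_sum_right) (use assms in \<open>simp add: case_prod_unfold\<close>)
qed

lemma continuous_map_from_fat_realisation_prod_left:
  assumes "\<And>p. continuous_map (cg_prod (cg_prod (level X p) (simplex_space p)) B) V
      (\<lambda>((x, t), b). f (fat_point X p x t, b))"
  shows "continuous_map (cg_prod (fat_realisation X) B) V f"
proof (rule continuous_map_cg_prod_quotient_left[OF quotient_map_fat_realisation compactly_generated_fat_total])
  show "continuous_map (cg_prod (fat_total X) B) V (\<lambda>(z, b). f (case z of (p, x, t) \<Rightarrow> fat_point X p x t, b))"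
    unfolding fat_total_def
    by (rule continuous_map_cg_prod_sum_left) (use assms in \<open>simp add: case_prod_unfold\<close>)
qed

lemma continuous_map_fat_map:
  assumes nat: "\<And>p i x. i \<le> Suc p \<Longrightarrow> x \<in> topspace (level X (Suc p)) \<Longrightarrow>
      face Y p i (\<phi> (Suc p) x) = \<phi> p (face X p i x)"
    and cont: "\<And>p. continuous_map (level X p) (level Y p) (\<phi> p)"
  shows "continuous_map (fat_realisation X) (fat_realisation Y) (fat_map Y \<phi>)"
proof (rule continuous_map_from_fat_realisation)
  fix p
  let ?D = "cg_prod (level X p) (simplex_space p)"
  have "fat_map Y \<phi> (fat_point X p x t) = fat_point Y p (\<phi> p x) t" for x t
    using nat continuous_map_funspace[OF cont] by (intro fat_map_point) blast
  moreover have "continuous_map ?D (fat_realisation Y) (\<lambda>z. (\<lambda>(x, t). fat_point Y p x t) (\<phi> p (fst z), snd z))"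
    by (intro continuous_map_compose_cg_prod[OF continuous_map_fat_point] compactly_generated_cg_prod
        continuous_map_cg_prod_snd continuous_map_compose[OF continuous_map_cg_prod_fst cont, unfolded o_def])
  ultimately show "continuous_map ?D (fat_realisation Y) (\<lambda>(x, t). fat_map Y \<phi> (fat_point X p x t))"
    by (simp add: case_prod_unfold)
qed

section \<open>Gluing along injective monotone maps\<close>

lemma simplex_push_face:
  assumes \<theta>: "\<theta> \<in> \<Delta>_hom n p" and i: "i \<le> Suc p" and inj: "inj_on \<theta> {..n}"
  shows "simplex_push n (compose {..n} (coface p i) \<theta>) w = simplical_face i (simplex_push n \<theta> w)"
proof
  fix j
  have set_eq: "{k. k \<le> n \<and> compose {..n} (coface p i) \<theta> k = j} =
      (if j = i then {} else {k. k \<le> n \<and> \<theta> k = (if j < i then j else j - 1)})"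
    using \<Delta>_hom_bound[OF \<theta>] by (auto simp: compose_def coface_def split: if_splits)
  show "simplex_push n (compose {..n} (coface p i) \<theta>) w j = simplical_face i (simplex_push n \<theta> w) j"
    unfolding simplex_push_def set_eq by (auto simp: simplical_face_def simplex_push_def)
qed

text \<open>Injective and monotone gives strictly increasing, so induction upwards from 0 bounds
  \<open>\<theta> k\<close> below by \<open>k\<close>, and induction downwards from the top bounds
  it above by \<open>k\<close>.\<close>

lemma \<Delta>_hom_onto_imp_id:
  assumes \<theta>: "\<theta> \<in> \<Delta>_hom n p" and inj: "inj_on \<theta> {..n}" and onto: "\<theta> ` {..n} = {..p}"
  shows "n = p \<and> \<theta> = restrict (\<lambda>j. j) {..p}"
proof -
  have "n = p"
    using card_image[OF inj] onto by simp
  have less: "\<theta> k < \<theta> (Suc k)" if "Suc k \<le> n" for k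
    using that \<Delta>_hom_mono[OF \<theta>, of k "Suc k"] inj_onD[OF inj, of k "Suc k"] by (force simp: order_le_less)
  have lower: "k \<le> n \<longrightarrow> k \<le> \<theta> k" for k
  proof (induction k)
    case (Suc k)
    then show ?case using less[of k] by auto
  qed simp
  have upper: "d \<le> n \<longrightarrow> \<theta> (n - d) \<le> n - d" for d
  proof (induction d)
    case 0
    then show ?case using \<Delta>_hom_bound[OF \<theta>, of n] \<open>n = p\<close> by simp
  next
    case (Suc d)
    then show ?case using less[of "n - Suc d"] by (auto simp: Suc_diff_Suc)
  qed
  have "\<theta> k = k" if "k \<le> n" for k
    using that lower[of k] upper[of "n - k"] by simp
  then have "\<theta> = restrict (\<lambda>j. j) {..p}"
    using \<theta> \<open>n = p\<close> by (intro extensionalityI[of _ "{..p}"]) (auto simp: \<Delta>_hom_def PiE_def)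
  then show ?thesis using \<open>n = p\<close> by simp
qed

lemma fat_point_push_onto:
  assumes Z: "simplicial_space Z" and \<theta>: "\<theta> \<in> \<Delta>_hom n p" "inj_on \<theta> {..n}" "\<theta> ` {..n} = {..p}"
    and x: "x \<in> topspace (level Z p)" and w: "w \<in> standard_simplex n"
  shows "fat_point Z p x (simplex_push n \<theta> w) = fat_point Z n (act Z n p \<theta> x) w"
proof -
  have id: "n = p" "\<theta> = restrict (\<lambda>j. j) {..p}"
    using \<Delta>_hom_onto_imp_id[OF \<theta>] by auto
  have "{k. k \<le> n \<and> \<theta> k = j} = (if j \<le> n then {j} else {})" for j
    using id by auto
  then have "simplex_push n \<theta> w = w"
    using w by (auto simp: fun_eq_iff simplex_push_def standard_simplex_def)
  then show ?thesis
    using id x simplicial_space_act_id[OF Z] by simp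
qed

text \<open>An injective \<open>\<theta>\<close> that misses some \<open>i\<close> factors through
  \<open>coface p i\<close>, so induction on \<open>p\<close> peels off one face relation at a time
  until \<open>\<theta>\<close> is onto and hence the identity.\<close>

lemma fat_point_push:
  assumes Z: "simplicial_space Z" and w: "w \<in> standard_simplex n"
  shows "\<lbrakk>\<theta> \<in> \<Delta>_hom n p; inj_on \<theta> {..n}; x \<in> topspace (level Z p)\<rbrakk>
    \<Longrightarrow> fat_point Z p x (simplex_push n \<theta> w) = fat_point Z n (act Z n p \<theta> x) w"
proof (induction p arbitrary: \<theta> x)
  case 0
  have "\<theta> k = 0" if "k \<le> n" for k
    using \<Delta>_hom_bound[OF 0(1) that] by simp
  then have "\<theta> ` {..n} = (\<lambda>_. 0) ` {..n}"
    by (intro image_cong) auto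
  then have "\<theta> ` {..n} = {..0}" by (simp add: image_constant_conv)
  with 0 show ?case by (intro fat_point_push_onto[OF Z _ _ _ _ w])
next
  case (Suc p)
  show ?case
  proof (cases "\<theta> ` {..n} = {..Suc p}")
    case True
    with Suc.prems show ?thesis by (intro fat_point_push_onto[OF Z _ _ _ _ w])
  next
    case False
    then obtain i where i: "i \<le> Suc p" "i \<notin> \<theta> ` {..n}"
      using \<Delta>_hom_bound[OF Suc.prems(1)] by auto
    \<comment> \<open>Closes the gap at \<open>i\<close>. Since \<open>i\<close> is missed, the
      result is still injective and composing it with \<open>coface p i\<close> restores
      \<open>\<theta>\<close>.\<close>
    define \<theta>' where "\<theta>' = (\<lambda>k\<in>{..n}. if \<theta> k < i then \<theta> k else \<theta> k - 1)"
    have ne: "\<theta> k \<noteq> i" if "k \<le> n" for k using i that by auto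
    have \<theta>': "\<theta>' \<in> \<Delta>_hom n p"
      unfolding \<theta>'_def
    proof (rule \<Delta>_homI)
      show "(if \<theta> k < i then \<theta> k else \<theta> k - 1) \<le> p" if "k \<le> n" for k
        using \<Delta>_hom_bound[OF Suc.prems(1) that] ne[OF that] i by auto
      show "(if \<theta> k < i then \<theta> k else \<theta> k - 1) \<le> (if \<theta> l < i then \<theta> l else \<theta> l - 1)" if "k \<le> l" "l \<le> n" for k l
        using \<Delta>_hom_mono[OF Suc.prems(1) that] ne[of k] ne[of l] that by auto
    qed
    have inj': "inj_on \<theta>' {..n}"
    proof (rule inj_onI)
      fix k l assume "k \<in> {..n}" "l \<in> {..n}" "\<theta>' k = \<theta>' l"
      then show "k = l"
        using ne[of k] ne[of l] inj_onD[OF Suc.prems(2), of k l] by (auto simp: \<theta>'_def split: if_splits)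
    qed
    have comp: "compose {..n} (coface p i) \<theta>' = \<theta>"
    proof (rule extensionalityI[of _ "{..n}"])
      fix k assume "k \<in> {..n}"
      then show "compose {..n} (coface p i) \<theta>' k = \<theta> k"
        using ne[of k] \<Delta>_hom_bound[OF \<theta>', of k] by (auto simp: compose_def coface_def \<theta>'_def split: if_splits)
    qed (use Suc.prems(1) in \<open>auto simp: \<Delta>_hom_def PiE_def\<close>)
    have "simplex_push n \<theta> w = simplical_face i (simplex_push n \<theta>' w)"
      using simplex_push_face[OF \<theta>' i(1) inj'] comp by simp
    then have "fat_point Z (Suc p) x (simplex_push n \<theta> w) = fat_point Z p (face Z p i x) (simplex_push n \<theta>' w)"
      using fat_point_face[OF i(1) Suc.prems(3) simplex_push_in_simplex[OF \<theta>' inj' w]] by simp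
    also have "\<dots> = fat_point Z n (act Z n p \<theta>' (face Z p i x)) w"
      by (intro Suc.IH \<theta>' inj' simplicial_space_face_in Z Suc.prems)
    also have "act Z n p \<theta>' (face Z p i x) = act Z n (Suc p) \<theta> x"
      unfolding face_def comp[symmetric]
      by (rule simplicial_space_act_compose[OF Z \<theta>' coface_in_\<Delta>_hom Suc.prems(3)])
    finally show ?thesis .
  qed
qed

subsection \<open>The shuffle map\<close>

lemma supports_commute: "supports p q s t n \<alpha> \<beta> \<Longrightarrow> supports q p t s n \<beta> \<alpha>"
proof -
  have "coupling t s (\<beta> k) (\<alpha> k) = coupling s t (\<alpha> k) (\<beta> k)" for k
    by (rule coupling_commute)
  then show "supports p q s t n \<alpha> \<beta> \<Longrightarrow> supports q p t s n \<beta> \<alpha>"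
    by (auto simp: supports_def lattice_paths_def inj_on_def)
qed

lemma path_weights_commute: "path_weights s t n \<alpha> \<beta> = path_weights t s n \<beta> \<alpha>"
  unfolding path_weights_def by (subst coupling_commute) simp

lemma supports_exists:
  assumes "s \<in> standard_simplex p" "t \<in> standard_simplex q"
  obtains n \<alpha> \<beta> where "supports p q s t n \<alpha> \<beta>"
  using supports_positive_exists[OF assms] by metis

lemma supports_\<Delta>_hom:
  assumes "supports p q s t n \<alpha> \<beta>"
  shows "\<alpha> \<in> \<Delta>_hom n p" "\<beta> \<in> \<Delta>_hom n q"
  using assms by (auto simp: supports_def lattice_paths_def)

text \<open>Composed with the coface, the path avoids the piece of length zero that the face inserts
  and meets the same overlaps as before.\<close>

lemma supports_face:
  assumes "supports p q s t n \<alpha> \<beta>"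
  shows "supports (Suc p) q (simplical_face i s) t n (compose {..n} (coface p i) \<alpha>) \<beta>"
    and "path_weights (simplical_face i s) t n (compose {..n} (coface p i) \<alpha>) \<beta> = path_weights s t n \<alpha> \<beta>"
proof -
  note \<alpha> = supports_\<Delta>_hom(1)[OF assms]
  have eq: "coupling (simplical_face i s) t (compose {..n} (coface p i) \<alpha> k) j = coupling s t (\<alpha> k) j"
    if "k \<le> n" for k j
    using coupling_face[OF \<Delta>_hom_bound[OF \<alpha> that]] that by (simp add: compose_def)
  have "inj_on (\<lambda>k. (compose {..n} (coface p i) \<alpha> k, \<beta> k)) {..n}"
  proof (rule inj_onI)
    fix k l
    assume kl: "k \<in> {..n}" "l \<in> {..n}"
      and "(compose {..n} (coface p i) \<alpha> k, \<beta> k) = (compose {..n} (coface p i) \<alpha> l, \<beta> l)"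
    then have "(\<alpha> k, \<beta> k) = (\<alpha> l, \<beta> l)"
      using \<Delta>_hom_bound[OF \<alpha>, of k] \<Delta>_hom_bound[OF \<alpha>, of l]
      by (auto simp: compose_def coface_def split: if_splits)
    then show "k = l"
      using assms kl by (auto simp: supports_def lattice_paths_def inj_on_def)
  qed
  then show "supports (Suc p) q (simplical_face i s) t n (compose {..n} (coface p i) \<alpha>) \<beta>"
    using assms \<Delta>_hom_compose[OF coface_in_\<Delta>_hom \<alpha>] eq by (simp add: supports_def lattice_paths_def)
  show "path_weights (simplical_face i s) t n (compose {..n} (coface p i) \<alpha>) \<beta> = path_weights s t n \<alpha> \<beta>"
    using eq by (auto simp: path_weights_def)
qed

lemma level_sprod [simp]: "level (sprod X Y) n = cg_prod (level X n) (level Y n)"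
  and act_sprod [simp]: "act (sprod X Y) m n \<theta> = map_prod (act X m n \<theta>) (act Y m n \<theta>)"
  by (simp_all add: sprod_def)

lemma face_sprod: "face (sprod X Y) p i = map_prod (face X p i) (face Y p i)"
  by (simp add: face_def)

locale simplicial_space_pair =
  fixes X :: "'a sspace" and Y :: "'b sspace"
  assumes X: "simplicial_space X" and Y: "simplicial_space Y"
begin

definition path_point :: "nat \<Rightarrow> 'a \<Rightarrow> (nat \<Rightarrow> real) \<Rightarrow> nat \<Rightarrow> 'b \<Rightarrow> (nat \<Rightarrow> real) \<Rightarrow>
    nat \<Rightarrow> (nat \<Rightarrow> nat) \<Rightarrow> (nat \<Rightarrow> nat) \<Rightarrow> (nat \<times> ('a \<times> 'b) \<times> (nat \<Rightarrow> real)) set" where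
  "path_point p x s q y t n \<alpha> \<beta> =
     fat_point (sprod X Y) n (act X n p \<alpha> x, act Y n q \<beta> y) (path_weights s t n \<alpha> \<beta>)"

text \<open>A path with positive weights is a subpath of every supporting path, by
  \<open>supports_covers\<close>. The additional vertices have weight zero, so
  \<open>fat_point_push\<close> removes them. Consequently all supporting paths give the same
  point.\<close>

lemma path_point_positive:
  assumes x: "x \<in> topspace (level X p)" and s: "s \<in> standard_simplex p"
    and y: "y \<in> topspace (level Y q)" and t: "t \<in> standard_simplex q"
    and sup0: "supports p q s t m \<alpha>' \<beta>'" and pos: "\<And>k. k \<le> m \<Longrightarrow> 0 < coupling s t (\<alpha>' k) (\<beta>' k)"
    and sup: "supports p q s t n \<alpha> \<beta>"
  shows "path_point p x s q y t n \<alpha> \<beta> = path_point p x s q y t m \<alpha>' \<beta>'"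
proof -
  note hom = supports_\<Delta>_hom[OF sup] and hom' = supports_\<Delta>_hom[OF sup0]
  have inj: "k = l" if "k \<le> n" "l \<le> n" "\<alpha> k = \<alpha> l" "\<beta> k = \<beta> l" for k l
    using sup that by (auto simp: supports_def lattice_paths_def inj_on_def)
  have inj': "k = l" if "k \<le> m" "l \<le> m" "\<alpha>' k = \<alpha>' l" "\<beta>' k = \<beta>' l" for k l
    using sup0 that by (auto simp: supports_def lattice_paths_def inj_on_def)
  have "\<exists>l\<le>n. \<alpha> l = \<alpha>' k \<and> \<beta> l = \<beta>' k" if "k \<le> m" for k
    using supports_covers[OF s t sup _ _ pos[OF that]] \<Delta>_hom_bound that hom' by blast
  then obtain f where f: "\<And>k. k \<le> m \<Longrightarrow> f k \<le> n \<and> \<alpha> (f k) = \<alpha>' k \<and> \<beta> (f k) = \<beta>' k"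
    by metis
  define \<theta> where "\<theta> = restrict f {..m}"
  have \<theta>: "\<theta> \<in> \<Delta>_hom m n"
    unfolding \<theta>_def
  proof (rule \<Delta>_homI)
    fix k l assume kl: "k \<le> l" "l \<le> m"
    \<comment> \<open>If \<open>f\<close> reversed the order, monotonicity of both paths would make
      the pairs at \<open>k\<close> and \<open>l\<close> equal, hence \<open>k = l\<close>.\<close>
    show "f k \<le> f l"
    proof (rule ccontr)
      assume "\<not> f k \<le> f l"
      then have fl: "f l \<le> f k" by simp
      have fk: "f k \<le> n \<and> \<alpha> (f k) = \<alpha>' k \<and> \<beta> (f k) = \<beta>' k"
        and fl': "f l \<le> n \<and> \<alpha> (f l) = \<alpha>' l \<and> \<beta> (f l) = \<beta>' l"
        using f kl by simp_all
      then have "\<alpha>' l \<le> \<alpha>' k" "\<beta>' l \<le> \<beta>' k"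
        using \<Delta>_hom_mono[OF hom(1) fl] \<Delta>_hom_mono[OF hom(2) fl] by simp_all
      then have "\<alpha>' k = \<alpha>' l" "\<beta>' k = \<beta>' l"
        using \<Delta>_hom_mono[OF hom'(1) kl] \<Delta>_hom_mono[OF hom'(2) kl] by simp_all
      then have "k = l"
        using kl inj'[of k l] by simp
      then show False using \<open>\<not> f k \<le> f l\<close> by simp
    qed
  qed (use f in blast)
  have inj_\<theta>: "inj_on \<theta> {..m}"
  proof (rule inj_onI)
    fix k l assume "k \<in> {..m}" "l \<in> {..m}" "\<theta> k = \<theta> l"
    then show "k = l"
      using f[of k] f[of l] inj'[of k l] by (simp add: \<theta>_def)
  qed
  have \<alpha>': "compose {..m} \<alpha> \<theta> = \<alpha>'" and \<beta>': "compose {..m} \<beta> \<theta> = \<beta>'"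
    using f hom' by (auto simp: fun_eq_iff compose_def \<theta>_def \<Delta>_hom_def PiE_def extensional_def)
  have w: "path_weights s t n \<alpha> \<beta> = simplex_push m \<theta> (path_weights s t m \<alpha>' \<beta>')"
  proof
    fix j
    show "path_weights s t n \<alpha> \<beta> j = simplex_push m \<theta> (path_weights s t m \<alpha>' \<beta>') j"
    proof (cases "j \<in> \<theta> ` {..m}")
      case True
      then obtain k where "k \<le> m" "j = \<theta> k" by auto
      then show ?thesis
        using f[of k] simplex_push_inj[OF inj_\<theta>, of k] by (simp add: path_weights_def \<theta>_def)
    next
      case False
      \<comment> \<open>A vertex of the longer path with mass would be a cell of the positive path,
        hence in the image of \<open>\<theta>\<close>.\<close>
      have "coupling s t (\<alpha> j) (\<beta> j) = 0" if j: "j \<le> n"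
      proof (rule ccontr)
        assume "coupling s t (\<alpha> j) (\<beta> j) \<noteq> 0"
        then have "0 < coupling s t (\<alpha> j) (\<beta> j)"
          using coupling_nonneg[OF s t, of "\<alpha> j" "\<beta> j"] by simp
        then obtain k where "k \<le> m" "\<alpha>' k = \<alpha> j" "\<beta>' k = \<beta> j"
          using supports_covers[OF s t sup0] \<Delta>_hom_bound[OF hom(1) j] \<Delta>_hom_bound[OF hom(2) j] by blast
        then show False
          using False f[of k] inj[of "f k" j] j by (auto simp: \<theta>_def)
      qed
      then show ?thesis
        using False by (simp add: simplex_push_outside path_weights_def)
    qed
  qed
  have "act X n p \<alpha> x \<in> topspace (level X n)" "act Y n q \<beta> y \<in> topspace (level Y n)"
    by (rule simplicial_space_act_in[OF X hom(1) x], rule simplicial_space_act_in[OF Y hom(2) y])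
  then have "path_point p x s q y t n \<alpha> \<beta> = fat_point (sprod X Y) m
      (act (sprod X Y) m n \<theta> (act X n p \<alpha> x, act Y n q \<beta> y)) (path_weights s t m \<alpha>' \<beta>')"
    unfolding path_point_def w
    by (intro fat_point_push simplicial_space_sprod X Y \<theta> inj_\<theta> path_weights_in_simplex[OF s t sup0]) simp
  then show ?thesis
    using simplicial_space_act_compose[OF X \<theta> hom(1) x] simplicial_space_act_compose[OF Y \<theta> hom(2) y]
    by (simp add: path_point_def \<alpha>' \<beta>')
qed

text \<open>The choice among supporting paths is immaterial by \<open>shuffle_rep_eq\<close>, so no
  rule is fixed for the ties that occur where overlaps vanish.\<close>

definition shuffle_rep :: "nat \<times> 'a \<times> (nat \<Rightarrow> real) \<Rightarrow> nat \<times> 'b \<times> (nat \<Rightarrow> real) \<Rightarrow> (nat \<times> ('a \<times> 'b) \<times> (nat \<Rightarrow> real)) set" where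
  "shuffle_rep = (\<lambda>(p, x, s) (q, y, t).
     case SOME (n, \<alpha>, \<beta>). supports p q s t n \<alpha> \<beta> of (n, \<alpha>, \<beta>) \<Rightarrow> path_point p x s q y t n \<alpha> \<beta>)"

definition shuffle_map :: "(nat \<times> 'a \<times> (nat \<Rightarrow> real)) set \<Rightarrow> (nat \<times> 'b \<times> (nat \<Rightarrow> real)) set \<Rightarrow> (nat \<times> ('a \<times> 'b) \<times> (nat \<Rightarrow> real)) set" where
  "shuffle_map A B = fat_lift (\<lambda>z. fat_lift (shuffle_rep z) B) A"

lemma shuffle_rep_eq:
  assumes x: "x \<in> topspace (level X p)" and s: "s \<in> standard_simplex p"
    and y: "y \<in> topspace (level Y q)" and t: "t \<in> standard_simplex q"
    and sup: "supports p q s t n \<alpha> \<beta>"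
  shows "shuffle_rep (p, x, s) (q, y, t) = path_point p x s q y t n \<alpha> \<beta>"
proof -
  obtain n' \<alpha>' \<beta>' where n': "(SOME (n, \<alpha>, \<beta>). supports p q s t n \<alpha> \<beta>) = (n', \<alpha>', \<beta>')"
    by (metis prod_cases3)
  have sup': "supports p q s t n' \<alpha>' \<beta>'"
    using someI[of "\<lambda>(n, \<alpha>, \<beta>). supports p q s t n \<alpha> \<beta>" "(n, \<alpha>, \<beta>)"] sup n' by simp
  obtain m \<alpha>0 \<beta>0 where pos: "supports p q s t m \<alpha>0 \<beta>0" "\<And>k. k \<le> m \<Longrightarrow> 0 < coupling s t (\<alpha>0 k) (\<beta>0 k)"
    using supports_positive_exists[OF s t] by metis
  have "path_point p x s q y t n' \<alpha>' \<beta>' = path_point p x s q y t n \<alpha> \<beta>"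
    using path_point_positive[OF x s y t pos sup] path_point_positive[OF x s y t pos sup'] by (rule trans[OF _ sym, rotated])
  then show ?thesis
    by (simp add: shuffle_rep_def n')
qed

lemma shuffle_rep_face_left:
  assumes x: "x \<in> topspace (level X (Suc p))" and s: "s \<in> standard_simplex p"
    and y: "y \<in> topspace (level Y q)" and t: "t \<in> standard_simplex q" and i: "i \<le> Suc p"
  shows "shuffle_rep (Suc p, x, simplical_face i s) (q, y, t) = shuffle_rep (p, face X p i x, s) (q, y, t)"
proof -
  obtain n \<alpha> \<beta> where sup: "supports p q s t n \<alpha> \<beta>"
    by (rule supports_exists[OF s t])
  have "simplical_face i s \<in> standard_simplex (Suc p)"
    using simplical_face_in_standard_simplex[of "Suc p" i s] s i by simp
  then show ?thesis
    using shuffle_rep_eq[OF x _ y t supports_face(1)[OF sup]]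
      shuffle_rep_eq[OF simplicial_space_face_in[OF X x] s y t sup] supports_face(2)[OF sup]
      simplicial_space_act_compose[OF X supports_\<Delta>_hom(1)[OF sup] coface_in_\<Delta>_hom x]
    by (simp add: path_point_def face_def)
qed

lemma shuffle_rep_face_right:
  assumes x: "x \<in> topspace (level X p)" and s: "s \<in> standard_simplex p"
    and y: "y \<in> topspace (level Y (Suc q))" and t: "t \<in> standard_simplex q" and i: "i \<le> Suc q"
  shows "shuffle_rep (p, x, s) (Suc q, y, simplical_face i t) = shuffle_rep (p, x, s) (q, face Y q i y, t)"
proof -
  obtain n \<alpha> \<beta> where sup: "supports p q s t n \<alpha> \<beta>"
    by (rule supports_exists[OF s t])
  note face = supports_face[OF supports_commute[OF sup], of i]
  have "simplical_face i t \<in> standard_simplex (Suc q)"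
    using simplical_face_in_standard_simplex[of "Suc q" i t] t i by simp
  then show ?thesis
    using shuffle_rep_eq[OF x s y _ supports_commute[OF face(1)]]
      shuffle_rep_eq[OF x s simplicial_space_face_in[OF Y y] t sup] face(2)
      simplicial_space_act_compose[OF Y supports_\<Delta>_hom(2)[OF sup] coface_in_\<Delta>_hom y]
    by (simp add: path_point_def face_def path_weights_commute[of s] path_weights_commute[of _ t])
qed

lemma shuffle_map_point:
  assumes x: "x \<in> topspace (level X p)" and s: "s \<in> standard_simplex p"
    and y: "y \<in> topspace (level Y q)" and t: "t \<in> standard_simplex q"
  shows "shuffle_map (fat_point X p x s) (fat_point Y q y t) = shuffle_rep (p, x, s) (q, y, t)"
proof -
  have inner: "fat_lift (shuffle_rep (p, x, s)) (fat_point Y q y t) = shuffle_rep (p, x, s) (q, y, t)"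
    if "x \<in> topspace (level X p)" "s \<in> standard_simplex p" for p x s
    by (rule fat_lift_point) (rule shuffle_rep_face_right[OF that])
  have "shuffle_map (fat_point X p x s) (fat_point Y q y t) = fat_lift (shuffle_rep (p, x, s)) (fat_point Y q y t)"
    unfolding shuffle_map_def
  proof (rule fat_lift_point)
    fix p i x s
    assume *: "i \<le> Suc p" "x \<in> topspace (level X (Suc p))" "s \<in> standard_simplex p"
    have "simplical_face i s \<in> standard_simplex (Suc p)"
      using simplical_face_in_standard_simplex[of "Suc p" i s] * by simp
    then show "fat_lift (shuffle_rep (Suc p, x, simplical_face i s)) (fat_point Y q y t) =
        fat_lift (shuffle_rep (p, face X p i x, s)) (fat_point Y q y t)"
      using * inner simplicial_space_face_in[OF X] shuffle_rep_face_left y t by simp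
  qed
  then show ?thesis using inner[OF x s] by simp
qed

lemma shuffle_map_eq:
  assumes "x \<in> topspace (level X p)" "s \<in> standard_simplex p" "y \<in> topspace (level Y q)" "t \<in> standard_simplex q"
    "supports p q s t n \<alpha> \<beta>"
  shows "shuffle_map (fat_point X p x s) (fat_point Y q y t) = path_point p x s q y t n \<alpha> \<beta>"
  using assms by (simp add: shuffle_map_point shuffle_rep_eq)

end

section \<open>Continuity of the shuffle map\<close>

lemma continuous_map_simplex_coordinate: "continuous_map (simplex_space p) euclideanreal (\<lambda>s. s i)"
  unfolding simplex_space_def
  by (intro continuous_map_from_subtopology continuous_map_product_projection) simp

lemma continuous_map_into_simplex_space:
  assumes "\<And>i. continuous_map Z euclideanreal (\<lambda>z. f z i)" "\<And>z. z \<in> topspace Z \<Longrightarrow> f z \<in> standard_simplex p"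
  shows "continuous_map Z (simplex_space p) f"
  using assms by (auto simp: simplex_space_def continuous_map_in_subtopology continuous_map_componentwise_UNIV)

lemma continuous_map_coupling:
  assumes s: "continuous_map Z (simplex_space p) s" and t: "continuous_map Z (simplex_space q) t"
  shows "continuous_map Z euclideanreal (\<lambda>z. coupling (s z) (t z) i j)"
proof -
  have "continuous_map Z euclideanreal (\<lambda>z. s z l)" "continuous_map Z euclideanreal (\<lambda>z. t z l)" for l
    using continuous_map_compose[OF s continuous_map_simplex_coordinate]
      continuous_map_compose[OF t continuous_map_simplex_coordinate] by (simp_all add: o_def)
  then show ?thesis
    unfolding coupling_def partial_sum_def by (intro continuous_map_real_min continuous_intros) auto
qed

context simplicial_space_pair
begin

lemma path_point_in:
  assumes "x \<in> topspace (level X p)" "s \<in> standard_simplex p" "y \<in> topspace (level Y q)" "t \<in> standard_simplex q"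
    and sup: "supports p q s t n \<alpha> \<beta>"
  shows "path_point p x s q y t n \<alpha> \<beta> \<in> topspace (fat_realisation (sprod X Y))"
  using assms simplicial_space_act_in[OF X supports_\<Delta>_hom(1)[OF sup]] simplicial_space_act_in[OF Y supports_\<Delta>_hom(2)[OF sup]]
  unfolding path_point_def by (intro fat_point_in path_weights_in_simplex) auto

text \<open>\<open>K\<close> has to be compactly generated so that maps into the k-ified products
  can be checked by components. The premise \<open>path\<close> does not follow from
  \<open>sup\<close> when \<open>K\<close> is empty.\<close>

lemma continuous_map_path_point:
  assumes K: "compactly_generated K"
    and x: "continuous_map K (level X p) x" and s: "continuous_map K (simplex_space p) s"
    and y: "continuous_map K (level Y q) y" and t: "continuous_map K (simplex_space q) t"
    and sup: "\<And>k. k \<in> topspace K \<Longrightarrow> supports p q (s k) (t k) n \<alpha> \<beta>"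
    and path: "(n, \<alpha>, \<beta>) \<in> lattice_paths p q"
  shows "continuous_map K (fat_realisation (sprod X Y)) (\<lambda>k. path_point p (x k) (s k) q (y k) (t k) n \<alpha> \<beta>)"
proof -
  have hom: "\<alpha> \<in> \<Delta>_hom n p" "\<beta> \<in> \<Delta>_hom n q"
    using path by (auto simp: lattice_paths_def)
  have "continuous_map (level X p) (level X n) (act X n p \<alpha>)" "continuous_map (level Y q) (level Y n) (act Y n q \<beta>)"
    using X Y hom by (auto simp: simplicial_space_def)
  then have "continuous_map K (level X n) (\<lambda>k. act X n p \<alpha> (x k))" "continuous_map K (level Y n) (\<lambda>k. act Y n q \<beta> (y k))"
    using continuous_map_compose[OF x] continuous_map_compose[OF y] by (auto simp: o_def)
  then have act: "continuous_map K (level (sprod X Y) n) (\<lambda>k. (act X n p \<alpha> (x k), act Y n q \<beta> (y k)))"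
    using K by (simp add: continuous_map_into_cg_prod o_def)
  have "continuous_map K euclideanreal (\<lambda>k. path_weights (s k) (t k) n \<alpha> \<beta> i)" for i
    using continuous_map_coupling[OF s t] by (cases "i \<le> n") (auto simp: path_weights_def)
  moreover have "path_weights (s k) (t k) n \<alpha> \<beta> \<in> standard_simplex n" if "k \<in> topspace K" for k
    using continuous_map_funspace[OF s] continuous_map_funspace[OF t] that sup
    by (intro path_weights_in_simplex) auto
  ultimately have "continuous_map K (simplex_space n) (\<lambda>k. path_weights (s k) (t k) n \<alpha> \<beta>)"
    by (rule continuous_map_into_simplex_space)
  from continuous_map_compose_cg_prod[OF continuous_map_fat_point K act this]
  show ?thesis by (simp add: path_point_def)
qed

text \<open>The two quotients are undone one factor at a time. A test space is then covered by
  finitely many closed sets, one for each lattice path; on each the formula for that path is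
  continuous, and on overlaps the formulas agree because all supporting paths give the same
  point.\<close>

lemma continuous_map_shuffle_map:
  "continuous_map (cg_prod (fat_realisation X) (fat_realisation Y)) (fat_realisation (sprod X Y))
     (\<lambda>(A, B). shuffle_map A B)"
proof (rule continuous_map_from_fat_realisation_prod_left, rule continuous_map_from_fat_realisation_prod_right)
  fix p q
  let ?W = "fat_realisation (sprod X Y)"
  let ?DX = "cg_prod (level X p) (simplex_space p)" and ?DY = "cg_prod (level Y q) (simplex_space q)"
  let ?f = "\<lambda>((x, s), (y, t)). shuffle_map (fat_point X p x s) (fat_point Y q y t)"
  have "continuous_map (cg_prod ?DX ?DY) ?W ?f"
  proof (rule continuous_map_cg_prod_test)
    show "?f \<in> topspace ?DX \<times> topspace ?DY \<rightarrow> topspace ?W"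
    proof clarsimp
      fix x s y t
      assume *: "x \<in> topspace (level X p)" "s \<in> standard_simplex p" "y \<in> topspace (level Y q)" "t \<in> standard_simplex q"
      obtain n \<alpha> \<beta> where "supports p q s t n \<alpha> \<beta>"
        by (rule supports_exists[OF *(2,4)])
      then show "shuffle_map (fat_point X p x s) (fat_point Y q y t) \<in> topspace ?W"
        using * by (simp add: shuffle_map_eq path_point_in)
    qed
  next
    fix K :: "((('a \<times> (nat \<Rightarrow> real)) \<times> ('b \<times> (nat \<Rightarrow> real))) \<times> nat) set set topology" and a b
    assume K: "compact_space K" "Hausdorff_space K"
      and a: "continuous_map K ?DX a" and b: "continuous_map K ?DY b"
    define x s y t where xsyt: "x k = fst (a k)" "s k = snd (a k)" "y k = fst (b k)" "t k = snd (b k)" for k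
    have cont: "continuous_map K (level X p) x" "continuous_map K (simplex_space p) s"
        "continuous_map K (level Y q) y" "continuous_map K (simplex_space q) t"
      using continuous_map_cg_prod_components[OF a] continuous_map_cg_prod_components[OF b]
      by (simp_all add: xsyt[abs_def])
    have pts: "x k \<in> topspace (level X p)" "s k \<in> standard_simplex p" "y k \<in> topspace (level Y q)" "t k \<in> standard_simplex q"
      if "k \<in> topspace K" for k
      using cont[THEN continuous_map_funspace] that by auto
    \<comment> \<open>Prescribing the total mass on the path makes this the preimage of a point,
      hence closed.\<close>
    define T where "T = (\<lambda>(n :: nat, \<alpha>, \<beta>). {k \<in> topspace K. (\<Sum>j\<le>n. coupling (s k) (t k) (\<alpha> j) (\<beta> j)) \<in> {1}})"
    have T: "supports p q (s k) (t k) n \<alpha> \<beta>" if "(n, \<alpha>, \<beta>) \<in> lattice_paths p q" "k \<in> T (n, \<alpha>, \<beta>)" for n \<alpha> \<beta> k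
      using that by (simp add: supports_def T_def)
    have clo: "closedin K (T i)" for i
    proof -
      obtain n \<alpha> \<beta> where i: "i = (n, \<alpha>, \<beta>)" by (cases i)
      have "continuous_map K euclideanreal (\<lambda>k. \<Sum>j\<le>n. coupling (s k) (t k) (\<alpha> j) (\<beta> j))"
        by (intro continuous_map_sum continuous_map_coupling[OF cont(2,4)]) simp
      from closedin_continuous_map_preimage[OF this, of "{1}"] show ?thesis
        by (simp add: T_def i)
    qed
    have "continuous_map K ?W (\<lambda>k. shuffle_rep (p, x k, s k) (q, y k, t k))"
    proof (rule pasting_lemma_closed[OF finite_lattice_paths clo])
      fix i assume "i \<in> lattice_paths p q"
      then obtain n \<alpha> \<beta> where i: "i = (n, \<alpha>, \<beta>)" "(n, \<alpha>, \<beta>) \<in> lattice_paths p q"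
        by (cases i) auto
      \<comment> \<open>Closedness of the piece inside \<open>K\<close> keeps it compact Hausdorff,
        and so compactly generated.\<close>
      have "compact_space (subtopology K (T i))"
        using K(1) clo closedin_compact_space compact_space_subtopology by blast
      then have "compactly_generated (subtopology K (T i))"
        using K(2) Hausdorff_space_subtopology compactly_generated_compact_Hausdorff by blast
      then have "continuous_map (subtopology K (T i)) ?W (\<lambda>k. path_point p (x k) (s k) q (y k) (t k) n \<alpha> \<beta>)"
        using T i by (intro continuous_map_path_point continuous_map_from_subtopology cont) auto
      then show "continuous_map (subtopology K (T i)) ?W
          ((\<lambda>(n, \<alpha>, \<beta>) k. path_point p (x k) (s k) q (y k) (t k) n \<alpha> \<beta>) i)"
        by (simp add: i)
    next
      fix i j k
      assume "i \<in> lattice_paths p q" "j \<in> lattice_paths p q" "k \<in> topspace K \<inter> T i \<inter> T j"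
      then show "(\<lambda>(n, \<alpha>, \<beta>) k. path_point p (x k) (s k) q (y k) (t k) n \<alpha> \<beta>) i k =
          (\<lambda>(n, \<alpha>, \<beta>) k. path_point p (x k) (s k) q (y k) (t k) n \<alpha> \<beta>) j k"
        using T pts[of k] by (cases i; cases j) (simp flip: shuffle_rep_eq)
    next
      fix k assume k: "k \<in> topspace K"
      obtain n \<alpha> \<beta> where sup: "supports p q (s k) (t k) n \<alpha> \<beta>"
        by (rule supports_exists[OF pts(2,4)[OF k]])
      then show "\<exists>j. j \<in> lattice_paths p q \<and> k \<in> T j \<and> shuffle_rep (p, x k, s k) (q, y k, t k) =
          (\<lambda>(n, \<alpha>, \<beta>) k. path_point p (x k) (s k) q (y k) (t k) n \<alpha> \<beta>) j k"
        using shuffle_rep_eq[OF pts[OF k] sup] k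
        by (intro exI[of _ "(n, \<alpha>, \<beta>)"]) (simp add: supports_def T_def)
    qed
    then show "continuous_map K ?W (\<lambda>k. ?f (a k, b k))"
      by (rule continuous_map_eq) (simp add: case_prod_unfold shuffle_map_point pts flip: xsyt)
  qed
  then show "continuous_map (cg_prod ?DX ?DY) ?W
      (\<lambda>(b, y, t). (\<lambda>((x, s), B). (\<lambda>(A, B). shuffle_map A B) (fat_point X p x s, B)) (b, fat_point Y q y t))"
    by (simp add: case_prod_unfold)
qed

end

subsection \<open>Refinement and its deformation\<close>

text \<open>
  A point of the realisation of the simplicial point is a bare subdivision of the interval, by which
  points of any other realisation can be refined.
\<close>

definition simplicial_point :: "unit sspace" where
  "simplicial_point = \<lparr>level = (\<lambda>_. discrete_topology UNIV), act = (\<lambda>_ _ _ _. ())\<rparr>"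

lemma simplicial_space_simplicial_point: "simplicial_space simplicial_point"
  by (auto simp: simplicial_space_def simplicial_point_def compactly_generated_def k_openin_def)

lemma topspace_level_simplicial_point [simp]: "topspace (level simplicial_point n) = UNIV"
  by (simp add: simplicial_point_def)

text \<open>The segment from \<open>t\<close> to a new vertex, which is placed first; the old
  vertices move up by one.\<close>

definition simplex_cone :: "real \<Rightarrow> (nat \<Rightarrow> real) \<Rightarrow> nat \<Rightarrow> real" where
  "simplex_cone \<tau> t i = (case i of 0 \<Rightarrow> \<tau> | Suc j \<Rightarrow> (1 - \<tau>) * t j)"

lemma simplex_cone_in_simplex:
  assumes "\<tau> \<in> {0..1}" "t \<in> standard_simplex p"
  shows "simplex_cone \<tau> t \<in> standard_simplex (Suc p)"
proof -
  have "sum (simplex_cone \<tau> t) {..Suc p} = \<tau> + (1 - \<tau>) * (\<Sum>i\<le>p. t i)"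
    by (simp only: sum.atMost_Suc_shift) (simp add: simplex_cone_def sum_distrib_left)
  then show ?thesis
    using assms by (auto simp: standard_simplex_def simplex_cone_def mult_le_one split: nat.split)
qed

lemma simplex_cone_face: "simplex_cone \<tau> (simplical_face i t) = simplical_face (Suc i) (simplex_cone \<tau> t)"
  by (auto simp: simplex_cone_def simplical_face_def fun_eq_iff split: nat.split)

lemma simplex_cone_0: "simplex_cone 0 t = simplical_face 0 t"
  by (auto simp: simplex_cone_def simplical_face_def fun_eq_iff split: nat.split)

lemma simplex_cone_1: "simplex_cone 1 t = (\<lambda>j. if j = 0 then 1 else 0)"
  by (auto simp: simplex_cone_def fun_eq_iff split: nat.split)

text \<open>The label \<open>x\<close> of level \<open>p\<close> is reused at level
  \<open>Suc p\<close>, which is possible because every level of the simplicial point is the same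
  point. As \<open>\<tau>\<close> runs to 1, this contracts the realisation to a vertex.\<close>

definition fat_cone :: "real \<Rightarrow> (nat \<times> unit \<times> (nat \<Rightarrow> real)) set \<Rightarrow> (nat \<times> unit \<times> (nat \<Rightarrow> real)) set" where
  "fat_cone \<tau> = fat_lift (\<lambda>(p, x, t). fat_point simplicial_point (Suc p) x (simplex_cone \<tau> t))"

lemma fat_cone_point:
  assumes "\<tau> \<in> {0..1}"
  shows "fat_cone \<tau> (fat_point simplicial_point p x t) = fat_point simplicial_point (Suc p) x (simplex_cone \<tau> t)"
  unfolding fat_cone_def
proof (subst fat_lift_point)
  fix p i x and t :: "nat \<Rightarrow> real"
  assume "i \<le> Suc p" "t \<in> standard_simplex p"
  then show "(case (Suc p, x, simplical_face i t) of (p, x, t) \<Rightarrow> fat_point simplicial_point (Suc p) x (simplex_cone \<tau> t)) =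
      (case (p, face simplicial_point p i x, t) of (p, x, t) \<Rightarrow> fat_point simplicial_point (Suc p) x (simplex_cone \<tau> t))"
    using fat_point_face[of "Suc i" "Suc p" x simplicial_point "simplex_cone \<tau> t"] simplex_cone_in_simplex[OF assms]
    by (simp add: simplex_cone_face)
qed simp

lemma continuous_map_fat_cone:
  "continuous_map (cg_prod (top_of_set {0..1}) (fat_realisation simplicial_point)) (fat_realisation simplicial_point)
     (\<lambda>(\<tau>, A). fat_cone \<tau> A)"
proof (rule continuous_map_from_fat_realisation_prod_right)
  fix p
  let ?I = "top_of_set {0..1::real}" and ?D = "cg_prod (level simplicial_point p) (simplex_space p)"
  note D = compactly_generated_cg_prod[of ?I ?D]
  have \<tau>: "continuous_map (cg_prod ?I ?D) euclideanreal fst"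
    using continuous_map_cg_prod_fst[of ?I ?D] continuous_map_into_fulltopology by blast
  have "continuous_map (cg_prod ?I ?D) ?D snd"
    by (rule continuous_map_cg_prod_snd)
  from continuous_map_cg_prod_components[OF this]
  have "continuous_map (cg_prod ?I ?D) (simplex_space p) (\<lambda>z. snd (snd z))" by simp
  from continuous_map_compose[OF this continuous_map_simplex_coordinate]
  have t: "continuous_map (cg_prod ?I ?D) euclideanreal (\<lambda>z. snd (snd z) i)" for i
    by (simp add: o_def)
  have "continuous_map (cg_prod ?I ?D) (simplex_space (Suc p)) (\<lambda>z. simplex_cone (fst z) (snd (snd z)))"
  proof (rule continuous_map_into_simplex_space)
    show "continuous_map (cg_prod ?I ?D) euclideanreal (\<lambda>z. simplex_cone (fst z) (snd (snd z)) i)" for i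
      using \<tau> t by (cases i) (auto simp: simplex_cone_def intro!: continuous_intros)
  qed (auto intro: simplex_cone_in_simplex)
  then have "continuous_map (cg_prod ?I ?D) (fat_realisation simplicial_point)
      (\<lambda>z. (\<lambda>(x, t). fat_point simplicial_point (Suc p) x t) ((), simplex_cone (fst z) (snd (snd z))))"
    by (intro continuous_map_compose_cg_prod[OF continuous_map_fat_point D]) simp_all
  then show "continuous_map (cg_prod ?I ?D) (fat_realisation simplicial_point)
      (\<lambda>(\<tau>, x, t). (\<lambda>(\<tau>, A). fat_cone \<tau> A) (\<tau>, fat_point simplicial_point p x t))"
    by (rule continuous_map_eq) (auto simp: fat_cone_point)
qed

abbreviation (input) to_point :: "'a sspace \<Rightarrow> (nat \<times> 'a \<times> (nat \<Rightarrow> real)) set \<Rightarrow> (nat \<times> unit \<times> (nat \<Rightarrow> real)) set" where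
  "to_point X \<equiv> fat_map simplicial_point (\<lambda>p x. ())"

lemma to_point_point: "to_point X (fat_point X p x t) = fat_point simplicial_point p () t"
  by (rule fat_map_point) simp

lemma continuous_map_to_point:
  "continuous_map (fat_realisation X) (fat_realisation simplicial_point) (to_point X)"
  by (rule continuous_map_fat_map) (auto simp: simplicial_point_def)

lemma continuous_map_fat_map_fst:
  "continuous_map (fat_realisation (sprod X Y)) (fat_realisation X) (fat_map X (\<lambda>p. fst))"
  by (rule continuous_map_fat_map) (auto simp: face_sprod continuous_map_cg_prod_fst)

lemma continuous_map_fat_map_snd:
  "continuous_map (fat_realisation (sprod X Y)) (fat_realisation Y) (fat_map Y (\<lambda>p. snd))"
  by (rule continuous_map_fat_map) (auto simp: face_sprod continuous_map_cg_prod_snd)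

lemma fat_map_fst_point:
  "fat_map X (\<lambda>p. fst) (fat_point (sprod X Y) p z t) = fat_point X p (fst z) t"
  by (rule fat_map_point) (auto simp: face_sprod)

lemma fat_map_snd_point:
  "fat_map Y (\<lambda>p. snd) (fat_point (sprod X Y) p z t) = fat_point Y p (snd z) t"
  by (rule fat_map_point) (auto simp: face_sprod)

text \<open>The first component of the round trip, isolated so that it depends on the other factor
  only through its subdivision. That subdivision can then be deformed freely.\<close>

definition refine :: "'a sspace \<Rightarrow> (nat \<times> 'a \<times> (nat \<Rightarrow> real)) set \<Rightarrow> (nat \<times> unit \<times> (nat \<Rightarrow> real)) set \<Rightarrow> (nat \<times> 'a \<times> (nat \<Rightarrow> real)) set" where
  "refine X A M = fat_map X (\<lambda>p. fst) (simplicial_space_pair.shuffle_map X simplicial_point A M)"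

lemma refine_eq:
  assumes X: "simplicial_space X"
    and "x \<in> topspace (level X p)" "s \<in> standard_simplex p" "t \<in> standard_simplex q" "supports p q s t n \<alpha> \<beta>"
  shows "refine X (fat_point X p x s) (fat_point simplicial_point q u t) =
    fat_point X n (act X n p \<alpha> x) (path_weights s t n \<alpha> \<beta>)"
proof -
  interpret simplicial_space_pair X simplicial_point
    by standard (use X simplicial_space_simplicial_point in auto)
  show ?thesis
    unfolding refine_def using assms
    by (subst shuffle_map_eq) (auto simp: path_point_def fat_map_fst_point)
qed

lemma continuous_map_refine:
  assumes X: "simplicial_space X"
  shows "continuous_map (cg_prod (fat_realisation X) (fat_realisation simplicial_point)) (fat_realisation X) (\<lambda>(A, M). refine X A M)"
proof -
  interpret simplicial_space_pair X simplicial_point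
    by standard (use X simplicial_space_simplicial_point in auto)
  from continuous_map_compose[OF continuous_map_shuffle_map continuous_map_fat_map_fst]
  show ?thesis by (simp add: refine_def o_def case_prod_unfold)
qed

section \<open>Refining by an undivided interval and by the same subdivision\<close>

lemma restrict_id_in_\<Delta>_hom: "restrict (\<lambda>j. j) {..p} \<in> \<Delta>_hom p p"
  by (rule \<Delta>_homI)

text \<open>The only piece of \<open>e\<close> is the whole unit interval, so each piece of
  \<open>s\<close> overlaps it in its full length.\<close>

lemma supports_vertex:
  assumes s: "s \<in> standard_simplex p"
  defines "e \<equiv> \<lambda>j::nat. if j = 0 then 1 else 0 :: real"
  shows "supports p 0 s e p (restrict (\<lambda>j. j) {..p}) (restrict (\<lambda>_. 0) {..p})"
    and "path_weights s e p (restrict (\<lambda>j. j) {..p}) (restrict (\<lambda>_. 0) {..p}) = s"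
proof -
  have e: "partial_sum e 0 = 0" "partial_sum e (Suc 0) = 1"
    by (simp_all add: partial_sum_def e_def)
  have w: "coupling s e i 0 = s i" if "i \<le> p" for i
    using partial_sum_mono[OF s, of i "Suc p"] partial_sum_mono[OF s, of "Suc i" "Suc p"] that
      partial_sum_nonneg[OF s, of i] partial_sum_nonneg[OF s, of "Suc i"] partial_sum_top[OF s]
    unfolding coupling_def e partial_sum_Suc[of s i] by simp
  then show "path_weights s e p (restrict (\<lambda>j. j) {..p}) (restrict (\<lambda>_. 0) {..p}) = s"
    using s by (auto simp: path_weights_def standard_simplex_def)
  have "(\<Sum>k\<le>p. coupling s e (restrict (\<lambda>j. j) {..p} k) (restrict (\<lambda>_. 0) {..p} k)) = sum s {..p}"
    using w by (intro sum.cong) auto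
  then show "supports p 0 s e p (restrict (\<lambda>j. j) {..p}) (restrict (\<lambda>_. 0) {..p})"
    using s restrict_id_in_\<Delta>_hom by (auto simp: supports_def lattice_paths_def standard_simplex_def inj_on_def intro!: \<Delta>_homI)
qed

lemma supports_diagonal:
  assumes s: "s \<in> standard_simplex p"
  shows "supports p p s s p (restrict (\<lambda>j. j) {..p}) (restrict (\<lambda>j. j) {..p})"
    and "path_weights s s p (restrict (\<lambda>j. j) {..p}) (restrict (\<lambda>j. j) {..p}) = s"
proof -
  have w: "coupling s s i i = s i" for i
    using partial_sum_mono[OF s, of i "Suc i"] by (simp add: coupling_def partial_sum_Suc[of s i])
  then show "path_weights s s p (restrict (\<lambda>j. j) {..p}) (restrict (\<lambda>j. j) {..p}) = s"
    using s by (auto simp: path_weights_def standard_simplex_def)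
  have "(\<Sum>k\<le>p. coupling s s (restrict (\<lambda>j. j) {..p} k) (restrict (\<lambda>j. j) {..p} k)) = sum s {..p}"
    using w by (intro sum.cong) auto
  then show "supports p p s s p (restrict (\<lambda>j. j) {..p}) (restrict (\<lambda>j. j) {..p})"
    using s restrict_id_in_\<Delta>_hom by (auto simp: supports_def lattice_paths_def standard_simplex_def inj_on_def)
qed

text \<open>At \<open>\<tau> = 1\<close> the cone has reached its first vertex, which
  \<open>fat_point_push\<close> along \<open>0 \<mapsto> 0\<close> identifies with the 0-simplex.
  This is the undivided interval, so it cuts nothing.\<close>

lemma refine_vertex:
  assumes X: "simplicial_space X" and x: "x \<in> topspace (level X p)" and s: "s \<in> standard_simplex p"
  shows "refine X (fat_point X p x s) (fat_cone 1 (fat_point simplicial_point q u t)) = fat_point X p x s"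
proof -
  let ?e = "\<lambda>j::nat. if j = 0 then 1 else 0 :: real"
  let ?\<theta> = "restrict (\<lambda>_. 0) {..0::nat}"
  have \<theta>: "?\<theta> \<in> \<Delta>_hom 0 (Suc q)" by (rule \<Delta>_homI) auto
  have e: "?e \<in> standard_simplex 0" by simp
  have "{k. k \<le> 0 \<and> ?\<theta> k = j} = (if j = 0 then {0} else {})" for j
    by auto
  then have "simplex_push 0 ?\<theta> ?e = ?e"
    by (simp add: simplex_push_def fun_eq_iff)
  then have "fat_cone 1 (fat_point simplicial_point q u t) = fat_point simplicial_point 0 () ?e"
    using fat_point_push[OF simplicial_space_simplicial_point e \<theta>, of u] by (simp add: fat_cone_point simplex_cone_1)
  then show ?thesis
    using refine_eq[OF X x s e supports_vertex(1)[OF s]] supports_vertex(2)[OF s] simplicial_space_act_id[OF X x]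
    by simp
qed

text \<open>At \<open>\<tau> = 0\<close> the new first piece has length zero, and the face relation
  deletes it.\<close>

lemma fat_cone_0:
  assumes "t \<in> standard_simplex p"
  shows "fat_cone 0 (fat_point simplicial_point p u t) = fat_point simplicial_point p u t"
  using fat_point_face[of 0 p u simplicial_point t] assms by (simp add: fat_cone_point simplex_cone_0)

theorem theorem7p2:
  fixes X :: "'a sspace" and Y :: "'b sspace"
  assumes "simplicial_space X" and "simplicial_space Y"
  shows "weak_homotopy_equivalence
           (fat_realisation (sprod X Y))
           (cg_prod (fat_realisation X) (fat_realisation Y))
           (\<lambda>z. (fat_map X (\<lambda>p. fst) z, fat_map Y (\<lambda>p. snd) z))"
proof -
  note X = assms(1) and Y = assms(2)
  interpret simplicial_space_pair X Y by standard (use assms in auto)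
  let ?W = "fat_realisation (sprod X Y)" and ?Z = "cg_prod (fat_realisation X) (fat_realisation Y)"
    and ?I = "top_of_set {0..1::real}"
  define F where "F z = (fat_map X (\<lambda>p. fst) z, fat_map Y (\<lambda>p. snd) z)" for z
  \<comment> \<open>Each factor is refined by the coned subdivision of the other. Labels are
    forgotten by \<open>to_point\<close> before coning, since only the simplicial point admits
    \<open>fat_cone\<close>.\<close>
  define H where "H = (\<lambda>(\<tau>, A, B). (refine X A (fat_cone \<tau> (to_point Y B)), refine Y B (fat_cone \<tau> (to_point X A))))"
  have F_point: "F (fat_point (sprod X Y) p (x, y) s) = (fat_point X p x s, fat_point Y p y s)" for p x y s
    by (simp add: F_def fat_map_fst_point fat_map_snd_point)
  have W_cases: thesis
    if "w \<in> topspace ?W" "\<And>p x y s. \<lbrakk>x \<in> topspace (level X p); y \<in> topspace (level Y p); s \<in> standard_simplex p;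
        w = fat_point (sprod X Y) p (x, y) s\<rbrakk> \<Longrightarrow> thesis" for w thesis
    using that by (auto elim!: fat_realisation_cases)
  have Z_cases: thesis
    if "z \<in> topspace ?Z" "\<And>p x s q y t. \<lbrakk>x \<in> topspace (level X p); s \<in> standard_simplex p;
        y \<in> topspace (level Y q); t \<in> standard_simplex q; z = (fat_point X p x s, fat_point Y q y t)\<rbrakk> \<Longrightarrow> thesis" for z thesis
    using that by (auto elim!: fat_realisation_cases)
  have "weak_homotopy_equivalence ?W ?Z F"
  proof (rule weak_homotopy_equivalence_retraction[where G = "\<lambda>(A, B). shuffle_map A B" and H = H])
    show "continuous_map ?W ?Z F"
      using continuous_map_fat_map_fst[of X Y] continuous_map_fat_map_snd[of X Y]
      by (simp add: continuous_map_into_cg_prod compactly_generated_fat_realisation F_def[abs_def] o_def)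
    show "continuous_map ?Z ?W (\<lambda>(A, B). shuffle_map A B)"
      by (rule continuous_map_shuffle_map)
    show "(case F w of (A, B) \<Rightarrow> shuffle_map A B) = w" if "w \<in> topspace ?W" for w
    proof (rule W_cases[OF that])
      fix p x y s
      assume x: "x \<in> topspace (level X p)" and y: "y \<in> topspace (level Y p)" and s: "s \<in> standard_simplex p"
        and w: "w = fat_point (sprod X Y) p (x, y) s"
      show ?thesis
        using shuffle_map_eq[OF x s y s supports_diagonal(1)[OF s]] supports_diagonal(2)[OF s]
          simplicial_space_act_id[OF X x] simplicial_space_act_id[OF Y y]
        by (simp add: w F_point path_point_def)
    qed
    show "continuous_map (prod_topology ?I ?Z) ?Z H"
    proof -
      let ?D = "prod_topology ?I ?Z"
      \<comment> \<open>Compactness of the interval makes the ordinary product compactly generated,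
        so maps from it into \<open>cg_prod\<close> can be checked by components.\<close>
      have D: "compactly_generated ?D"
        by (rule compactly_generated_prod_compact_Hausdorff_left)
          (auto simp: compactly_generated_cg_prod compact_space_subtopology Hausdorff_space_subtopology)
      have \<tau>: "continuous_map ?D ?I fst" by (rule continuous_map_fst)
      have snd: "continuous_map ?D ?Z snd" by (rule continuous_map_snd)
      note AB = continuous_map_cg_prod_components[OF snd]
      have A: "continuous_map ?D (fat_realisation X) (\<lambda>z. fst (snd z))"
        and B: "continuous_map ?D (fat_realisation Y) (\<lambda>z. snd (snd z))"
        using AB by auto
      note cone = continuous_map_compose_cg_prod[OF continuous_map_fat_cone D \<tau>]
      note coneA = cone[OF continuous_map_compose[OF A continuous_map_to_point[of X]]]
      note coneB = cone[OF continuous_map_compose[OF B continuous_map_to_point[of Y]]]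
      show ?thesis
        using continuous_map_compose_cg_prod[OF continuous_map_refine[OF X] D A coneB]
          continuous_map_compose_cg_prod[OF continuous_map_refine[OF Y] D B coneA]
        by (simp add: continuous_map_into_cg_prod D H_def o_def case_prod_unfold)
    qed
    show "H (0, z) = F (case z of (A, B) \<Rightarrow> shuffle_map A B)" if "z \<in> topspace ?Z" for z
    proof (rule Z_cases[OF that])
      fix p x s q y t
      assume x: "x \<in> topspace (level X p)" and s: "s \<in> standard_simplex p"
        and y: "y \<in> topspace (level Y q)" and t: "t \<in> standard_simplex q"
        and z: "z = (fat_point X p x s, fat_point Y q y t)"
      obtain n \<alpha> \<beta> where sup: "supports p q s t n \<alpha> \<beta>"
        by (rule supports_exists[OF s t])
      \<comment> \<open>The path that defines the inverse, with its components swapped, serves to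
        refine \<open>y\<close> by \<open>s\<close> and has the same weights, so both refinements
        come from one point of the product.\<close>
      show ?thesis
        using shuffle_map_eq[OF x s y t sup] refine_eq[OF X x s t sup] refine_eq[OF Y y t s supports_commute[OF sup]]
        by (simp add: H_def z to_point_point fat_cone_0 s t path_point_def F_point path_weights_commute[of t s])
    qed
    show "H (1, z) = z" if "z \<in> topspace ?Z" for z
      by (rule Z_cases[OF that]) (simp add: H_def to_point_point refine_vertex X Y)
    show "H (\<tau>, F w) \<in> F ` topspace ?W" if \<tau>: "\<tau> \<in> {0..1}" and "w \<in> topspace ?W" for \<tau> w
    proof (rule W_cases[OF that(2)])
      fix p x y s
      assume x: "x \<in> topspace (level X p)" and y: "y \<in> topspace (level Y p)" and s: "s \<in> standard_simplex p"
        and w: "w = fat_point (sprod X Y) p (x, y) s"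
      note c = simplex_cone_in_simplex[OF \<tau> s]
      \<comment> \<open>On the range of \<open>F\<close> both factors have the same subdivision
        \<open>s\<close> and are refined by the same cone on it. A single \<open>\<alpha>\<close>
        therefore acts on \<open>x\<close> and on \<open>y\<close> with common weights, which keeps
        the pair in the range.\<close>
      obtain n \<alpha> \<beta> where sup: "supports p (Suc p) s (simplex_cone \<tau> s) n \<alpha> \<beta>"
        by (rule supports_exists[OF s c])
      have "H (\<tau>, F w) = F (fat_point (sprod X Y) n (act X n p \<alpha> x, act Y n p \<alpha> y) (path_weights s (simplex_cone \<tau> s) n \<alpha> \<beta>))"
        using refine_eq[OF X x s c sup] refine_eq[OF Y y s c sup] fat_cone_point[OF \<tau>]
        by (simp add: H_def w F_point to_point_point)
      moreover have "fat_point (sprod X Y) n (act X n p \<alpha> x, act Y n p \<alpha> y) (path_weights s (simplex_cone \<tau> s) n \<alpha> \<beta>) \<in> topspace ?W"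
        using simplicial_space_act_in[OF X supports_\<Delta>_hom(1)[OF sup] x] simplicial_space_act_in[OF Y supports_\<Delta>_hom(1)[OF sup] y]
        by (intro fat_point_in path_weights_in_simplex[OF s c sup]) simp
      ultimately show ?thesis by blast
    qed
  qed
  then show ?thesis by (simp add: F_def[abs_def])
qed

end
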